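(* Let $f_1,\dots,f_m$ be smooth vector fields on $\mathbb{R}^d$ satisfying (F1) and Chow's condition (that is, the Lie algebra generated by $f_1,\dots,f_m$ spans $\mathbb{R}^d$ at every point $x\in\mathbb{R}^d$), and let $L\in C^2(\mathbb{R}^d\times\mathbb{R}^m;\mathbb{R})$ satisfy (L1), (L2) and (L3') (all stated in the context). Then there exist a continuous function $\chi:\mathbb{R}^d\to\mathbb{R}$ and a sequence $\lambda_n\downarrow0$ such that, for every $R\ge0$, $$\lim_{n\to\infty}v_{\lambda_n}(x)=\chi(x)\quad\text{uniformly on }\overline{B}_R .$$ Moreover: (i) $\chi(x)\ge0$ for all $x$, $\chi(x^* )=0$, and $\chi$ is locally Lipschitz continuous with respect to $d_{SR}$, that is, for every $R\ge0$ there is a constant $\ell_R\ge0$ such that $|\chi(x)-\chi(y)|\le\ell_R\,d_{SR}(x,y)$ for all $x,y\in\overline{B}_R$; (ii) $\chi$ is a viscosity solution of the ergodic Hamilton–Jacobi equation $H(x,D\chi(x))=0$, $x\in\mathbb{R}^d$.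
   Context: Notation: $\overline{B}_R$ is the closed Euclidean ball of radius $R$ centered at $0$. $F(x)=[f_1(x)|\cdots|f_m(x)]$ is the $d\times m$ matrix with columns $f_i(x)$, and the control system is $\dot\gamma(t)=F(\gamma(t))u(t)=\sum_i u_i(t)f_i(\gamma(t))$. For $s_0<s_1$, $x,y\in\mathbb{R}^d$, $\Gamma_{s_0,s_1}^{x\to}$ is the set of $(\gamma,u)\in AC([s_0,s_1];\mathbb{R}^d)\times L^2(s_0,s_1;\mathbb{R}^m)$ solving the system a.e. with $\gamma(s_0)=x$; $\Gamma_{s_0,s_1}^{\to y}$ is the same with $\gamma(s_1)=y$ instead; $\Gamma_{s_0,s_1}^{x\to y}=\Gamma_{s_0,s_1}^{x\to}\cap\Gamma_{s_0,s_1}^{\to y}$. Sub-Riemannian distance: $g(x,v)=\inf\{\sum_{i=1}^m u_i^2:\ v=\sum_i u_if_i(x)\}$ and $d_{SR}(x,y)=\inf_{(\gamma,u)\in\Gamma_{0,1}^{x\to y}}\int_0^1\sqrt{g(\gamma(t),\dot\gamma(t))}\,dt$; equivalently, $d_{SR}(x,y)$ is the infimum of the $T>0$ for which there is $(\gamma,u)\in\Gamma_{0,T}^{x\to y}$ with $|u(t)|\le1$ a.e. Hamiltonian: $H(x,p)=\sup_{u\in\mathbb{R}^m}\{\langle p,F(x)u\rangle-L(x,u)\}$. Discounted value function: for $\lambda>0$, $v_\lambda(x)=\inf\int_0^{\infty}e^{-\lambda t}L(\gamma(t),u(t))\,dt$, the infimum being over the set $\Gamma_{0,\infty}^{x\to}(e^{-\lambda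 t}dt)$ of pairs $(\gamma,u)\in L^\infty_{loc}(0,\infty;\mathbb{R}^d)\times L^2_{loc}(0,\infty;\mathbb{R}^m)$ whose restriction to $[0,T]$ lies in $\Gamma_{0,T}^{x\to}$ for all $T>0$ and with $\int_0^\infty e^{-\lambda t}|u(t)|^2dt<\infty$. Assumptions: (F1) There is $c_f\ge1$ with $|f_i(x)|\le c_f(1+|x|)$ for all $x\in\mathbb{R}^d$, $i=1,\dots,m$. (Chow's condition) The Lie algebra generated by $f_1,\dots,f_m$ spans $\mathbb{R}^d$ at every point $x\in\mathbb{R}^d$. (L1) There are a nondecreasing $\beta:[0,\infty)\to\mathbb{R}$ and $\ell_1>0$ such that for all $(x,u)$: $L(x,u)\le\beta(|x|)(1+|u|^2)$, $|D_xL(x,u)|\le\ell_1(1+|u|^2)$, $D_u^2L(x,u)\ge\frac1{\ell_1}$ (as quadratic forms). (L2) (with $u^*=0$) $L(x,u)\ge L(x,0)$ for all $(x,u)$. (L3') There is a compact set $\mathcal{K}\subset\mathbb{R}^d$ with $\min_{x\in\mathcal{K}}L(x,0)=0$ and $\inf_{x\in\mathbb{R}^d\setminus\mathcal{K}}L(x,0)>0$. The point $x^*\in\mathcal{K}$ is fixed with $L(x^*,0)=\min_{x\in\mathcal{K}}L(x,0)$.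
   Formalization: In (ii) the equation proved is H(x,−Dχ(x))=0: with H as defined and trajectories starting at x, the printed H(x,Dχ(x))=0 fails in general when L is not even in u; the two equations coincide when L(x,−u)=L(x,u). *)

theory Defs
  imports "HOL-Analysis.Analysis"
begin

subsection \<open>Regularity\<close>

text \<open>In finite dimension, a differentiable \<open>f\<close> has a derivative of class \<open>C\<^sup>k\<close> iff
  all the maps \<open>x \<mapsto> Df(x) v\<close> are of class \<open>C\<^sup>k\<close>; this avoids iterated spaces of linear maps.\<close>

primrec Ck :: "nat \<Rightarrow> ('a::euclidean_space \<Rightarrow> 'b::real_normed_vector) \<Rightarrow> bool" where
  "Ck 0 f \<longleftrightarrow> continuous_on UNIV f"
| "Ck (Suc k) f \<longleftrightarrow> (\<forall>x. f differentiable (at x)) \<and>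
     (\<forall>v. Ck k (\<lambda>x. frechet_derivative f (at x) v))"

definition smooth :: "('a::euclidean_space \<Rightarrow> 'b::real_normed_vector) \<Rightarrow> bool" where
  "smooth f \<longleftrightarrow> (\<forall>k. Ck k f)"

definition abs_continuous_on_interval :: "real \<Rightarrow> real \<Rightarrow> (real \<Rightarrow> 'a::real_normed_vector) \<Rightarrow> bool" where
  "abs_continuous_on_interval s0 s1 g \<longleftrightarrow>
     (\<forall>e>0. \<exists>d>0. \<forall>P. finite P \<longrightarrow>
        (\<forall>(a,b)\<in>P. s0 \<le> a \<and> a \<le> b \<and> b \<le> s1) \<longrightarrow>
        pairwise (\<lambda>I J. {fst I<..<snd I} \<inter> {fst J<..<snd J} = {}) P \<longrightarrow>
        (\<Sum>(a,b)\<in>P. b - a) < d \<longrightarrow>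
        (\<Sum>(a,b)\<in>P. norm (g b - g a)) < e)"

subsection \<open>Vector fields\<close>

definition lie_bracket ::
  "('a::euclidean_space \<Rightarrow> 'a) \<Rightarrow> ('a \<Rightarrow> 'a) \<Rightarrow> 'a \<Rightarrow> 'a" where
  "lie_bracket X Y = (\<lambda>x. frechet_derivative Y (at x) (X x) - frechet_derivative X (at x) (Y x))"

inductive_set generated_lie_algebra ::
  "('m \<Rightarrow> 'a::euclidean_space \<Rightarrow> 'a) \<Rightarrow> ('a \<Rightarrow> 'a) set"
  for f :: "'m \<Rightarrow> 'a \<Rightarrow> 'a" where
  generator: "f i \<in> generated_lie_algebra f"
| add: "X \<in> generated_lie_algebra f \<Longrightarrow> Y \<in> generated_lie_algebra f \<Longrightarrow>
    (\<lambda>x. X x + Y x) \<in> generated_lie_algebra f"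
| scale: "X \<in> generated_lie_algebra f \<Longrightarrow> (\<lambda>x. c *\<^sub>R X x) \<in> generated_lie_algebra f"
| bracket: "X \<in> generated_lie_algebra f \<Longrightarrow> Y \<in> generated_lie_algebra f \<Longrightarrow>
    lie_bracket X Y \<in> generated_lie_algebra f"

definition chow_condition :: "('m \<Rightarrow> 'a::euclidean_space \<Rightarrow> 'a) \<Rightarrow> bool" where
  "chow_condition f \<longleftrightarrow> (\<forall>x. span ((\<lambda>X. X x) ` generated_lie_algebra f) = UNIV)"

definition assumption_F1 :: "('m \<Rightarrow> 'a::euclidean_space \<Rightarrow> 'a) \<Rightarrow> bool" where
  "assumption_F1 f \<longleftrightarrow> (\<exists>cf\<ge>1. \<forall>x i. norm (f i x) \<le> cf * (1 + norm x))"

definition control_matrix :: "('m::finite \<Rightarrow> real^'d \<Rightarrow> real^'d) \<Rightarrow> real^'d \<Rightarrow> real^'m^'d" where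
  "control_matrix f x = (\<chi> i j. f j x $ i)"

subsection \<open>Controlled trajectories\<close>

text \<open>Controls are represented by functions rather than by classes modulo null sets, and
  the values of \<open>\<gamma>\<close> and \<open>u\<close> outside of \<open>[s0, s1]\<close> are irrelevant.\<close>

definition trajectories ::
  "('m::finite \<Rightarrow> real^'d \<Rightarrow> real^'d) \<Rightarrow> real \<Rightarrow> real \<Rightarrow> ((real \<Rightarrow> real^'d) \<times> (real \<Rightarrow> real^'m)) set" where
  "trajectories f s0 s1 = {(\<gamma>, u).
     abs_continuous_on_interval s0 s1 \<gamma> \<and>
     u \<in> borel_measurable (lebesgue_on {s0..s1}) \<and>
     integrable (lebesgue_on {s0..s1}) (\<lambda>t. (norm (u t))\<^sup>2) \<and>
     (AE t in lebesgue_on {s0..s1}.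
        (\<gamma> has_vector_derivative (control_matrix f (\<gamma> t) *v u t)) (at t))}"

definition trajectories_from ::
  "('m::finite \<Rightarrow> real^'d \<Rightarrow> real^'d) \<Rightarrow> real \<Rightarrow> real \<Rightarrow> real^'d \<Rightarrow>
    ((real \<Rightarrow> real^'d) \<times> (real \<Rightarrow> real^'m)) set" where
  "trajectories_from f s0 s1 x = {(\<gamma>, u) \<in> trajectories f s0 s1. \<gamma> s0 = x}"

definition trajectories_to ::
  "('m::finite \<Rightarrow> real^'d \<Rightarrow> real^'d) \<Rightarrow> real \<Rightarrow> real \<Rightarrow> real^'d \<Rightarrow>
    ((real \<Rightarrow> real^'d) \<times> (real \<Rightarrow> real^'m)) set" where
  "trajectories_to f s0 s1 y = {(\<gamma>, u) \<in> trajectories f s0 s1. \<gamma> s1 = y}"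

definition trajectories_between ::
  "('m::finite \<Rightarrow> real^'d \<Rightarrow> real^'d) \<Rightarrow> real \<Rightarrow> real \<Rightarrow> real^'d \<Rightarrow> real^'d \<Rightarrow>
    ((real \<Rightarrow> real^'d) \<times> (real \<Rightarrow> real^'m)) set" where
  "trajectories_between f s0 s1 x y = trajectories_from f s0 s1 x \<inter> trajectories_to f s0 s1 y"

text \<open>Membership of \<open>\<gamma>\<close> in \<open>L\<^sup>\<infinity>\<close>-loc and of \<open>u\<close> in \<open>L\<^sup>2\<close>-loc is implied by the condition
  on the restrictions to \<open>[0, T]\<close>.\<close>

definition trajectories_discounted ::
  "('m::finite \<Rightarrow> real^'d \<Rightarrow> real^'d) \<Rightarrow> real \<Rightarrow> real^'d \<Rightarrow>
    ((real \<Rightarrow> real^'d) \<times> (real \<Rightarrow> real^'m)) set" where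
  "trajectories_discounted f lam x = {(\<gamma>, u).
     (\<forall>T>0. (\<gamma>, u) \<in> trajectories_from f 0 T x) \<and>
     integrable (lebesgue_on {0..}) (\<lambda>t. exp (- lam * t) * (norm (u t))\<^sup>2)}"

subsection \<open>Sub-Riemannian distance\<close>

text \<open>The infimum over the empty set is \<open>\<infinity>\<close>.\<close>

definition sr_metric :: "('m::finite \<Rightarrow> real^'d \<Rightarrow> real^'d) \<Rightarrow> real^'d \<Rightarrow> real^'d \<Rightarrow> ennreal" where
  "sr_metric f x v = (INF u\<in>{u::real^'m. v = (\<Sum>i\<in>UNIV. (u $ i) *\<^sub>R f i x)}.
     ennreal (\<Sum>i\<in>UNIV. (u $ i)\<^sup>2))"

definition ennreal_root :: "ennreal \<Rightarrow> ennreal" where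
  "ennreal_root z = (if z = top then top else ennreal (sqrt (enn2real z)))"

definition sr_dist :: "('m::finite \<Rightarrow> real^'d \<Rightarrow> real^'d) \<Rightarrow> real^'d \<Rightarrow> real^'d \<Rightarrow> ennreal" where
  "sr_dist f x y = (INF (\<gamma>, u)\<in>trajectories_between f 0 1 x y.
     \<integral>\<^sup>+ t. ennreal_root (sr_metric f (\<gamma> t) (vector_derivative \<gamma> (at t))) \<partial>lebesgue_on {0..1})"

subsection \<open>Lagrangian\<close>

definition assumption_L1 :: "((real^'d) \<times> (real^'m) \<Rightarrow> real) \<Rightarrow> bool" where
  "assumption_L1 L \<longleftrightarrow> (\<exists>\<beta> l1. mono_on {0..} \<beta> \<and> l1 > 0 \<and>
     (\<forall>x u. L (x, u) \<le> \<beta> (norm x) * (1 + (norm u)\<^sup>2) \<and>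
        onorm (frechet_derivative (\<lambda>y. L (y, u)) (at x)) \<le> l1 * (1 + (norm u)\<^sup>2) \<and>
        (\<forall>w. frechet_derivative (\<lambda>v. frechet_derivative (\<lambda>v'. L (x, v')) (at v) w) (at u) w
              \<ge> 1 / l1 * (norm w)\<^sup>2)))"

definition assumption_L2 :: "((real^'d) \<times> (real^'m) \<Rightarrow> real) \<Rightarrow> bool" where
  "assumption_L2 L \<longleftrightarrow> (\<forall>x u. L (x, u) \<ge> L (x, 0))"

definition assumption_L3' :: "((real^'d) \<times> (real^'m) \<Rightarrow> real) \<Rightarrow> (real^'d) set \<Rightarrow> bool" where
  "assumption_L3' L K \<longleftrightarrow> compact K \<and>
     (\<exists>y. is_arg_min (\<lambda>x. L (x, 0)) (\<lambda>x. x \<in> K) y \<and> L (y, 0) = 0) \<and>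
     (INF x\<in>- K. ereal (L (x, 0))) > 0"

subsection \<open>Discounted value function\<close>

definition ext_integral :: "'a measure \<Rightarrow> ('a \<Rightarrow> real) \<Rightarrow> ereal" where
  "ext_integral M g =
     enn2ereal (\<integral>\<^sup>+ t. ennreal (g t) \<partial>M) - enn2ereal (\<integral>\<^sup>+ t. ennreal (- g t) \<partial>M)"

definition ext_discounted_value ::
  "('m::finite \<Rightarrow> real^'d \<Rightarrow> real^'d) \<Rightarrow> ((real^'d) \<times> (real^'m) \<Rightarrow> real) \<Rightarrow> real \<Rightarrow> real^'d \<Rightarrow> ereal" where
  "ext_discounted_value f L lam x = (INF (\<gamma>, u)\<in>trajectories_discounted f lam x.
     ext_integral (lebesgue_on {0..}) (\<lambda>t. exp (- lam * t) * L (\<gamma> t, u t)))"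

text \<open>If \<open>L \<ge> 0\<close>, which is a consequence of \<open>assumption_L2\<close> and \<open>assumption_L3'\<close>, the infimum lies
  between \<open>0\<close> and \<open>L (x, 0) / lam\<close>, the cost of the constant trajectory; hence no
  infinite value is truncated by \<open>real_of_ereal\<close>.\<close>

definition discounted_value ::
  "('m::finite \<Rightarrow> real^'d \<Rightarrow> real^'d) \<Rightarrow> ((real^'d) \<times> (real^'m) \<Rightarrow> real) \<Rightarrow> real \<Rightarrow> real^'d \<Rightarrow> real" where
  "discounted_value f L lam x = real_of_ereal (ext_discounted_value f L lam x)"

subsection \<open>Hamiltonian and viscosity solutions\<close>

text \<open>A pitfall about signs: with this Hamiltonian, value functions of problems in which the
  initial point of the trajectory is prescribed satisfy equations in \<open>H(x, - Dv)\<close>. Indeed,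
  the dynamic programming principle for \<open>v = discounted_value f L lam\<close> reads
  \<open>lam v(x) = inf\<^sub>u (\<langle>Dv(x), F(x)u\<rangle> + L(x, u)) = - H(x, - Dv(x))\<close>.\<close>

definition hamiltonian ::
  "('m::finite \<Rightarrow> real^'d \<Rightarrow> real^'d) \<Rightarrow> ((real^'d) \<times> (real^'m) \<Rightarrow> real) \<Rightarrow> real^'d \<Rightarrow> real^'d \<Rightarrow> ereal" where
  "hamiltonian f L x p = (SUP u. ereal (p \<bullet> (control_matrix f x *v u) - L (x, u)))"

definition viscosity_subsolution ::
  "('a::euclidean_space \<Rightarrow> 'a \<Rightarrow> ereal) \<Rightarrow> ('a \<Rightarrow> real) \<Rightarrow> bool" where
  "viscosity_subsolution G w \<longleftrightarrow> (\<forall>\<phi> x p. Ck 1 \<phi> \<longrightarrow> GDERIV \<phi> x :> p \<longrightarrow>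
     (\<forall>\<^sub>F y in nhds x. w y - \<phi> y \<le> w x - \<phi> x) \<longrightarrow> G x p \<le> 0)"

definition viscosity_supersolution ::
  "('a::euclidean_space \<Rightarrow> 'a \<Rightarrow> ereal) \<Rightarrow> ('a \<Rightarrow> real) \<Rightarrow> bool" where
  "viscosity_supersolution G w \<longleftrightarrow> (\<forall>\<phi> x p. Ck 1 \<phi> \<longrightarrow> GDERIV \<phi> x :> p \<longrightarrow>
     (\<forall>\<^sub>F y in nhds x. w y - \<phi> y \<ge> w x - \<phi> x) \<longrightarrow> G x p \<ge> 0)"

text \<open>Continuous viscosity solutions of \<open>G(x, Dw(x)) = 0\<close> on the whole space.\<close>

definition viscosity_solution ::
  "('a::euclidean_space \<Rightarrow> 'a \<Rightarrow> ereal) \<Rightarrow> ('a \<Rightarrow> real) \<Rightarrow> bool" where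
  "viscosity_solution G w \<longleftrightarrow>
     continuous_on UNIV w \<and> viscosity_subsolution G w \<and> viscosity_supersolution G w"

end

theory Submission
  imports Defs
begin

text \<open>Since \<open>L \<ge> 0\<close>, the value functions \<open>v lam\<close> increase as \<open>lam\<close> decreases, so along any sequence
  \<open>lam\<^sub>n\<close> decreasing to \<open>0\<close> they converge pointwise to their supremum \<open>chi\<close>, and everything rests on
  estimates that are uniform in \<open>lam\<close>. By the dynamic programming principle, \<open>v lam\<close> varies by at most
  \<open>C s\<close> along an integral curve of \<open>\<plusminus>f\<^sub>i\<close> of duration \<open>s\<close>, and Chow's condition turns this into
  equicontinuity: a nested commutator of flows run for time \<open>s\<close> moves \<open>y\<close> to \<open>y + s\<^sup>k X(y) + O(s\<^sup>k\<^sup>+\<^sup>1)\<close>,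
  where \<open>X\<close> is an iterated bracket of length \<open>k\<close>, so composing \<open>d\<close> such moves whose brackets form a basis
  gives a continuous perturbation of a linear isomorphism, and Brouwer's theorem shows that
  it covers a neighbourhood. Connectedness and \<open>v lam xstar = 0\<close> then give local bounds.
  The expansions use only Taylor's formula for smooth functions along flows, never the differentiability
  of a flow in its initial point.

  The equation for \<open>chi\<close> follows from the dynamic programming principle, tested with constant controls
  and with nearly optimal ones. For the Lipschitz bound, a trajectory with its pointwise minimal control
  is cut into short pieces, each of which is run at its own constant speed.\<close>

subsection \<open>Smooth functions and Lie derivatives\<close>

text \<open>The moves depend on their parameter through roots of it, so they are continuous but are
  linearized only at the parameter 0; this is why a fixed point theorem stands where the inverse
  function theorem would be expected. Maps are studied through their action on scalar smooth
  functions: a commutator of moves becomes a commutator of first-order operators, in which the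
  second derivatives cancel.

  Controls are only square integrable, so a nearly optimal trajectory need not stay near its start
  by itself. Locality is paid for by the cost: \<open>L\<close> is uniformly convex in the control
  and minimal at 0, hence grows at least like \<open>(norm u)^2 / (2 * l1)\<close>; a bounded cost
  over a short time then makes the integral of \<open>norm u\<close>, and with it the displacement,
  small.

  The Lipschitz bound rests on one balance: at speed \<open>m\<close> the cost of a piece is of
  order \<open>1 / m + m * (norm u)^2\<close> per unit of the old time, and
  \<open>m = 1 / norm u\<close> turns this into twice the length element.

  No limit of trajectories is ever taken: a test at \<open>chi\<close> uses one small
  \<open>lam\<close> for which \<open>v lam\<close> is uniformly close to
  \<open>chi\<close>.\<close>

lemma Ck_D: "Ck (Suc k) f \<Longrightarrow> Ck k f"
proof (induction k arbitrary: f)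
  case 0
  then show ?case
    by (auto intro!: differentiable_imp_continuous_on simp: differentiable_on_def intro: differentiable_at_withinI)
next
  case (Suc k)
  then show ?case by (metis Ck.simps(2))
qed

lemma Ck_le: "Ck k f \<Longrightarrow> j \<le> k \<Longrightarrow> Ck j f"
  by (induction k) (auto simp: le_Suc_eq dest: Ck_D simp del: Ck.simps(2))

lemma Ck_continuous: "Ck k f \<Longrightarrow> continuous_on UNIV f"
  using Ck_le[of k f 0] by simp

lemma Ck_SucI:
  assumes "\<And>x. (f has_derivative f' x) (at x)" and "\<And>v. Ck k (\<lambda>x. f' x v)"
  shows "Ck (Suc k) f"
proof -
  have "frechet_derivative f (at x) = f' x" for x
    using frechet_derivative_at[OF assms(1)] by metis
  then show ?thesis
    using assms differentiableI by (auto simp: differentiable_def)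
qed

lemma Ck_Suc_has_derivative:
  "Ck (Suc k) f \<Longrightarrow> (f has_derivative frechet_derivative f (at x)) (at x)"
  by (simp add: frechet_derivative_works[symmetric])

lemma Ck_const: "Ck k (\<lambda>x. c)"
proof (induction k arbitrary: c)
  case (Suc k)
  then show ?case by (intro Ck_SucI[where f'="\<lambda>x v. 0"]) auto
qed simp

lemma Ck_bounded_linear_comp:
  assumes "bounded_linear h" "Ck k f"
  shows "Ck k (\<lambda>x. h (f x))"
  using assms(2)
proof (induction k arbitrary: f)
  case 0
  then show ?case
    using assms(1) by (simp add: bounded_linear.continuous_on)
next
  case (Suc k)
  show ?case
  proof (rule Ck_SucI)
    show "((\<lambda>x. h (f x)) has_derivative (\<lambda>v. h (frechet_derivative f (at x) v))) (at x)" for x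
      by (rule bounded_linear.has_derivative[OF assms(1) Ck_Suc_has_derivative[OF Suc.prems]])
    show "Ck k (\<lambda>x. h (frechet_derivative f (at x) v))" for v
      using Suc by simp
  qed
qed

lemma Ck_bounded_linear: "bounded_linear h \<Longrightarrow> Ck k h"
proof (cases k)
  case 0
  then show "bounded_linear h \<Longrightarrow> Ck k h"
    by (simp add: linear_continuous_on)
next
  case (Suc j)
  then show "bounded_linear h \<Longrightarrow> Ck k h"
    by (auto intro!: Ck_SucI[where f'="\<lambda>x. h"] Ck_const bounded_linear_imp_has_derivative simp del: Ck.simps(2))
qed

lemma Ck_add:
  assumes "Ck k f" "Ck k g"
  shows "Ck k (\<lambda>x. f x + g x)"
  using assms
proof (induction k arbitrary: f g)
  case 0
  then show ?case by (simp add: continuous_on_add)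
next
  case (Suc k)
  show ?case
  proof (rule Ck_SucI)
    show "((\<lambda>x. f x + g x) has_derivative
        (\<lambda>v. frechet_derivative f (at x) v + frechet_derivative g (at x) v)) (at x)" for x
      by (intro has_derivative_add Ck_Suc_has_derivative[OF Suc.prems(1)]
          Ck_Suc_has_derivative[OF Suc.prems(2)])
    show "Ck k (\<lambda>x. frechet_derivative f (at x) v + frechet_derivative g (at x) v)" for v
      using Suc by simp
  qed
qed

lemma Ck_sum: "(\<And>i. i \<in> I \<Longrightarrow> Ck k (f i)) \<Longrightarrow> Ck k (\<lambda>x. \<Sum>i\<in>I. f i x)"
  by (induction I rule: infinite_finite_induct) (auto intro: Ck_const Ck_add)

lemma Ck_bilinear:
  assumes bl: "bounded_bilinear pr" and "Ck k f" "Ck k g"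
  shows "Ck k (\<lambda>x. pr (f x) (g x))"
  using assms(2,3)
proof (induction k arbitrary: f g)
  case 0
  then show ?case by (simp add: bounded_bilinear.continuous_on[OF bl])
next
  case (Suc k)
  show ?case
  proof (rule Ck_SucI)
    show "((\<lambda>x. pr (f x) (g x)) has_derivative
        (\<lambda>v. pr (f x) (frechet_derivative g (at x) v) + pr (frechet_derivative f (at x) v) (g x))) (at x)" for x
      by (intro bounded_bilinear.FDERIV[OF bl] Ck_Suc_has_derivative[OF Suc.prems(1)]
          Ck_Suc_has_derivative[OF Suc.prems(2)])
    show "Ck k (\<lambda>x. pr (f x) (frechet_derivative g (at x) v) + pr (frechet_derivative f (at x) v) (g x))" for v
      using Suc Ck_D[OF Suc.prems(1)] Ck_D[OF Suc.prems(2)] by (intro Ck_add) auto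
  qed
qed

lemma smooth_Ck: "smooth f \<Longrightarrow> Ck k f"
  by (simp add: smooth_def)

lemma smooth_has_derivative:
  "smooth f \<Longrightarrow> (f has_derivative frechet_derivative f (at x)) (at x)"
  using Ck_Suc_has_derivative smooth_Ck by blast

lemma smooth_continuous: "smooth f \<Longrightarrow> continuous_on S f"
  using smooth_Ck[of f 0] continuous_on_subset by auto

lemma smooth_directional: "smooth f \<Longrightarrow> smooth (\<lambda>x. frechet_derivative f (at x) v)"
  unfolding smooth_def
proof
  show "\<forall>k. Ck k f \<Longrightarrow> Ck k (\<lambda>x. frechet_derivative f (at x) v)" for k
    using Ck.simps(2)[of k f] by blast
qed

lemma smooth_const: "smooth (\<lambda>x. c)"
  by (simp add: smooth_def Ck_const)

lemma smooth_add: "smooth f \<Longrightarrow> smooth g \<Longrightarrow> smooth (\<lambda>x. f x + g x)"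
  by (simp add: smooth_def Ck_add)

lemma smooth_sum: "(\<And>i. i \<in> I \<Longrightarrow> smooth (f i)) \<Longrightarrow> smooth (\<lambda>x. \<Sum>i\<in>I. f i x)"
  by (simp add: smooth_def Ck_sum)

lemma smooth_bounded_linear_comp: "bounded_linear h \<Longrightarrow> smooth f \<Longrightarrow> smooth (\<lambda>x. h (f x))"
  by (simp add: smooth_def Ck_bounded_linear_comp)

lemma smooth_scaleR: "smooth f \<Longrightarrow> smooth (\<lambda>x. c *\<^sub>R f x)"
  by (rule smooth_bounded_linear_comp[OF bounded_linear_scaleR_right])

lemma smooth_minus: "smooth f \<Longrightarrow> smooth (\<lambda>x. - f x)"
  using smooth_scaleR[of f "-1"] by simp

lemma smooth_diff: "smooth f \<Longrightarrow> smooth g \<Longrightarrow> smooth (\<lambda>x. f x - g x)"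
  using smooth_add[OF _ smooth_minus] by fastforce

lemma smooth_inner_left: "smooth (\<lambda>x. x \<bullet> b)"
  by (simp add: smooth_def Ck_bounded_linear bounded_linear_inner_left)

text \<open>The values may lie in any normed space, so that the operator also acts on vector fields
  and the Lie bracket is the difference of two of its instances.\<close>

definition lie_derivative :: "('a::euclidean_space \<Rightarrow> 'a) \<Rightarrow> ('a \<Rightarrow> 'b::real_normed_vector) \<Rightarrow> 'a \<Rightarrow> 'b" where
  "lie_derivative X g = (\<lambda>x. frechet_derivative g (at x) (X x))"

text \<open>\<open>Ck\<close> speaks of derivatives in fixed directions, whereas here the direction
  \<open>X x\<close> varies. Expanding \<open>X x\<close> in the basis turns the Lie derivative into
  a finite sum of products of \<open>Ck k\<close> functions.\<close>

lemma lie_derivative_Ck: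
  fixes X :: "'a::euclidean_space \<Rightarrow> 'a" and g :: "'a \<Rightarrow> 'b::real_normed_vector"
  assumes "Ck k X" "Ck (Suc k) g"
  shows "Ck k (lie_derivative X g)"
proof -
  have "lie_derivative X g = (\<lambda>x. \<Sum>b\<in>Basis. (X x \<bullet> b) *\<^sub>R frechet_derivative g (at x) b)"
  proof
    fix x
    have lin: "linear (frechet_derivative g (at x))"
      using Ck_Suc_has_derivative[OF assms(2)] has_derivative_linear by blast
    have "lie_derivative X g x = frechet_derivative g (at x) (\<Sum>b\<in>Basis. (X x \<bullet> b) *\<^sub>R b)"
      by (simp add: lie_derivative_def euclidean_representation)
    also have "\<dots> = (\<Sum>b\<in>Basis. (X x \<bullet> b) *\<^sub>R frechet_derivative g (at x) b)"
      by (simp add: linear_sum[OF lin] linear_scale[OF lin])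
    finally show "lie_derivative X g x = (\<Sum>b\<in>Basis. (X x \<bullet> b) *\<^sub>R frechet_derivative g (at x) b)" .
  qed
  moreover have "Ck k (\<lambda>x. (X x \<bullet> b) *\<^sub>R frechet_derivative g (at x) b)" for b
    using assms
    by (intro Ck_bilinear[OF bounded_bilinear_scaleR]
        Ck_bounded_linear_comp[OF bounded_linear_inner_left, where f=X]) auto
  ultimately show ?thesis by (simp add: Ck_sum)
qed

lemma smooth_lie_derivative: "smooth X \<Longrightarrow> smooth g \<Longrightarrow> smooth (lie_derivative X g)"
  unfolding smooth_def using lie_derivative_Ck by blast

lemma lie_bracket_lie_derivative: "lie_bracket X Y = (\<lambda>x. lie_derivative X Y x - lie_derivative Y X x)"
  by (simp add: lie_bracket_def lie_derivative_def)

lemma smooth_lie_bracket: "smooth X \<Longrightarrow> smooth Y \<Longrightarrow> smooth (lie_bracket X Y)"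
  unfolding lie_bracket_lie_derivative by (intro smooth_diff smooth_lie_derivative)

section \<open>Symmetry of second derivatives and commutators of Lie derivatives\<close>

lemma second_difference_mvt:
  fixes g :: "'a::euclidean_space \<Rightarrow> real"
  assumes g: "Ck 2 g" and s: "s > 0"
  shows "\<exists>\<xi> \<eta>. 0 < \<xi> \<and> \<xi> < s \<and> 0 < \<eta> \<and> \<eta> < s \<and>
    g (x + s *\<^sub>R u + s *\<^sub>R v) - g (x + s *\<^sub>R u) - g (x + s *\<^sub>R v) + g x
      = s\<^sup>2 * frechet_derivative (\<lambda>y. frechet_derivative g (at y) u) (at (x + \<xi> *\<^sub>R u + \<eta> *\<^sub>R v)) v"
proof -
  let ?D = "\<lambda>y. frechet_derivative g (at y) u"
  have g1: "Ck (Suc (Suc 0)) g" using g by (simp add: numeral_2_eq_2)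
  then have D1: "Ck (Suc 0) ?D" by simp
  have chain: "((\<lambda>t. h (p + t *\<^sub>R w)) has_real_derivative frechet_derivative h (at (p + t *\<^sub>R w)) w) (at t)"
    if "\<And>y. (h has_derivative frechet_derivative h (at y)) (at y)" for h :: "'a \<Rightarrow> real" and p w t
  proof -
    have "((\<lambda>t. h (p + t *\<^sub>R w)) has_derivative (\<lambda>r. frechet_derivative h (at (p + t *\<^sub>R w)) (r *\<^sub>R w))) (at t)"
      by (rule has_derivative_compose[OF _ that]) (auto intro!: derivative_eq_intros)
    moreover have "frechet_derivative h (at (p + t *\<^sub>R w)) (r *\<^sub>R w) = frechet_derivative h (at (p + t *\<^sub>R w)) w * r" for r
      using linear_scale[OF has_derivative_linear[OF that]] by simp
    ultimately show ?thesis by (simp add: has_field_derivative_def)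
  qed
  \<comment> \<open>\<open>h\<close> is an increment in direction \<open>v\<close>; a mean value in
    direction \<open>u\<close>, then one in direction \<open>v\<close>, produce the mixed derivative
    at an intermediate point.\<close>
  define h where "h t = g (x + s *\<^sub>R v + t *\<^sub>R u) - g (x + t *\<^sub>R u)" for t
  have "(h has_real_derivative ?D (x + s *\<^sub>R v + t *\<^sub>R u) - ?D (x + t *\<^sub>R u)) (at t)" for t
    unfolding h_def by (intro DERIV_diff chain Ck_Suc_has_derivative[OF g1])
  then obtain \<xi> where \<xi>: "0 < \<xi>" "\<xi> < s"
    "h s - h 0 = (s - 0) * (?D (x + s *\<^sub>R v + \<xi> *\<^sub>R u) - ?D (x + \<xi> *\<^sub>R u))"
    using MVT2[OF s, of h "\<lambda>t. ?D (x + s *\<^sub>R v + t *\<^sub>R u) - ?D (x + t *\<^sub>R u)"] by blast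
  have "((\<lambda>t. ?D (x + \<xi> *\<^sub>R u + t *\<^sub>R v)) has_real_derivative
      frechet_derivative ?D (at (x + \<xi> *\<^sub>R u + t *\<^sub>R v)) v) (at t)" for t
    by (intro chain Ck_Suc_has_derivative[OF D1])
  then obtain \<eta> where \<eta>: "0 < \<eta>" "\<eta> < s"
    "?D (x + \<xi> *\<^sub>R u + s *\<^sub>R v) - ?D (x + \<xi> *\<^sub>R u + 0 *\<^sub>R v)
       = (s - 0) * frechet_derivative ?D (at (x + \<xi> *\<^sub>R u + \<eta> *\<^sub>R v)) v"
    using MVT2[OF s, of "\<lambda>t. ?D (x + \<xi> *\<^sub>R u + t *\<^sub>R v)"
        "\<lambda>t. frechet_derivative ?D (at (x + \<xi> *\<^sub>R u + t *\<^sub>R v)) v"] by blast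
  have "g (x + s *\<^sub>R u + s *\<^sub>R v) - g (x + s *\<^sub>R u) - g (x + s *\<^sub>R v) + g x = h s - h 0"
    by (simp add: h_def algebra_simps)
  also have "\<dots> = s\<^sup>2 * frechet_derivative ?D (at (x + \<xi> *\<^sub>R u + \<eta> *\<^sub>R v)) v"
    using \<xi>(3) \<eta>(3) by (simp add: algebra_simps power2_eq_square)
  finally show ?thesis using \<xi> \<eta> by blast
qed

lemma second_derivative_limit:
  fixes g :: "'a::euclidean_space \<Rightarrow> real"
  assumes g: "Ck 2 g"
  shows "((\<lambda>s. (g (x + s *\<^sub>R u + s *\<^sub>R v) - g (x + s *\<^sub>R u) - g (x + s *\<^sub>R v) + g x) / s\<^sup>2)
     \<longlongrightarrow> frechet_derivative (\<lambda>y. frechet_derivative g (at y) u) (at x) v) (at_right 0)"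
proof -
  let ?E = "\<lambda>y. frechet_derivative (\<lambda>y. frechet_derivative g (at y) u) (at y) v"
  have "continuous_on UNIV ?E"
    using g by (simp add: numeral_2_eq_2)
  then have E: "isCont ?E x" by (simp add: continuous_on_eq_continuous_at)
  define Q where "Q s = (g (x + s *\<^sub>R u + s *\<^sub>R v) - g (x + s *\<^sub>R u) - g (x + s *\<^sub>R v) + g x) / s\<^sup>2" for s
  have "(Q \<longlongrightarrow> ?E x) (at_right 0)"
  proof (rule tendstoI)
    fix e :: real assume "e > 0"
    then obtain d where d: "d > 0" "\<And>y. dist y x < d \<Longrightarrow> dist (?E y) (?E x) < e"
      using E unfolding continuous_at by (metis (no_types, lifting) E continuous_at_eps_delta)
    \<comment> \<open>The intermediate point lies within \<open>s * (norm u + norm v)\<close> of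
      \<open>x\<close>; the added 1 keeps the divisor positive.\<close>
    define c where "c = d / (norm u + norm v + 1)"
    have c: "c > 0" unfolding c_def using d by (simp add: add_nonneg_pos)
    have "dist (Q s) (?E x) < e" if s: "0 < s" "s < c" for s
    proof -
      obtain \<xi> \<eta> where *: "0 < \<xi>" "\<xi> < s" "0 < \<eta>" "\<eta> < s"
        "g (x + s *\<^sub>R u + s *\<^sub>R v) - g (x + s *\<^sub>R u) - g (x + s *\<^sub>R v) + g x
          = s\<^sup>2 * ?E (x + \<xi> *\<^sub>R u + \<eta> *\<^sub>R v)"
        using second_difference_mvt[OF g s(1)] by blast
      have "norm (\<xi> *\<^sub>R u + \<eta> *\<^sub>R v) \<le> \<xi> * norm u + \<eta> * norm v"
        using * by (metis abs_of_pos norm_scaleR norm_triangle_ineq)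
      also have "\<dots> \<le> s * norm u + s * norm v"
        using * by (intro add_mono mult_right_mono) auto
      also have "\<dots> < s * (norm u + norm v + 1)" using s by (simp add: algebra_simps)
      also have "\<dots> \<le> c * (norm u + norm v + 1)"
        using s by (intro mult_right_mono) (auto simp: add_nonneg_nonneg)
      also have "\<dots> = d"
        unfolding c_def using add_nonneg_pos[of "norm u + norm v" 1] by simp
      finally have "dist (x + \<xi> *\<^sub>R u + \<eta> *\<^sub>R v) x < d"
        by (simp add: dist_norm add.assoc)
      moreover have "Q s = ?E (x + \<xi> *\<^sub>R u + \<eta> *\<^sub>R v)"
        using * s by (simp add: Q_def)
      ultimately show ?thesis using d(2) by simp
    qed
    then show "\<forall>\<^sub>F s in at_right 0. dist (Q s) (?E x) < e"
      using eventually_at_right_less[of "0::real"] c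
      by (auto simp: eventually_at_right_field intro!: exI[of _ c])
  qed
  then show ?thesis unfolding Q_def .
qed

text \<open>Exchanging \<open>u\<close> and \<open>v\<close> leaves the second difference quotient
  unchanged, and both mixed derivatives are its limit.\<close>

lemma second_derivative_symmetric_real:
  fixes g :: "'a::euclidean_space \<Rightarrow> real"
  assumes "Ck 2 g"
  shows "frechet_derivative (\<lambda>y. frechet_derivative g (at y) u) (at x) v
    = frechet_derivative (\<lambda>y. frechet_derivative g (at y) v) (at x) u"
proof -
  have "(\<lambda>s. (g (x + s *\<^sub>R v + s *\<^sub>R u) - g (x + s *\<^sub>R v) - g (x + s *\<^sub>R u) + g x) / s\<^sup>2)
    = (\<lambda>s. (g (x + s *\<^sub>R u + s *\<^sub>R v) - g (x + s *\<^sub>R u) - g (x + s *\<^sub>R v) + g x) / s\<^sup>2)"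
    by (rule ext) (simp add: algebra_simps)
  then show ?thesis
    by (intro tendsto_unique[OF trivial_limit_at_right_real second_derivative_limit[OF assms, of x u v]])
       (use second_derivative_limit[OF assms, of x v u] in simp)
qed

text \<open>The two iterated derivatives share their second-order part because the Hessian of
  \<open>g\<close> is symmetric; their first-order parts differ by \<open>g\<close> differentiated
  along the bracket.\<close>

lemma lie_derivative_lie_bracket:
  fixes g :: "'a::euclidean_space \<Rightarrow> real"
  assumes X: "smooth X" and Y: "smooth Y" and g: "smooth g"
  shows "lie_derivative (lie_bracket X Y) g x = lie_derivative X (lie_derivative Y g) x - lie_derivative Y (lie_derivative X g) x"
proof -
  have g2: "Ck 2 g" using g smooth_Ck by blast
  let ?H = "\<lambda>b v. frechet_derivative (\<lambda>y. frechet_derivative g (at y) b) (at x) v"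
  have ling: "linear (frechet_derivative g (at y))" for y
    using smooth_has_derivative[OF g] has_derivative_linear by blast
  have linH: "linear (?H b)" for b
    using smooth_has_derivative[OF smooth_directional[OF g]] has_derivative_linear by blast
  \<comment> \<open>The product rule splits the iterated derivative into a part where
    \<open>W\<close> is differentiated and the Hessian of \<open>g\<close> at \<open>W x\<close> and
    \<open>Z x\<close>.\<close>
  have key: "lie_derivative Z (lie_derivative W g) x = frechet_derivative g (at x) (lie_derivative Z W x) + (\<Sum>b\<in>Basis. (W x \<bullet> b) * ?H b (Z x))"
    if W: "smooth W" for Z W
  proof -
    have eq: "lie_derivative W g = (\<lambda>y. \<Sum>b\<in>Basis. (W y \<bullet> b) * frechet_derivative g (at y) b)"
    proof
      fix y
      have "lie_derivative W g y = frechet_derivative g (at y) (\<Sum>b\<in>Basis. (W y \<bullet> b) *\<^sub>R b)"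
        by (simp add: lie_derivative_def euclidean_representation)
      then show "lie_derivative W g y = (\<Sum>b\<in>Basis. (W y \<bullet> b) * frechet_derivative g (at y) b)"
        by (simp add: linear_sum[OF ling] linear_scale[OF ling])
    qed
    have "((\<lambda>y. \<Sum>b\<in>Basis. (W y \<bullet> b) * frechet_derivative g (at y) b) has_derivative
       (\<lambda>v. \<Sum>b\<in>Basis. (W x \<bullet> b) * ?H b v + (frechet_derivative W (at x) v \<bullet> b) * frechet_derivative g (at x) b)) (at x)"
      by (intro has_derivative_sum has_derivative_mult has_derivative_inner_left
          smooth_has_derivative W smooth_directional g)
    then have "frechet_derivative (lie_derivative W g) (at x) =
       (\<lambda>v. \<Sum>b\<in>Basis. (W x \<bullet> b) * ?H b v + (frechet_derivative W (at x) v \<bullet> b) * frechet_derivative g (at x) b)"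
      unfolding eq by (rule frechet_derivative_at[symmetric])
    then have "lie_derivative Z (lie_derivative W g) x =
       (\<Sum>b\<in>Basis. (W x \<bullet> b) * ?H b (Z x)) + (\<Sum>b\<in>Basis. (lie_derivative Z W x \<bullet> b) * frechet_derivative g (at x) b)"
      by (simp add: lie_derivative_def[of Z] sum.distrib)
    also have "(\<Sum>b\<in>Basis. (lie_derivative Z W x \<bullet> b) * frechet_derivative g (at x) b)
       = frechet_derivative g (at x) (\<Sum>b\<in>Basis. (lie_derivative Z W x \<bullet> b) *\<^sub>R b)"
      by (simp add: linear_sum[OF ling] linear_scale[OF ling])
    finally show ?thesis by (simp add: euclidean_representation)
  qed
  have exp: "?H b (Z x) = (\<Sum>c\<in>Basis. (Z x \<bullet> c) * ?H b c)" for b Z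
  proof -
    have "?H b (Z x) = ?H b (\<Sum>c\<in>Basis. (Z x \<bullet> c) *\<^sub>R c)"
      by (simp add: euclidean_representation)
    then show ?thesis by (simp add: linear_sum[OF linH] linear_scale[OF linH])
  qed
  have "(\<Sum>b\<in>Basis. (Y x \<bullet> b) * ?H b (X x)) = (\<Sum>b\<in>Basis. \<Sum>c\<in>Basis. (Y x \<bullet> b) * ((X x \<bullet> c) * ?H b c))"
    by (simp add: exp[of _ X] sum_distrib_left)
  also have "\<dots> = (\<Sum>c\<in>Basis. \<Sum>b\<in>Basis. (X x \<bullet> c) * ((Y x \<bullet> b) * ?H c b))"
    by (subst sum.swap) (simp add: second_derivative_symmetric_real[OF g2, of _ x] mult.left_commute)
  also have "\<dots> = (\<Sum>b\<in>Basis. (X x \<bullet> b) * ?H b (Y x))"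
    by (simp add: exp[of _ Y] sum_distrib_left)
  finally show ?thesis
    using linear_diff[OF ling]
    by (simp add: key[OF X] key[OF Y] lie_bracket_lie_derivative lie_derivative_def[of "\<lambda>x. lie_derivative X Y x - lie_derivative Y X x"])
qed

text \<open>The ball is convex, so a bound on the derivative is enough. \<open>Ck\<close> yields
  continuity of the derivative one direction at a time; the sum of the norms of the partial
  derivatives is continuous and dominates the operator norm.\<close>

lemma C1_lipschitz_on_cball:
  fixes g :: "'a::euclidean_space \<Rightarrow> 'b::real_normed_vector"
  assumes "Ck (Suc 0) g"
  shows "\<exists>K\<ge>0. \<forall>x\<in>cball a R. \<forall>y\<in>cball a R. norm (g x - g y) \<le> K * norm (x - y)"
proof -
  let ?D = "\<lambda>b x. norm (frechet_derivative g (at x) b)"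
  have cont: "continuous_on (cball a R) (\<lambda>x. \<Sum>b\<in>Basis. ?D b x)"
    using assms by (intro continuous_on_sum continuous_on_norm) (auto intro: continuous_on_subset)
  then have "bounded ((\<lambda>x. \<Sum>b\<in>Basis. ?D b x) ` cball a R)"
    by (intro compact_imp_bounded compact_continuous_image) auto
  then obtain K where K: "K > 0" "\<And>x. x \<in> cball a R \<Longrightarrow> (\<Sum>b\<in>Basis. ?D b x) \<le> K"
    unfolding bounded_pos by (metis abs_le_D1 image_eqI real_norm_def)
  have "norm (frechet_derivative g (at x) v) \<le> K * norm v" if x: "x \<in> cball a R" for x v
  proof -
    have lin: "linear (frechet_derivative g (at x))"
      using Ck_Suc_has_derivative[OF assms] has_derivative_linear by blast
    have "norm (frechet_derivative g (at x) v) = norm (frechet_derivative g (at x) (\<Sum>b\<in>Basis. (v \<bullet> b) *\<^sub>R b))"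
      by (simp add: euclidean_representation)
    also have "\<dots> = norm (\<Sum>b\<in>Basis. (v \<bullet> b) *\<^sub>R frechet_derivative g (at x) b)"
      by (simp add: linear_sum[OF lin] linear_scale[OF lin])
    also have "\<dots> \<le> (\<Sum>b\<in>Basis. norm v * ?D b x)"
      by (intro sum_norm_le) (auto intro!: mult_right_mono simp: Basis_le_norm)
    also have "\<dots> \<le> K * norm v"
      using mult_left_mono[OF K(2)[OF x], of "norm v"] by (simp add: sum_distrib_left[symmetric] mult.commute)
    finally show ?thesis .
  qed
  then have "norm (g x - g y) \<le> K * norm (x - y)" if "x \<in> cball a R" "y \<in> cball a R" for x y
    using that K(1) Ck_Suc_has_derivative[OF assms]
    by (intro differentiable_bound[where S="cball a R" and f'="\<lambda>x. frechet_derivative g (at x)"])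
       (auto intro!: onorm_bound intro: has_derivative_at_withinI)
  then show ?thesis using K(1) by (intro exI[of _ K]) auto
qed

subsection \<open>Flows of vector fields\<close>

text \<open>A short-time form of Gronwall's inequality: when \<open>h * K \<le> 1/2\<close>, the
  largest distance exceeds the initial one by at most half of itself, which can be absorbed.\<close>

lemma lipschitz_solutions_close:
  fixes X :: "'a::euclidean_space \<Rightarrow> 'a"
  assumes lip: "\<And>x y. norm (X x - X y) \<le> K * norm (x - y)" and K: "K \<ge> 0"
    and h: "h \<ge> 0" "h * K \<le> 1/2"
    and g1: "\<And>t. t \<in> {0..h} \<Longrightarrow> (g1 has_vector_derivative X (g1 t)) (at t within {0..h})"
    and g2: "\<And>t. t \<in> {0..h} \<Longrightarrow> (g2 has_vector_derivative X (g2 t)) (at t within {0..h})"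
    and t: "t \<in> {0..h}"
  shows "norm (g1 t - g2 t) \<le> 2 * norm (g1 0 - g2 0)"
proof -
  let ?d = "\<lambda>t. g1 t - g2 t"
  have der: "(?d has_vector_derivative X (g1 t) - X (g2 t)) (at t within {0..h})" if "t \<in> {0..h}" for t
    using g1[OF that] g2[OF that] by (rule has_vector_derivative_diff)
  then have "continuous_on {0..h} ?d"
    by (meson continuous_on_eq_continuous_within has_vector_derivative_continuous)
  then have "continuous_on {0..h} (\<lambda>t. norm (?d t))" by (rule continuous_on_norm)
  then obtain m where m: "m \<in> {0..h}" "\<And>t. t \<in> {0..h} \<Longrightarrow> norm (?d t) \<le> norm (?d m)"
    using continuous_attains_sup[of "{0..h}"] h by fastforce
  let ?B = "norm (?d m)"
  have "norm (?d m - ?d 0) \<le> K * ?B * norm (m - 0)"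
  proof (rule differentiable_bound[where S="{0..h}"])
    show "(?d has_derivative (\<lambda>r. r *\<^sub>R (X (g1 t) - X (g2 t)))) (at t within {0..h})" if "t \<in> {0..h}" for t
      using der[OF that] by (simp add: has_vector_derivative_def)
    show "onorm (\<lambda>r. r *\<^sub>R (X (g1 t) - X (g2 t))) \<le> K * ?B" if t: "t \<in> {0..h}" for t
    proof (rule onorm_bound)
      show "norm (r *\<^sub>R (X (g1 t) - X (g2 t))) \<le> K * ?B * norm r" for r
        using lip[of "g1 t" "g2 t"] mult_left_mono[OF m(2)[OF t] K]
        by (simp add: mult.commute[of _ "\<bar>r\<bar>"] mult_left_mono order_trans)
    qed (use K in simp)
  qed (use m h in auto)
  also have "\<dots> \<le> ?B / 2"
  proof -
    have "K * ?B * norm (m - 0) \<le> K * ?B * h"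
      using m K by (intro mult_left_mono) auto
    also have "\<dots> = (h * K) * ?B" by simp
    also have "\<dots> \<le> (1/2) * ?B" using h by (intro mult_right_mono) auto
    finally show ?thesis by simp
  qed
  finally have "?B \<le> 2 * norm (?d 0)"
    using norm_triangle_sub[of "?d m" "?d 0"] by simp
  then show ?thesis using m(2)[OF t] by simp
qed

text \<open>Picard iteration; the integral operator halves distances because
  \<open>h * K \<le> 1/2\<close>.\<close>

lemma lipschitz_solution_exists:
  fixes X :: "'a::euclidean_space \<Rightarrow> 'a"
  assumes lip: "\<And>x y. norm (X x - X y) \<le> K * norm (x - y)" and K: "K \<ge> 0"
    and h: "h > 0" "h * K \<le> 1/2"
  shows "\<exists>g. g 0 = y \<and> (\<forall>t\<in>{0..h}. (g has_vector_derivative X (g t)) (at t within {0..h}))"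
proof -
  have "K-lipschitz_on UNIV X" using lip K by (auto simp: lipschitz_on_def dist_norm)
  then have "continuous_on UNIV X" by (rule lipschitz_on_continuous_on)
  then have contX: "continuous_on S (\<lambda>t. X (u t))" if "continuous_on S u" for S and u :: "real \<Rightarrow> 'a"
    using that continuous_on_compose2 by blast
  \<comment> \<open>Clamping the time to \<open>{0..h}\<close> lets the operator act on the bounded
    continuous functions on the whole line, a complete space.\<close>
  define c where "c t = max 0 (min h t)" for t :: real
  have c: "continuous_on UNIV c" "c t \<in> {0..h}" "t \<in> {0..h} \<Longrightarrow> c t = t" for t
    unfolding c_def using h by (auto intro!: continuous_intros)
  define P where "P u t = y + integral {0..c t} (\<lambda>s. X (u s))" for u :: "real \<Rightarrow> 'a" and t
  have cu: "continuous_on S (apply_bcontfun u)" for u :: "real \<Rightarrow>\<^sub>C 'a" and S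
    using continuous_on_subset[OF continuous_on_apply_bcontfun] by blast
  have int: "(\<lambda>s. X (apply_bcontfun u s)) integrable_on {0..t}" for u :: "real \<Rightarrow>\<^sub>C 'a" and t
    by (intro integrable_continuous_interval contX cu)
  have Pcont: "continuous_on UNIV (P u)" if "\<And>S. continuous_on S u" for u
  proof -
    have "continuous_on {0..h} (\<lambda>t. integral {0..t} (\<lambda>s. X (u s)))"
      by (intro indefinite_integral_continuous_1 integrable_continuous_interval contX that)
    then have "continuous_on UNIV (\<lambda>t. integral {0..c t} (\<lambda>s. X (u s)))"
      by (rule continuous_on_compose2) (use c in auto)
    then show ?thesis unfolding P_def by (intro continuous_intros)
  qed
  have Pb: "P (apply_bcontfun u) \<in> bcontfun" for u :: "real \<Rightarrow>\<^sub>C 'a"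
  proof -
    have "range (P (apply_bcontfun u)) \<subseteq> P (apply_bcontfun u) ` {0..h}"
    proof safe
      fix t
      have "P (apply_bcontfun u) t = P (apply_bcontfun u) (c t)"
        using c by (simp add: P_def)
      then show "P (apply_bcontfun u) t \<in> P (apply_bcontfun u) ` {0..h}" using c(2) by blast
    qed
    moreover have "bounded (P (apply_bcontfun u) ` {0..h})"
      using Pcont[OF cu] by (intro compact_imp_bounded compact_continuous_image) (auto intro: continuous_on_subset)
    ultimately show ?thesis
      using Pcont[OF cu] bounded_subset by (auto simp: bcontfun_def)
  qed
  define T where "T u = Bcontfun (P (apply_bcontfun u))" for u :: "real \<Rightarrow>\<^sub>C 'a"
  have T: "apply_bcontfun (T u) = P (apply_bcontfun u)" for u
    unfolding T_def using Pb by (simp add: Bcontfun_inverse)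
  have "dist (T u) (T v) \<le> 1/2 * dist u v" for u v
  proof (rule dist_bound)
    fix t
    have "norm (P (apply_bcontfun u) t - P (apply_bcontfun v) t)
      = norm (integral {0..c t} (\<lambda>s. X (apply_bcontfun u s) - X (apply_bcontfun v s)))"
      by (simp add: P_def integral_diff int)
    also have "\<dots> \<le> (K * dist u v) * (c t - 0)"
    proof (rule integral_bound)
      show "continuous_on {0..c t} (\<lambda>s. X (apply_bcontfun u s) - X (apply_bcontfun v s))"
        by (intro continuous_intros contX cu)
      show "norm (X (apply_bcontfun u s) - X (apply_bcontfun v s)) \<le> K * dist u v" for s
        using lip[of "apply_bcontfun u s" "apply_bcontfun v s"]
          mult_left_mono[OF dist_bounded[of u s v] K] by (simp add: dist_norm)
    qed (use c(2)[of t] in auto)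
    also have "\<dots> \<le> (K * dist u v) * h"
      using c(2)[of t] K by (intro mult_left_mono) auto
    also have "\<dots> = (h * K) * dist u v" by simp
    also have "\<dots> \<le> 1/2 * dist u v" using h by (intro mult_right_mono) auto
    finally show "dist (apply_bcontfun (T u) t) (apply_bcontfun (T v) t) \<le> 1/2 * dist u v"
      by (simp add: T dist_norm)
  qed
  then obtain u where Tu: "T u = u"
    using banach_fix_type[of "1/2" T] by auto
  have u: "apply_bcontfun u t = y + integral {0..c t} (\<lambda>s. X (apply_bcontfun u s))" for t
    by (rule fun_cong[OF T[of u], of t, unfolded Tu P_def])
  have "(apply_bcontfun u has_vector_derivative X (apply_bcontfun u t)) (at t within {0..h})" if t: "t \<in> {0..h}" for t
  proof -
    have "((\<lambda>t. y + integral {0..t} (\<lambda>s. X (apply_bcontfun u s))) has_vector_derivative 0 + X (apply_bcontfun u t)) (at t within {0..h})"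
      using t by (intro has_vector_derivative_add has_vector_derivative_const integral_has_vector_derivative contX cu)
    then have *: "((\<lambda>t. y + integral {0..t} (\<lambda>s. X (apply_bcontfun u s))) has_vector_derivative X (apply_bcontfun u t)) (at t within {0..h})"
      by simp
    show ?thesis
    proof (rule has_vector_derivative_transform[OF t _ *])
      show "apply_bcontfun u t = y + integral {0..t} (\<lambda>s. X (apply_bcontfun u s))" if "t \<in> {0..h}" for t
        using u[of t] unfolding c(3)[OF that] .
    qed
  qed
  moreover have "apply_bcontfun u 0 = y" using u[of 0] c(3)[of 0] h by simp
  ultimately show ?thesis by blast
qed

text \<open>Each field is made globally Lipschitz by precomposing it with the projection onto the
  ball of radius \<open>R\<close>. All points then share one existence time \<open>h\<close>, and
  inside the ball the curves follow the original field. The map \<open>rv\<close> names the opposite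
  fields, so that inverses of flows belong to the family again.\<close>

lemma local_flows_exist:
  fixes F :: "'l::finite \<Rightarrow> 'a::euclidean_space \<Rightarrow> 'a"
  assumes C1: "\<And>l. Ck (Suc 0) (F l)" and rv: "\<And>l x. F (rv l) x = - F l x" and R: "R \<ge> 0"
  shows "\<exists>h>0. \<exists>M\<ge>0. \<exists>\<phi>. (\<forall>l y. \<phi> l 0 y = y) \<and>
    (\<forall>l y y'. \<forall>s\<in>{0..h}. \<forall>t\<in>{0..h}. norm (\<phi> l s y - \<phi> l t y') \<le> M * \<bar>s - t\<bar> + 2 * norm (y - y')) \<and>
    (\<forall>l y. \<forall>t\<in>{0..h}. \<phi> l t y \<in> cball 0 R \<longrightarrow>
        ((\<lambda>t. \<phi> l t y) has_vector_derivative F l (\<phi> l t y)) (at t within {0..h})) \<and>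
    (\<forall>l y. \<forall>t\<in>{0..h}. \<phi> (rv l) t (\<phi> l t y) = y)"
proof -
  define S where "S = (cball 0 R :: 'a set)"
  have S: "convex S" "closed S" "S \<noteq> {}" "compact S" using R by (auto simp: S_def)
  define X where "X l x = F l (closest_point S x)" for l x
  have cp: "closest_point S x \<in> S" for x using closest_point_in_set S by blast
  obtain K where K: "\<And>l. K l \<ge> 0"
    "\<And>l x y. x \<in> S \<Longrightarrow> y \<in> S \<Longrightarrow> norm (F l x - F l y) \<le> K l * norm (x - y)"
    using C1_lipschitz_on_cball[OF C1, of 0 R] unfolding S_def by metis
  define Ks where "Ks = (\<Sum>l\<in>UNIV. K l)"
  have Ks: "K l \<le> Ks" for l unfolding Ks_def by (intro member_le_sum) (use K in auto)
  have Ks0: "Ks \<ge> 0" unfolding Ks_def by (intro sum_nonneg) (use K in auto)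
  have lip: "norm (X l x - X l y) \<le> Ks * norm (x - y)" for l x y
  proof -
    have "norm (X l x - X l y) \<le> K l * norm (closest_point S x - closest_point S y)"
      unfolding X_def by (intro K cp)
    also have "\<dots> \<le> Ks * norm (x - y)"
      using closest_point_lipschitz[OF S(1-3), of x y] Ks K Ks0 by (intro mult_mono) (auto simp: dist_norm)
    finally show ?thesis .
  qed
  have "bounded (\<Union>l. F l ` S)"
    using C1 S(4) Ck_continuous continuous_on_subset
    by (intro bounded_UN[OF finite] ballI compact_imp_bounded compact_continuous_image) blast+
  then obtain M where "M > 0" and M': "\<And>v. v \<in> (\<Union>l. F l ` S) \<Longrightarrow> norm v \<le> M"
    unfolding bounded_pos by metis
  then have M: "M > 0" "\<And>l x. x \<in> S \<Longrightarrow> norm (F l x) \<le> M" by auto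
  define h where "h = 1 / (2 * (Ks + 1))"
  have h: "h > 0" "h * Ks \<le> 1/2" using Ks0 unfolding h_def by (auto simp: field_simps)
  define g where "g l y = (SOME g. g 0 = y \<and> (\<forall>t\<in>{0..h}. (g has_vector_derivative X l (g t)) (at t within {0..h})))" for l y
  have g': "g l y 0 = y \<and> (\<forall>t\<in>{0..h}. (g l y has_vector_derivative X l (g l y t)) (at t within {0..h}))" for l y
    unfolding g_def by (rule someI_ex[OF lipschitz_solution_exists[OF lip Ks0 h]])
  then have g0: "g l y 0 = y" for l y by blast
  have g: "(g l y has_vector_derivative X l (g l y t)) (at t within {0..h})" if "t \<in> {0..h}" for l y t
    using g' that by blast
  have Mlip: "norm (g l y s - g l y t) \<le> M * \<bar>s - t\<bar>" if "s \<in> {0..h}" "t \<in> {0..h}" for l y s t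
  proof -
    have "norm (g l y s - g l y t) \<le> M * norm (s - t)"
    proof (rule differentiable_bound[where S="{0..h}"])
      show "(g l y has_derivative (\<lambda>r. r *\<^sub>R X l (g l y t))) (at t within {0..h})" if "t \<in> {0..h}" for t
        using g[OF that] by (simp add: has_vector_derivative_def)
      show "onorm (\<lambda>r. r *\<^sub>R X l (g l y t)) \<le> M" for t
        using M(2)[OF cp] M(1) by (intro onorm_bound) (auto simp: X_def mult.commute[of M] intro!: mult_left_mono)
    qed (use that in auto)
    then show ?thesis by simp
  qed
  have joint: "norm (g l y s - g l y' t) \<le> M * \<bar>s - t\<bar> + 2 * norm (y - y')"
    if "s \<in> {0..h}" "t \<in> {0..h}" for l y y' s t
  proof -
    have "norm (g l y t - g l y' t) \<le> 2 * norm (y - y')"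
      using lipschitz_solutions_close[OF lip Ks0 less_imp_le[OF h(1)] h(2) g g, of t] that
      by (simp add: g0)
    then show ?thesis
      using Mlip[OF that, of l y] norm_triangle_ineq[of "g l y s - g l y t" "g l y t - g l y' t"] by simp
  qed
  have rev: "g (rv l) (g l y t) t = y" if t: "t \<in> {0..h}" for l y t
  proof -
    \<comment> \<open>The curve run backwards from \<open>g l y t\<close> solves the equation of the
      opposite field, as does \<open>g (rv l) (g l y t)\<close>. Both start at the same point, so
      they coincide.\<close>
    have sub: "{0..t} \<subseteq> {0..h}" using t by auto
    have 1: "((\<lambda>s. g l y (t - s)) has_vector_derivative X (rv l) (g l y (t - s))) (at s within {0..t})"
      if s: "s \<in> {0..t}" for s
    proof -
      have 2: "((\<lambda>s. t - s) has_vector_derivative - 1) (at s within {0..t})"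
        by (auto intro!: derivative_eq_intros)
      have "(\<lambda>s. t - s) ` {0..t} \<subseteq> {0..h}" using t by auto
      then have 3: "(g l y has_vector_derivative X l (g l y (t - s))) (at (t - s) within (\<lambda>s. t - s) ` {0..t})"
        using g[of "t - s" l y] s t by (auto intro: has_vector_derivative_within_subset)
      have "((g l y \<circ> (\<lambda>s. t - s)) has_vector_derivative (- 1) *\<^sub>R X l (g l y (t - s))) (at s within {0..t})"
        by (rule vector_diff_chain_within[OF 2 3])
      then show ?thesis by (simp add: o_def X_def rv)
    qed
    have 2: "(g (rv l) (g l y t) has_vector_derivative X (rv l) (g (rv l) (g l y t) s)) (at s within {0..t})"
      if s: "s \<in> {0..t}" for s
      using g[of s "rv l" "g l y t"] s sub by (auto intro: has_vector_derivative_within_subset)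
    have "t * Ks \<le> h * Ks" using t Ks0 by (intro mult_right_mono) auto
    then have "norm (g (rv l) (g l y t) t - g l y (t - t)) \<le> 2 * norm (g (rv l) (g l y t) 0 - g l y (t - 0))"
      using t h by (intro lipschitz_solutions_close[OF lip Ks0 _ _ 2 1]) auto
    then show ?thesis by (simp add: g0)
  qed
  have "((\<lambda>t. g l y t) has_vector_derivative F l (g l y t)) (at t within {0..h})"
    if "t \<in> {0..h}" "g l y t \<in> cball 0 R" for l y t
    using g[OF that(1), of l y] that(2) by (simp add: X_def closest_point_self S_def)
  then show ?thesis using h(1) M(1) g0 joint rev
    by (intro exI[of _ h] conjI exI[of _ M] exI[of _ "\<lambda>l t y. g l y t"]) auto
qed

subsection \<open>Asymptotic expansions along flows\<close>

text \<open>The remainder class \<open>O(s^n)\<close> as \<open>s\<close> decreases to 0, uniformly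
  on a ball.\<close>

definition unif_bigo :: "nat \<Rightarrow> real \<Rightarrow> (real \<Rightarrow> 'a::real_normed_vector \<Rightarrow> real) \<Rightarrow> bool" where
  "unif_bigo n R u \<longleftrightarrow> (\<exists>C. \<exists>d>0. \<forall>s\<in>{0..d}. \<forall>y\<in>cball 0 R. \<bar>u s y\<bar> \<le> C * s ^ n)"

text \<open>The bound holds for all \<open>y\<close> at once, as it does for flows of truncated
  fields; such maps therefore compose without regard to balls.\<close>

definition near_id :: "(real \<Rightarrow> 'a::real_normed_vector \<Rightarrow> 'a) \<Rightarrow> bool" where
  "near_id P \<longleftrightarrow> (\<exists>M. \<exists>d>0. \<forall>s\<in>{0..d}. \<forall>y. norm (P s y - y) \<le> M * s)"

lemma unif_bigoI:
  assumes "d > 0" "\<And>s y. 0 \<le> s \<Longrightarrow> s \<le> d \<Longrightarrow> norm y \<le> R \<Longrightarrow> \<bar>u s y\<bar> \<le> C * s ^ n"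
  shows "unif_bigo n R u"
  unfolding unif_bigo_def using assms by (metis atLeastAtMost_iff mem_cball_0)

lemma unif_bigoE:
  assumes "unif_bigo n R u"
  obtains C d where "C \<ge> 0" "d > 0" "d \<le> 1"
    "\<And>s y. 0 \<le> s \<Longrightarrow> s \<le> d \<Longrightarrow> norm y \<le> R \<Longrightarrow> \<bar>u s y\<bar> \<le> C * s ^ n"
proof -
  obtain C d where *: "d > 0" "\<And>s y. s \<in> {0..d} \<Longrightarrow> y \<in> cball 0 R \<Longrightarrow> \<bar>u s y\<bar> \<le> C * s ^ n"
    using assms unfolding unif_bigo_def by blast
  have "\<bar>u s y\<bar> \<le> \<bar>C\<bar> * s ^ n" if "0 \<le> s" "s \<le> min d 1" "norm y \<le> R" for s y
    using *(2)[of s y] mult_right_mono[OF abs_ge_self[of C], of "s ^ n"] that by simp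
  then show ?thesis using *(1) by (intro that[of "\<bar>C\<bar>" "min d 1"]) auto
qed

lemma unif_bigo_cong:
  assumes "unif_bigo n R u" "d > 0" "\<And>s y. 0 \<le> s \<Longrightarrow> s \<le> d \<Longrightarrow> norm y \<le> R \<Longrightarrow> u s y = w s y"
  shows "unif_bigo n R w"
proof -
  obtain C e where C: "C \<ge> 0" "e > 0" "e \<le> 1"
    "\<And>s y. 0 \<le> s \<Longrightarrow> s \<le> e \<Longrightarrow> norm y \<le> R \<Longrightarrow> \<bar>u s y\<bar> \<le> C * s ^ n"
    using unif_bigoE[OF assms(1)] by blast
  show ?thesis
    using C assms(2) by (intro unif_bigoI[of "min d e" _ _ C]) (auto simp: assms(3)[symmetric])
qed

lemma unif_bigo_add: assumes "unif_bigo n R u" "unif_bigo n R w" shows "unif_bigo n R (\<lambda>s y. u s y + w s y)"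
proof -
  obtain C e where C: "e > 0" "\<And>s y. 0 \<le> s \<Longrightarrow> s \<le> e \<Longrightarrow> norm y \<le> R \<Longrightarrow> \<bar>u s y\<bar> \<le> C * s ^ n"
    using unif_bigoE[OF assms(1)] by metis
  obtain D d where D: "d > 0" "\<And>s y. 0 \<le> s \<Longrightarrow> s \<le> d \<Longrightarrow> norm y \<le> R \<Longrightarrow> \<bar>w s y\<bar> \<le> D * s ^ n"
    using unif_bigoE[OF assms(2)] by metis
  show ?thesis
  proof (rule unif_bigoI[of "min d e" _ _ "C + D"])
    fix s y assume "0 \<le> s" "s \<le> min d e" "norm (y::'a) \<le> R"
    then show "\<bar>u s y + w s y\<bar> \<le> (C + D) * s ^ n"
      using C(2)[of s y] D(2)[of s y] by (simp add: distrib_right)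
  qed (use C D in auto)
qed

lemma unif_bigo_minus: "unif_bigo n R u \<Longrightarrow> unif_bigo n R (\<lambda>s y. - u s y)"
  by (simp add: unif_bigo_def)

lemma unif_bigo_diff: "unif_bigo n R u \<Longrightarrow> unif_bigo n R w \<Longrightarrow> unif_bigo n R (\<lambda>s y. u s y - w s y)"
  using unif_bigo_add[OF _ unif_bigo_minus, of n R u w] by simp

lemma unif_bigo_zero: "unif_bigo n R (\<lambda>s y. 0)"
  by (rule unif_bigoI[of 1 _ _ 0]) auto

lemma unif_bigo_sum: "(\<And>i. i \<in> I \<Longrightarrow> unif_bigo n R (u i)) \<Longrightarrow> unif_bigo n R (\<lambda>s y. \<Sum>i\<in>I. u i s y)"
  by (induction I rule: infinite_finite_induct) (auto intro: unif_bigo_add unif_bigo_zero)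

lemma unif_bigo_le: assumes "unif_bigo n R u" "m \<le> n" shows "unif_bigo m R u"
proof -
  obtain C e where C: "C \<ge> 0" "e > 0" "e \<le> 1"
    "\<And>s y. 0 \<le> s \<Longrightarrow> s \<le> e \<Longrightarrow> norm y \<le> R \<Longrightarrow> \<bar>u s y\<bar> \<le> C * s ^ n"
    using unif_bigoE[OF assms(1)] by blast
  show ?thesis
  proof (rule unif_bigoI[of e _ _ C])
    fix s y assume *: "0 \<le> s" "s \<le> e" "norm (y::'a) \<le> R"
    then have "s ^ n \<le> s ^ m" using C assms(2) by (intro power_decreasing) auto
    then show "\<bar>u s y\<bar> \<le> C * s ^ m" using C(4)[OF *] C(1) by (meson mult_left_mono order_trans)
  qed (use C in auto)
qed

lemma unif_bigo_mult: assumes "unif_bigo n R u" "m \<le> n + k" shows "unif_bigo m R (\<lambda>s y. s ^ k * u s y)"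
proof -
  obtain C e where C: "C \<ge> 0" "e > 0" "e \<le> 1"
    "\<And>s y. 0 \<le> s \<Longrightarrow> s \<le> e \<Longrightarrow> norm y \<le> R \<Longrightarrow> \<bar>u s y\<bar> \<le> C * s ^ n"
    using unif_bigoE[OF assms(1)] by blast
  have "unif_bigo (n + k) R (\<lambda>s y. s ^ k * u s y)"
  proof (rule unif_bigoI[of e _ _ C])
    fix s y assume *: "0 \<le> s" "s \<le> e" "norm (y::'a) \<le> R"
    then show "\<bar>s ^ k * u s y\<bar> \<le> C * s ^ (n + k)"
      using mult_left_mono[OF C(4)[OF *], of "s ^ k"] by (simp add: abs_mult power_add mult_ac)
  qed (use C in auto)
  then show ?thesis using assms(2) by (rule unif_bigo_le)
qed

lemma unif_bigo_subset: "unif_bigo n R u \<Longrightarrow> R' \<le> R \<Longrightarrow> unif_bigo n R' u"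
  unfolding unif_bigo_def by fastforce

lemma unif_bigo_const:
  fixes w :: "'a::euclidean_space \<Rightarrow> real"
  assumes "continuous_on UNIV w"
  shows "unif_bigo 0 R (\<lambda>s y. w y)"
proof -
  have "bounded (w ` cball 0 R)"
    using assms by (intro compact_imp_bounded compact_continuous_image) (auto intro: continuous_on_subset)
  then obtain B where "\<forall>y\<in>cball 0 R. \<bar>w y\<bar> \<le> B"
    unfolding bounded_iff by auto
  then show ?thesis by (intro unif_bigoI[of 1 _ _ B]) auto
qed

lemma near_idE:
  assumes "near_id P"
  obtains M d where "M \<ge> 0" "d > 0" "d \<le> 1" "\<And>s y. 0 \<le> s \<Longrightarrow> s \<le> d \<Longrightarrow> norm (P s y - y) \<le> M * s"
proof -
  obtain M d where *: "d > 0" "\<And>s y. s \<in> {0..d} \<Longrightarrow> norm (P s y - y) \<le> M * s"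
    using assms unfolding near_id_def by blast
  have "norm (P s y - y) \<le> \<bar>M\<bar> * s" if "0 \<le> s" "s \<le> min d 1" for s y
    using *(2)[of s y] mult_right_mono[OF abs_ge_self[of M], of s] that by simp
  then show ?thesis using *(1) by (intro that[of "\<bar>M\<bar>" "min d 1"]) auto
qed

lemma near_id_stay:
  assumes "near_id P" "R < R'"
  obtains d where "d > 0" "\<And>s y. 0 \<le> s \<Longrightarrow> s \<le> d \<Longrightarrow> norm y \<le> R \<Longrightarrow> norm (P s y) \<le> R'"
proof -
  obtain M d where M: "M \<ge> 0" "d > 0" "d \<le> 1" "\<And>s y. 0 \<le> s \<Longrightarrow> s \<le> d \<Longrightarrow> norm (P s y - y) \<le> M * s"
    using near_idE[OF assms(1)] by blast
  define e where "e = min d ((R' - R) / (M + 1))"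
  have e: "e > 0" "e \<le> d" "M * e \<le> R' - R"
  proof -
    show "e > 0" "e \<le> d" using M assms(2) by (auto simp: e_def)
    have "e * (M + 1) \<le> R' - R"
      using M by (simp add: pos_le_divide_eq[symmetric] e_def)
    then show "M * e \<le> R' - R" using \<open>e > 0\<close> by (simp add: algebra_simps)
  qed
  have "norm (P s y) \<le> R'" if "0 \<le> s" "s \<le> e" "norm y \<le> R" for s y
  proof -
    have "M * s \<le> M * e" using that M by (intro mult_left_mono) auto
    then show ?thesis
      using M(4)[of s y] that e norm_triangle_ineq[of "P s y - y" y] by simp
  qed
  then show ?thesis using e(1) that by blast
qed

lemma near_id_comp:
  assumes "near_id P" "near_id Q"
  shows "near_id (\<lambda>s y. Q s (P s y))"
proof -
  obtain M d where M: "d > 0" "\<And>s y. 0 \<le> s \<Longrightarrow> s \<le> d \<Longrightarrow> norm (P s y - y) \<le> M * s"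
    using near_idE[OF assms(1)] by metis
  obtain N e where N: "e > 0" "\<And>s y. 0 \<le> s \<Longrightarrow> s \<le> e \<Longrightarrow> norm (Q s y - y) \<le> N * s"
    using near_idE[OF assms(2)] by metis
  have "norm (Q s (P s y) - y) \<le> (M + N) * s" if "0 \<le> s" "s \<le> min d e" for s y
    using M(2)[of s y] N(2)[of s "P s y"] that norm_triangle_ineq[of "Q s (P s y) - P s y" "P s y - y"]
    by (simp add: algebra_simps)
  then show ?thesis
    unfolding near_id_def using M(1) N(1) by (intro exI[of _ "M + N"] exI[of _ "min d e"]) auto
qed

text \<open>Substitution costs radius: \<open>P s y\<close> may leave the ball of radius
  \<open>R\<close>, but for small \<open>s\<close> it stays in the larger one. This is why the
  expansions below are asked for on all balls of radius less than some \<open>R0\<close>.\<close>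

lemma unif_bigo_comp:
  assumes "unif_bigo n R' u" "near_id P" "R < R'"
  shows "unif_bigo n R (\<lambda>s y. u s (P s y))"
proof -
  obtain C e where C: "C \<ge> 0" "e > 0" "e \<le> 1"
    "\<And>s y. 0 \<le> s \<Longrightarrow> s \<le> e \<Longrightarrow> norm y \<le> R' \<Longrightarrow> \<bar>u s y\<bar> \<le> C * s ^ n"
    using unif_bigoE[OF assms(1)] by blast
  obtain d where "d > 0" "\<And>s y. 0 \<le> s \<Longrightarrow> s \<le> d \<Longrightarrow> norm y \<le> R \<Longrightarrow> norm (P s y) \<le> R'"
    using near_id_stay[OF assms(2,3)] by blast
  then show ?thesis using C by (intro unif_bigoI[of "min d e" _ _ C]) auto
qed

lemma unif_bigo_near_id:
  fixes g :: "'a::euclidean_space \<Rightarrow> real"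
  assumes g: "Ck (Suc 0) g" and P: "near_id P"
  shows "unif_bigo 1 R (\<lambda>s y. g (P s y) - g y)"
proof -
  obtain M e where M: "M \<ge> 0" "e > 0" "e \<le> 1" "\<And>s y. 0 \<le> s \<Longrightarrow> s \<le> e \<Longrightarrow> norm (P s y - y) \<le> M * s"
    using near_idE[OF P] by blast
  obtain d where d: "d > 0" "\<And>s y. 0 \<le> s \<Longrightarrow> s \<le> d \<Longrightarrow> norm y \<le> R \<Longrightarrow> norm (P s y) \<le> R + 1"
    using near_id_stay[OF P, of R "R + 1"] by auto
  obtain K where K: "K \<ge> 0" "\<And>x y. x \<in> cball 0 (R+1) \<Longrightarrow> y \<in> cball 0 (R+1) \<Longrightarrow> norm (g x - g y) \<le> K * norm (x - y)"
    using C1_lipschitz_on_cball[OF g, of 0 "R + 1"] by blast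
  show ?thesis
  proof (rule unif_bigoI[of "min d e" _ _ "K * M"])
    fix s y assume s: "0 \<le> s" "s \<le> min d e" "norm (y::'a) \<le> R"
    have "\<bar>g (P s y) - g y\<bar> \<le> K * norm (P s y - y)"
      using K(2)[of "P s y" y] d(2)[of s y] s by simp
    also have "\<dots> \<le> K * (M * s)" using M(4)[of s y] s K(1) by (intro mult_left_mono) auto
    finally show "\<bar>g (P s y) - g y\<bar> \<le> K * M * s ^ 1" by simp
  qed (use d M in auto)
qed

section \<open>Asymptotic expansions: uniqueness, composition, inverses, commutators\<close>

lemma poly_constant_coeff_zero:
  fixes q :: "nat \<Rightarrow> real"
  assumes "d > 0" "\<And>s. 0 < s \<Longrightarrow> s \<le> d \<Longrightarrow> \<bar>\<Sum>j\<le>n. s ^ j * q j\<bar> \<le> C * s ^ (n + 1)"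
  shows "q 0 = 0"
proof -
  have "((\<lambda>s. \<Sum>j\<le>n. s ^ j * q j) \<longlongrightarrow> (\<Sum>j\<le>n. 0 ^ j * q j)) (at_right 0)"
    by (intro tendsto_intros)
  moreover have "(\<Sum>j\<le>n. 0 ^ j * q j) = q 0"
    by (induction n) auto
  moreover have "((\<lambda>s. \<Sum>j\<le>n. s ^ j * q j) \<longlongrightarrow> 0) (at_right 0)"
  proof (rule Lim_null_comparison)
    show "\<forall>\<^sub>F s in at_right 0. norm (\<Sum>j\<le>n. s ^ j * q j) \<le> C * s ^ (n + 1)"
      unfolding eventually_at_right_field using assms by (intro exI[of _ d]) auto
    have "((\<lambda>s. C * s ^ (n + 1)) \<longlongrightarrow> C * 0 ^ (n + 1)) (at_right 0)" by (intro tendsto_intros)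
    then show "((\<lambda>s. C * s ^ (n + 1)) \<longlongrightarrow> 0) (at_right 0)" by simp
  qed
  ultimately show ?thesis using tendsto_unique[OF trivial_limit_at_right_real] by metis
qed

lemma poly_coeffs_zero:
  fixes q :: "nat \<Rightarrow> real"
  assumes "d > 0" "\<And>s. 0 < s \<Longrightarrow> s \<le> d \<Longrightarrow> \<bar>\<Sum>j\<le>n. s ^ j * q j\<bar> \<le> C * s ^ (n + 1)" "j \<le> n"
  shows "q j = 0"
  using assms(2,3)
proof (induction n arbitrary: q j)
  case 0
  then show ?case using poly_constant_coeff_zero[OF assms(1) 0(1)] by simp
next
  case (Suc n)
  have q0: "q 0 = 0" by (rule poly_constant_coeff_zero[OF assms(1) Suc.prems(1)])
  have "\<bar>\<Sum>j\<le>n. s ^ j * q (Suc j)\<bar> \<le> C * s ^ (n + 1)" if s: "0 < s" "s \<le> d" for s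
  proof -
    have "(\<Sum>j\<le>Suc n. s ^ j * q j) = s * (\<Sum>j\<le>n. s ^ j * q (Suc j))"
      by (simp add: sum.atMost_Suc_shift q0 sum_distrib_left mult_ac del: sum.atMost_Suc)
    then have "s * \<bar>\<Sum>j\<le>n. s ^ j * q (Suc j)\<bar> \<le> s * (C * s ^ (n + 1))"
      using Suc.prems(1)[OF s] s by (simp add: abs_mult mult_ac)
    then show ?thesis using s by simp
  qed
  then have "i \<le> n \<Longrightarrow> q (Suc i) = 0" for i using Suc.IH[of "\<lambda>j. q (Suc j)"] by blast
  then show ?case using q0 Suc.prems(2) by (cases j) auto
qed

lemma unif_bigo_poly_zero:
  assumes "unif_bigo (n + 1) R (\<lambda>s y. \<Sum>j\<le>n. s ^ j * q j y)" "j \<le> n" "norm y \<le> R"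
  shows "q j y = 0"
proof -
  obtain C e where C: "e > 0" "\<And>s y. 0 \<le> s \<Longrightarrow> s \<le> e \<Longrightarrow> norm y \<le> R \<Longrightarrow> \<bar>\<Sum>j\<le>n. s ^ j * q j y\<bar> \<le> C * s ^ (n + 1)"
    using unif_bigoE[OF assms(1)] by metis
  show ?thesis
    by (rule poly_coeffs_zero[OF C(1), where q="\<lambda>j. q j y" and n=n and C=C]) (use C(2) assms(2,3) in auto)
qed

text \<open>The smoothness of the coefficients matters: an expansion along a second map can then be
  applied to them in turn.\<close>

definition expands :: "real \<Rightarrow> (real \<Rightarrow> 'a::euclidean_space \<Rightarrow> 'a) \<Rightarrow> bool" where
  "expands R0 P \<longleftrightarrow> (\<forall>(g :: 'a \<Rightarrow> real) n R. smooth g \<longrightarrow> R < R0 \<longrightarrow>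
     (\<exists>c. (\<forall>j. smooth (c j)) \<and> unif_bigo (n + 1) R (\<lambda>s y. g (P s y) - (\<Sum>j\<le>n. s ^ j * c j y))))"

text \<open>On functions, \<open>P s\<close> acts like \<open>1 + s^a X + O(s^(a+1))\<close>, with
  \<open>X\<close> regarded as a derivation.\<close>

definition leads :: "real \<Rightarrow> nat \<Rightarrow> ('a::euclidean_space \<Rightarrow> 'a) \<Rightarrow> (real \<Rightarrow> 'a \<Rightarrow> 'a) \<Rightarrow> bool" where
  "leads R0 a X P \<longleftrightarrow> (\<forall>(g :: 'a \<Rightarrow> real) R. smooth g \<longrightarrow> R < R0 \<longrightarrow>
     unif_bigo (a + 1) R (\<lambda>s y. g (P s y) - g y - s ^ a * lie_derivative X g y))"

lemma expands_id: "expands R0 (\<lambda>s y. y)"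
  unfolding expands_def
proof (intro allI impI)
  fix g :: "'a \<Rightarrow> real" and n :: nat and R
  assume "smooth g"
  moreover have "(\<Sum>j\<le>n. s ^ j * (if j = 0 then g else (\<lambda>y. 0)) y) = g y" for s y
    by (induction n) auto
  ultimately show "\<exists>c. (\<forall>j. smooth (c j)) \<and> unif_bigo (n + 1) R (\<lambda>s y. g y - (\<Sum>j\<le>n. s ^ j * c j y))"
    by (intro exI[of _ "\<lambda>j. if j = 0 then g else (\<lambda>y. 0)"]) (auto simp: smooth_const unif_bigo_zero)
qed

lemma expands_comp:
  assumes P: "near_id P" "expands R0 P" and Q: "expands R0 Q"
  shows "expands R0 (\<lambda>s y. Q s (P s y))"
  unfolding expands_def
proof (intro allI impI)
  fix g :: "'a \<Rightarrow> real" and n :: nat and R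
  assume g: "smooth g" and R: "R < R0"
  define R' where "R' = (R + R0) / 2"
  have R': "R < R'" "R' < R0" using R by (auto simp: R'_def)
  obtain c where c: "\<And>j. smooth (c j)" "unif_bigo (n + 1) R' (\<lambda>s y. g (Q s y) - (\<Sum>j\<le>n. s ^ j * c j y))"
    using Q g R' unfolding expands_def by blast
  \<comment> \<open>The coefficient \<open>c j\<close> carries a factor \<open>s ^ j\<close>, so it
    is expanded to order \<open>n - j\<close> only.\<close>
  have "\<forall>j. \<exists>e. (\<forall>i. smooth (e i)) \<and> unif_bigo (n - j + 1) R (\<lambda>s y. c j (P s y) - (\<Sum>i\<le>n - j. s ^ i * e i y))"
    using P(2) c(1) R unfolding expands_def by blast
  from choice[OF this] obtain e where e: "\<And>j i. smooth (e j i)"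
    "\<And>j. unif_bigo (n - j + 1) R (\<lambda>s y. c j (P s y) - (\<Sum>i\<le>n - j. s ^ i * e j i y))"
    by blast
  \<comment> \<open>The Cauchy product of the two expansions.\<close>
  define d where "d k y = (\<Sum>j\<le>k. e j (k - j) y)" for k y
  have "smooth (d k)" for k
    unfolding d_def[abs_def] by (intro smooth_sum e)
  moreover have "unif_bigo (n + 1) R (\<lambda>s y. g (Q s (P s y)) - (\<Sum>k\<le>n. s ^ k * d k y))"
  proof -
    have "unif_bigo (n + 1) R (\<lambda>s y. (g (Q s (P s y)) - (\<Sum>j\<le>n. s ^ j * c j (P s y))) +
       (\<Sum>j\<le>n. s ^ j * (c j (P s y) - (\<Sum>i\<le>n - j. s ^ i * e j i y))))"
      by (intro unif_bigo_add unif_bigo_sum unif_bigo_mult[OF e(2)] unif_bigo_comp[OF c(2) P(1) R'(1)]) auto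
    moreover have "(g (Q s (P s y)) - (\<Sum>j\<le>n. s ^ j * c j (P s y))) +
       (\<Sum>j\<le>n. s ^ j * (c j (P s y) - (\<Sum>i\<le>n - j. s ^ i * e j i y)))
       = g (Q s (P s y)) - (\<Sum>k\<le>n. s ^ k * d k y)" for s y
    proof -
      have "(\<Sum>k\<le>n. s ^ k * d k y) = (\<Sum>k\<le>n. \<Sum>j\<le>k. s ^ j * (s ^ (k - j) * e j (k - j) y))"
        by (auto simp: d_def sum_distrib_left mult.assoc[symmetric] power_add[symmetric] intro!: sum.cong)
      also have "\<dots> = (\<Sum>(j, i)\<in>{(j, i). j + i \<le> n}. s ^ j * (s ^ i * e j i y))"
        by (rule sum.triangle_reindex_eq[symmetric])
      also have "{(j, i). j + i \<le> n} = (SIGMA j:{..n}. {..n - j})" by auto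
      also have "(\<Sum>(j, i)\<in>(SIGMA j:{..n}. {..n - j}). s ^ j * (s ^ i * e j i y)) =
          (\<Sum>j\<le>n. s ^ j * (\<Sum>i\<le>n - j. s ^ i * e j i y))"
        by (subst sum.Sigma[symmetric]) (auto simp: sum_distrib_left)
      finally show ?thesis by (simp add: right_diff_distrib sum_subtractf)
    qed
    ultimately show ?thesis by (rule unif_bigo_cong[OF _ zero_less_one])
  qed
  ultimately show "\<exists>c. (\<forall>j. smooth (c j)) \<and> unif_bigo (n + 1) R (\<lambda>s y. g (Q s (P s y)) - (\<Sum>j\<le>n. s ^ j * c j y))"
    by blast
qed

text \<open>Uniqueness of expansions: the full expansion up to order \<open>n\<close> is compared
  with the one that the leading term provides up to order \<open>a\<close>.\<close>

lemma expansion_leading: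
  fixes g :: "'a::euclidean_space \<Rightarrow> real"
  assumes g: "unif_bigo (a + 1) R (\<lambda>s y. g (P s y) - g y - s ^ a * lie_derivative X g y)" and a: "a \<ge> 1"
    and c: "unif_bigo (n + 1) R (\<lambda>s y. g (P s y) - (\<Sum>j\<le>n. s ^ j * c j y))" "\<And>j. smooth (c j)" "a \<le> n"
    and y: "norm y \<le> R"
  shows "c 0 y = g y" "\<And>j. 0 < j \<Longrightarrow> j < a \<Longrightarrow> c j y = 0" "c a y = lie_derivative X g y"
proof -
  define q where "q j y = c j y - (if j = 0 then g y else if j = a then lie_derivative X g y else 0)" for j y
  have 1: "(\<Sum>j\<le>a. s ^ j * q j y) = (\<Sum>j\<le>a. s ^ j * c j y) - g y - s ^ a * lie_derivative X g y" for s y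
  proof -
    have "(\<Sum>j\<le>a. s ^ j * q j y) = (\<Sum>j\<le>a. s ^ j * c j y) -
       (\<Sum>j\<le>a. (if j = 0 then g y else 0) + (if j = a then s ^ a * lie_derivative X g y else 0))"
      unfolding q_def sum_subtractf[symmetric] using a by (intro sum.cong) (auto simp: algebra_simps)
    then show ?thesis by (simp add: sum.distrib)
  qed
  have 2: "(\<Sum>j\<le>n. s ^ j * c j y) = (\<Sum>j\<le>a. s ^ j * c j y) + (\<Sum>j\<in>{a<..n}. s ^ j * c j y)" for s y
    using c(3) by (subst sum.union_disjoint[symmetric]) (auto intro!: sum.cong)
  have 3: "unif_bigo (a + 1) R (\<lambda>s y. (g (P s y) - g y - s ^ a * lie_derivative X g y) -
      (g (P s y) - (\<Sum>j\<le>n. s ^ j * c j y)) - (\<Sum>j\<in>{a<..n}. s ^ j * c j y))"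
    by (intro unif_bigo_diff g unif_bigo_le[OF c(1)] unif_bigo_sum unif_bigo_mult[OF unif_bigo_const[OF smooth_continuous[OF c(2)]]])
       (use c(3) in auto)
  have "unif_bigo (a + 1) R (\<lambda>s y. \<Sum>j\<le>a. s ^ j * q j y)"
    by (rule unif_bigo_cong[OF 3 zero_less_one]) (simp add: 1 2)
  from unif_bigo_poly_zero[OF this _ y] have q: "j \<le> a \<Longrightarrow> q j y = 0" for j .
  show "c 0 y = g y" using q[of 0] by (simp add: q_def)
  show "c j y = 0" if "0 < j" "j < a" for j using q[of j] that by (simp add: q_def)
  show "c a y = lie_derivative X g y" using q[of a] a by (simp add: q_def)
qed

text \<open>The leading term of \<open>Q\<close> alone leaves an error \<open>O(s^(b+1))\<close>,
  which is too coarse. Instead \<open>g\<close> along \<open>Q\<close> is expanded to order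
  \<open>a + b\<close>; its nonconstant terms \<open>s ^ j * c j\<close> begin at
  \<open>j = b\<close>, and passing from \<open>z\<close> to \<open>P s z\<close> changes each
  coefficient by \<open>O(s^a)\<close>. So the terms with \<open>j > b\<close> become negligible,
  and the term \<open>j = b\<close> gives the iterated Lie derivative.\<close>

lemma leads_mixed_difference:
  fixes g :: "'a::euclidean_space \<Rightarrow> real"
  assumes P: "near_id P" "leads R0 a X P" and Q: "expands R0 Q" "leads R0 b Y Q"
    and ab: "a \<ge> 1" "b \<ge> 1" and X: "smooth X" and Y: "smooth Y" and g: "smooth g" and R: "R < R0"
  shows "unif_bigo (a + b + 1) R (\<lambda>s z. g (Q s (P s z)) - g (P s z) - g (Q s z) + g z
     - s ^ (a + b) * lie_derivative X (lie_derivative Y g) z)"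
proof -
  define n where "n = a + b"
  define R' where "R' = (R + R0) / 2"
  have R': "R < R'" "R' < R0" using R by (auto simp: R'_def)
  obtain c where c: "\<And>j. smooth (c j)" "unif_bigo (n + 1) R' (\<lambda>s y. g (Q s y) - (\<Sum>j\<le>n. s ^ j * c j y))"
    using Q(1) g R' unfolding expands_def by blast
  define r where "r s y = g (Q s y) - (\<Sum>j\<le>n. s ^ j * c j y)" for s y
  have "unif_bigo (b + 1) R' (\<lambda>s y. g (Q s y) - g y - s ^ b * lie_derivative Y g y)"
    using Q(2) g R' unfolding leads_def by blast
  note lead = expansion_leading[OF this ab(2) c(2,1)]
  have "b \<le> n" by (simp add: n_def)
  note lead = lead[OF this]
  have split: "(\<Sum>j\<le>n. s ^ j * c j y) = g y + s ^ b * lie_derivative Y g y + (\<Sum>j\<in>{b<..n}. s ^ j * c j y)"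
    if "norm y \<le> R'" for s y
  proof -
    have "(\<Sum>j\<le>n. s ^ j * c j y) = (\<Sum>j\<le>b. s ^ j * c j y) + (\<Sum>j\<in>{b<..n}. s ^ j * c j y)"
      by (subst sum.union_disjoint[symmetric]) (auto intro!: sum.cong simp: n_def)
    also have "(\<Sum>j\<le>b. s ^ j * c j y) = (\<Sum>j\<le>b. (if j = 0 then g y else 0) + (if j = b then s ^ b * lie_derivative Y g y else 0))"
      using ab(2) lead[OF that] by (intro sum.cong) auto
    finally show ?thesis by (simp add: sum.distrib)
  qed
  have cP: "unif_bigo a R (\<lambda>s y. c j (P s y) - c j y)" for j
  proof -
    have "unif_bigo a R (\<lambda>s y. (c j (P s y) - c j y - s ^ a * lie_derivative X (c j) y) + s ^ a * lie_derivative X (c j) y)"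
    proof (intro unif_bigo_add)
      show "unif_bigo a R (\<lambda>s y. c j (P s y) - c j y - s ^ a * lie_derivative X (c j) y)"
        using P(2) c(1) R unif_bigo_le[of "a + 1" R _ a] unfolding leads_def by auto
      show "unif_bigo a R (\<lambda>s y. s ^ a * lie_derivative X (c j) y)"
        by (intro unif_bigo_mult[OF unif_bigo_const[OF smooth_continuous[OF smooth_lie_derivative[OF X c(1)]]]]) auto
    qed
    then show ?thesis by simp
  qed
  obtain d where d: "d > 0" "\<And>s y. 0 \<le> s \<Longrightarrow> s \<le> d \<Longrightarrow> norm y \<le> R \<Longrightarrow> norm (P s y) \<le> R'"
    using near_id_stay[OF P(1) R'(1)] by blast
  have "unif_bigo (n + 1) R (\<lambda>s z. r s (P s z) - r s z
      + s ^ b * (lie_derivative Y g (P s z) - lie_derivative Y g z - s ^ a * lie_derivative X (lie_derivative Y g) z)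
      + (\<Sum>j\<in>{b<..n}. s ^ j * (c j (P s z) - c j z)))"
  proof (intro unif_bigo_add unif_bigo_diff unif_bigo_sum)
    show "unif_bigo (n + 1) R (\<lambda>s z. r s (P s z))"
      unfolding r_def by (rule unif_bigo_comp[OF c(2) P(1) R'(1)])
    show "unif_bigo (n + 1) R r"
      unfolding r_def[abs_def] by (rule unif_bigo_subset[OF c(2)]) (use R' in simp)
    show "unif_bigo (n + 1) R (\<lambda>s z. s ^ b * (lie_derivative Y g (P s z) - lie_derivative Y g z - s ^ a * lie_derivative X (lie_derivative Y g) z))"
      using P(2) R smooth_lie_derivative[OF Y g] unfolding leads_def by (intro unif_bigo_mult[of "a + 1"]) (auto simp: n_def)
    show "unif_bigo (n + 1) R (\<lambda>s z. s ^ j * (c j (P s z) - c j z))" if "j \<in> {b<..n}" for j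
      using that by (intro unif_bigo_mult[OF cP]) (auto simp: n_def)
  qed
  then show ?thesis
    unfolding n_def[symmetric]
  proof (rule unif_bigo_cong[OF _ d(1)])
    fix s z assume s: "0 \<le> s" "s \<le> d" "norm (z::'a) \<le> R"
    then have *: "norm (P s z) \<le> R'" "norm z \<le> R'" using d(2) R' by auto
    show "r s (P s z) - r s z
      + s ^ b * (lie_derivative Y g (P s z) - lie_derivative Y g z - s ^ a * lie_derivative X (lie_derivative Y g) z)
      + (\<Sum>j\<in>{b<..n}. s ^ j * (c j (P s z) - c j z)) =
      g (Q s (P s z)) - g (P s z) - g (Q s z) + g z - s ^ n * lie_derivative X (lie_derivative Y g) z"
      unfolding r_def split[OF *(1)] split[OF *(2)]
      by (simp add: right_diff_distrib sum_subtractf n_def power_add algebra_simps)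
  qed
qed

text \<open>The expansion of \<open>P\<close> is taken at \<open>Pv s y\<close>, which
  \<open>P s\<close> sends back to \<open>y\<close>; moving the derivative from
  \<open>Pv s y\<close> to \<open>y\<close> costs one more factor \<open>s\<close>.\<close>

lemma leads_inverse:
  assumes P: "leads R0 a X P" and Pv: "near_id Pv" and X: "smooth X"
    and inv: "d > 0" "\<And>s y. 0 \<le> s \<Longrightarrow> s \<le> d \<Longrightarrow> P s (Pv s y) = y"
  shows "leads R0 a (\<lambda>x. - X x) Pv"
  unfolding leads_def
proof (intro allI impI)
  fix g :: "'a \<Rightarrow> real" and R
  assume g: "smooth g" and R: "R < R0"
  define R' where "R' = (R + R0) / 2"
  have R': "R < R'" "R' < R0" using R by (auto simp: R'_def)
  have neg: "lie_derivative (\<lambda>x. - X x) g y = - lie_derivative X g y" for y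
    by (simp add: lie_derivative_def linear_neg[OF has_derivative_linear[OF smooth_has_derivative[OF g]]])
  have "unif_bigo (a + 1) R' (\<lambda>s y. g (P s y) - g y - s ^ a * lie_derivative X g y)"
    using P g R' unfolding leads_def by blast
  then have "unif_bigo (a + 1) R (\<lambda>s y. - (g (P s (Pv s y)) - g (Pv s y) - s ^ a * lie_derivative X g (Pv s y))
      - s ^ a * (lie_derivative X g (Pv s y) - lie_derivative X g y))"
    by (intro unif_bigo_diff[OF unif_bigo_minus[OF unif_bigo_comp[OF _ Pv R'(1), where u="\<lambda>s z. g (P s z) - g z - s ^ a * lie_derivative X g z"]]
        unif_bigo_mult[OF unif_bigo_near_id[OF smooth_Ck[OF smooth_lie_derivative[OF X g]] Pv]]]) auto
  then show "unif_bigo (a + 1) R (\<lambda>s y. g (Pv s y) - g y - s ^ a * lie_derivative (\<lambda>x. - X x) g y)"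
    by (rule unif_bigo_cong[OF _ inv(1)]) (simp add: inv(2) neg algebra_simps)
qed

text \<open>At \<open>z = Qv s (Pv s y)\<close> one has \<open>P s (Q s z) = y\<close>. In the
  difference of the two mixed differences everything cancels except
  \<open>g (Q s (P s z)) - g y\<close> and the commutator of the two derivations.\<close>

lemma leads_commutator:
  assumes P: "near_id P" "leads R0 a X P" "expands R0 P" and Q: "near_id Q" "leads R0 b Y Q" "expands R0 Q"
    and ab: "a \<ge> 1" "b \<ge> 1" and XY: "smooth X" "smooth Y"
    and inv: "near_id Pv" "near_id Qv" "d > 0"
      "\<And>s y. 0 \<le> s \<Longrightarrow> s \<le> d \<Longrightarrow> P s (Pv s y) = y"
      "\<And>s y. 0 \<le> s \<Longrightarrow> s \<le> d \<Longrightarrow> Q s (Qv s y) = y"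
  shows "leads R0 (a + b) (lie_bracket X Y) (\<lambda>s y. Q s (P s (Qv s (Pv s y))))"
  unfolding leads_def
proof (intro allI impI)
  fix g :: "'a \<Rightarrow> real" and R
  assume g: "smooth g" and R: "R < R0"
  define R' where "R' = (R + R0) / 2"
  have R': "R < R'" "R' < R0" using R by (auto simp: R'_def)
  define A where "A s z = g (Q s (P s z)) - g (P s z) - g (Q s z) + g z - s ^ (a + b) * lie_derivative X (lie_derivative Y g) z" for s z
  define B where "B s z = g (P s (Q s z)) - g (Q s z) - g (P s z) + g z - s ^ (a + b) * lie_derivative Y (lie_derivative X g) z" for s z
  have A: "unif_bigo (a + b + 1) R' A"
    unfolding A_def[abs_def] by (rule leads_mixed_difference[OF P(1,2) Q(3,2) ab XY g R'(2)])
  have B: "unif_bigo (a + b + 1) R' B"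
    unfolding B_def[abs_def]
    using leads_mixed_difference[OF Q(1,2) P(3,2) ab(2,1) XY(2,1) g R'(2)] by (simp add: add.commute)
  let ?Z = "\<lambda>s y. Qv s (Pv s y)"
  have Z: "near_id ?Z" by (rule near_id_comp[OF inv(1,2)])
  have "unif_bigo (a + b + 1) R (\<lambda>s y. A s (?Z s y) - B s (?Z s y)
      + s ^ (a + b) * (lie_derivative (lie_bracket X Y) g (?Z s y) - lie_derivative (lie_bracket X Y) g y))"
    by (rule unif_bigo_add[OF unif_bigo_diff[OF unif_bigo_comp[OF A Z R'(1)] unif_bigo_comp[OF B Z R'(1)]]
          unif_bigo_mult[OF unif_bigo_near_id[OF smooth_Ck[OF smooth_lie_derivative[OF smooth_lie_bracket[OF XY] g]] Z]]]) simp
  then show "unif_bigo (a + b + 1) R (\<lambda>s y. g (Q s (P s (?Z s y))) - g y - s ^ (a + b) * lie_derivative (lie_bracket X Y) g y)"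
  proof (rule unif_bigo_cong[OF _ inv(3)])
    fix s y assume "0 \<le> s" "s \<le> d"
    then have "P s (Q s (?Z s y)) = y" using inv(4,5) by simp
    then show "A s (?Z s y) - B s (?Z s y)
      + s ^ (a + b) * (lie_derivative (lie_bracket X Y) g (?Z s y) - lie_derivative (lie_bracket X Y) g y)
      = g (Q s (P s (?Z s y))) - g y - s ^ (a + b) * lie_derivative (lie_bracket X Y) g y"
      by (simp add: A_def B_def lie_derivative_lie_bracket[OF XY g] algebra_simps)
  qed
qed

section \<open>Iterated brackets and the words of flows that realize them\<close>

datatype 'l bracket_tree = Gen 'l | Brk "'l bracket_tree" "'l bracket_tree"

primrec tree_field :: "('l \<Rightarrow> 'a::euclidean_space \<Rightarrow> 'a) \<Rightarrow> 'l bracket_tree \<Rightarrow> 'a \<Rightarrow> 'a" where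
  "tree_field F (Gen l) = F l"
| "tree_field F (Brk a b) = lie_bracket (tree_field F a) (tree_field F b)"

primrec tree_order :: "'l bracket_tree \<Rightarrow> nat" where
  "tree_order (Gen l) = 1"
| "tree_order (Brk a b) = tree_order a + tree_order b"

lemma tree_order_pos: "tree_order t \<ge> 1"
  by (induction t) auto

lemma smooth_tree_field: "(\<And>l. smooth (F l)) \<Longrightarrow> smooth (tree_field F t)"
  by (induction t) (auto intro: smooth_lie_bracket)

text \<open>The differential equation is available only while a curve stays in the ball of radius
  \<open>R0\<close>, outside of which the fields are truncated; the Lipschitz bound and the
  inversion by \<open>rv\<close> hold everywhere.\<close>

locale local_flows =
  fixes F :: "'l \<Rightarrow> 'a::euclidean_space \<Rightarrow> 'a" and rv :: "'l \<Rightarrow> 'l"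
    and \<phi> :: "'l \<Rightarrow> real \<Rightarrow> 'a \<Rightarrow> 'a" and h M R0 :: real
  assumes smooth_F: "smooth (F l)"
    and rv_rv: "rv (rv l) = l"
    and h_pos: "h > 0" and M_nonneg: "M \<ge> 0"
    and flow_0: "\<phi> l 0 y = y"
    and flow_lipschitz: "s \<in> {0..h} \<Longrightarrow> t \<in> {0..h} \<Longrightarrow>
      norm (\<phi> l s y - \<phi> l t y') \<le> M * \<bar>s - t\<bar> + 2 * norm (y - y')"
    and flow_derivative: "t \<in> {0..h} \<Longrightarrow> \<phi> l t y \<in> cball 0 R0 \<Longrightarrow>
      ((\<lambda>t. \<phi> l t y) has_vector_derivative F l (\<phi> l t y)) (at t within {0..h})"
    and flow_rv: "t \<in> {0..h} \<Longrightarrow> \<phi> (rv l) t (\<phi> l t y) = y"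
begin

lemma flow_near: "t \<in> {0..h} \<Longrightarrow> norm (\<phi> l t y - y) \<le> M * t"
  using flow_lipschitz[of t 0 l y y] h_pos by (simp add: flow_0)

lemma near_id_flow: "near_id (\<phi> l)"
  unfolding near_id_def using flow_near h_pos by blast

text \<open>The time derivative of the remainder for \<open>g\<close> is the remainder of one order
  less for \<open>lie_derivative (F l) g\<close>; the mean value estimate gains the missing power of
  \<open>s\<close>.\<close>

lemma flow_taylor:
  fixes g :: "'a \<Rightarrow> real"
  assumes "smooth g" and R: "R < R0"
  shows "unif_bigo (n + 1) R (\<lambda>s y. g (\<phi> l s y) - (\<Sum>j\<le>n. s ^ j * ((lie_derivative (F l) ^^ j) g y / fact j)))"
  using assms(1)
proof (induction n arbitrary: g)
  case 0
  then show ?case using unif_bigo_near_id[OF smooth_Ck[OF 0] near_id_flow] by simp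
next
  case (Suc n)
  let ?c = "\<lambda>j. (lie_derivative (F l) ^^ j) g"
  have c_Suc: "(lie_derivative (F l) ^^ j) (lie_derivative (F l) g) = ?c (Suc j)" for j
    by (simp add: funpow_swap1)
  obtain C d where C: "C \<ge> 0" "d > 0" "d \<le> 1" "\<And>s y. 0 \<le> s \<Longrightarrow> s \<le> d \<Longrightarrow> norm y \<le> R \<Longrightarrow>
      \<bar>lie_derivative (F l) g (\<phi> l s y) - (\<Sum>j\<le>n. s ^ j * (?c (Suc j) y / fact j))\<bar> \<le> C * s ^ (n + 1)"
    by (rule unif_bigoE[OF Suc.IH[OF smooth_lie_derivative[OF smooth_F[of l] Suc.prems], unfolded c_Suc]]) (rule that)
  obtain d' where d': "d' > 0" "\<And>s y. 0 \<le> s \<Longrightarrow> s \<le> d' \<Longrightarrow> norm y \<le> R \<Longrightarrow> norm (\<phi> l s y) \<le> R0"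
    using near_id_stay[OF near_id_flow R] by blast
  show ?case
  proof (rule unif_bigoI[of "min h (min d d')"])
    show "min h (min d d') > 0" using h_pos C d' by simp
    fix S y assume S: "0 \<le> S" "S \<le> min h (min d d')" and y: "norm (y::'a) \<le> R"
    define r where "r s = g (\<phi> l s y) - (\<Sum>j\<le>Suc n. s ^ j * (?c j y / fact j))" for s
    have "norm (r S - r 0) \<le> (C * S ^ (n + 1)) * norm (S - 0)"
    proof (rule field_differentiable_bound[where S="{0..S}"])
      fix s assume s: "s \<in> {0..S}"
      let ?x = "\<phi> l s y"
      have "((\<lambda>t. \<phi> l t y) has_vector_derivative F l ?x) (at s within {0..h})"
        using s S y d' by (intro flow_derivative) auto
      then have "((\<lambda>t. \<phi> l t y) has_derivative (\<lambda>u. u *\<^sub>R F l ?x)) (at s within {0..S})"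
        using S unfolding has_vector_derivative_def by (auto intro: has_derivative_subset)
      then have "((\<lambda>t. g (\<phi> l t y)) has_derivative (\<lambda>u. frechet_derivative g (at ?x) (u *\<^sub>R F l ?x))) (at s within {0..S})"
        by (rule has_derivative_compose[OF _ smooth_has_derivative[OF Suc.prems]])
      moreover have "frechet_derivative g (at ?x) (u *\<^sub>R F l ?x) = lie_derivative (F l) g ?x * u" for u
        using linear_scale[OF has_derivative_linear[OF smooth_has_derivative[OF Suc.prems]]]
        by (simp add: lie_derivative_def)
      ultimately have 1: "((\<lambda>t. g (\<phi> l t y)) has_real_derivative lie_derivative (F l) g ?x) (at s within {0..S})"
        by (simp add: has_field_derivative_def)
      have "((\<lambda>s. ?c 0 y / fact 0 + (\<Sum>j\<le>n. s ^ Suc j * (?c (Suc j) y / fact (Suc j)))) has_real_derivative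
          0 + (\<Sum>j\<le>n. (real (Suc j) * s ^ j) * (?c (Suc j) y / fact (Suc j)))) (at s within {0..S})"
        by (intro DERIV_add DERIV_const DERIV_sum DERIV_cmult_right)
           (use DERIV_pow[of "Suc _" s] in \<open>auto simp del: power_Suc of_nat_Suc\<close>)
      moreover have "(real (Suc j) * s ^ j) * (?c (Suc j) y / fact (Suc j)) = s ^ j * (?c (Suc j) y / fact j)" for j
        by (simp del: of_nat_Suc funpow.simps)
      ultimately have 2: "((\<lambda>s. \<Sum>j\<le>Suc n. s ^ j * (?c j y / fact j)) has_real_derivative
          (\<Sum>j\<le>n. s ^ j * (?c (Suc j) y / fact j))) (at s within {0..S})"
        unfolding sum.atMost_Suc_shift[of _ n] by (simp del: fact_Suc funpow.simps power_Suc)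
      show "(r has_real_derivative lie_derivative (F l) g ?x - (\<Sum>j\<le>n. s ^ j * (?c (Suc j) y / fact j))) (at s within {0..S})"
        unfolding r_def[abs_def] by (rule DERIV_diff[OF 1 2])
      have "norm (lie_derivative (F l) g ?x - (\<Sum>j\<le>n. s ^ j * (?c (Suc j) y / fact j))) \<le> C * s ^ (n + 1)"
        using C(4)[of s y] s S y by simp
      also have "\<dots> \<le> C * S ^ (n + 1)"
        using s C(1) by (intro mult_left_mono power_mono) auto
      finally show "norm (lie_derivative (F l) g ?x - (\<Sum>j\<le>n. s ^ j * (?c (Suc j) y / fact j))) \<le> C * S ^ (n + 1)" .
    qed (use S in auto)
    moreover have "r 0 = 0"
      unfolding r_def sum.atMost_Suc_shift[of _ n] by (simp add: flow_0)
    ultimately show "\<bar>g (\<phi> l S y) - (\<Sum>j\<le>Suc n. S ^ j * (?c j y / fact j))\<bar> \<le> C * S ^ (Suc n + 1)"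
      using S unfolding r_def by (simp add: mult_ac del: sum.atMost_Suc funpow.simps)
  qed
qed

lemma expands_flow: "expands R0 (\<phi> l)"
  unfolding expands_def
proof (intro allI impI)
  fix g :: "'a \<Rightarrow> real" and n R
  assume g: "smooth g" and R: "R < R0"
  have "smooth ((lie_derivative (F l) ^^ j) g)" for j
    by (induction j) (auto intro: smooth_lie_derivative smooth_F g)
  then have "smooth (\<lambda>y. (lie_derivative (F l) ^^ j) g y / fact j)" for j
    by (rule smooth_bounded_linear_comp[OF bounded_linear_divide])
  then show "\<exists>c. (\<forall>j. smooth (c j)) \<and> unif_bigo (n + 1) R (\<lambda>s y. g (\<phi> l s y) - (\<Sum>j\<le>n. s ^ j * c j y))"
    using flow_taylor[OF g R, of n l] by (intro exI[of _ "\<lambda>j y. (lie_derivative (F l) ^^ j) g y / fact j"]) blast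
qed

lemma leads_flow: "leads R0 1 (F l) (\<phi> l)"
  unfolding leads_def
proof (intro allI impI)
  fix g :: "'a \<Rightarrow> real" and R
  assume g: "smooth g" and R: "R < R0"
  show "unif_bigo (1 + 1) R (\<lambda>s y. g (\<phi> l s y) - g y - s ^ 1 * lie_derivative (F l) g y)"
    by (rule unif_bigo_cong[OF flow_taylor[OF g R, of 1 l] zero_less_one]) simp
qed

definition run :: "'l list \<Rightarrow> real \<Rightarrow> 'a \<Rightarrow> 'a" where
  "run w s y = fold (\<lambda>l. \<phi> l s) w y"

definition inv_word :: "'l list \<Rightarrow> 'l list" where
  "inv_word w = map rv (rev w)"

lemma run_simps [simp]:
  "run [] s y = y" "run (l # w) s y = run w s (\<phi> l s y)" "run (w @ w') s y = run w' s (run w s y)"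
  by (simp_all add: run_def)

lemma run_0: "run w 0 y = y"
  by (induction w) (auto simp: flow_0)

lemma inv_word_inv_word: "inv_word (inv_word w) = w"
  by (simp add: inv_word_def rev_map rv_rv o_def)

lemma length_inv_word: "length (inv_word w) = length w"
  by (simp add: inv_word_def)

lemma run_inv_word: "s \<in> {0..h} \<Longrightarrow> run (inv_word w) s (run w s y) = y"
  by (induction w arbitrary: y) (auto simp: inv_word_def flow_rv)

lemma run_run_inv_word: "s \<in> {0..h} \<Longrightarrow> run w s (run (inv_word w) s y) = y"
  using run_inv_word[of s "inv_word w" y] by (simp add: inv_word_inv_word)

lemma run_near: "s \<in> {0..h} \<Longrightarrow> norm (run w s y - y) \<le> length w * M * s"
proof (induction w arbitrary: y)
  case (Cons l w)
  have "norm (run w s (\<phi> l s y) - \<phi> l s y) \<le> length w * M * s" "norm (\<phi> l s y - y) \<le> M * s"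
    by (rule Cons.IH[OF Cons.prems] flow_near[OF Cons.prems])+
  then have "norm ((run w s (\<phi> l s y) - \<phi> l s y) + (\<phi> l s y - y)) \<le> length w * M * s + M * s"
    by (intro norm_triangle_le add_mono)
  then show ?case by (simp add: algebra_simps)
qed simp

lemma near_id_run: "near_id (run w)"
  unfolding near_id_def using run_near h_pos by blast

lemma expands_run: "expands R0 (run w)"
proof (induction w)
  case Nil
  then show ?case using expands_id by (simp add: run_def[abs_def])
next
  case (Cons l w)
  show ?case
    using expands_comp[OF near_id_flow expands_flow Cons.IH, of l] by (simp add: run_def[abs_def])
qed

lemma continuous_on_flow:
  assumes "continuous_on A s" "continuous_on A y" "s ` A \<subseteq> {0..h}"
  shows "continuous_on A (\<lambda>x. \<phi> l (s x) (y x))"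
proof -
  have "continuous_on ({0..h} \<times> UNIV) (\<lambda>p. \<phi> l (fst p) (snd p))"
  proof (rule lipschitz_on_continuous_on[where L="M + 2"], rule lipschitz_onI)
    fix p q assume pq: "p \<in> {0..h} \<times> (UNIV :: 'a set)" "q \<in> {0..h} \<times> (UNIV :: 'a set)"
    have "dist (\<phi> l (fst p) (snd p)) (\<phi> l (fst q) (snd q)) \<le> M * dist (fst p) (fst q) + 2 * dist (snd p) (snd q)"
      using flow_lipschitz[of "fst p" "fst q"] pq by (auto simp: dist_norm)
    also have "\<dots> \<le> M * dist p q + 2 * dist p q"
      using M_nonneg by (intro add_mono mult_left_mono dist_fst_le dist_snd_le) auto
    finally show "dist (\<phi> l (fst p) (snd p)) (\<phi> l (fst q) (snd q)) \<le> (M + 2) * dist p q"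
      by (simp add: algebra_simps)
  qed (use M_nonneg in auto)
  from continuous_on_compose2[OF this continuous_on_Pair[OF assms(1,2)]] show ?thesis
    using assms(3) by auto
qed

lemma continuous_on_run:
  assumes "continuous_on A s" "continuous_on A y" "s ` A \<subseteq> {0..h}"
  shows "continuous_on A (\<lambda>x. run w (s x) (y x))"
  using assms(2)
proof (induction w arbitrary: y)
  case (Cons l w)
  show ?case
    using Cons.IH[OF continuous_on_flow[OF assms(1) Cons.prems assms(3), of l]] by simp
qed simp

text \<open>Letters act from left to right, so this is the order of \<open>leads_commutator\<close>:
  both inverses, then \<open>a\<close>, then \<open>b\<close>.\<close>

primrec word :: "'l bracket_tree \<Rightarrow> 'l list" where
  "word (Gen l) = [l]"
| "word (Brk a b) = inv_word (word a) @ inv_word (word b) @ word a @ word b"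

lemma leads_word: "leads R0 (tree_order t) (tree_field F t) (run (word t))"
proof (induction t)
  case (Gen l)
  then show ?case using leads_flow by (simp add: run_def[abs_def])
next
  case (Brk a b)
  have "leads R0 (tree_order a + tree_order b) (lie_bracket (tree_field F a) (tree_field F b))
    (\<lambda>s y. run (word b) s (run (word a) s (run (inv_word (word b)) s (run (inv_word (word a)) s y))))"
    using h_pos run_run_inv_word
    by (intro leads_commutator[where d=h] near_id_run expands_run Brk tree_order_pos
        smooth_tree_field smooth_F) auto
  moreover have "run (word (Brk a b)) =
     (\<lambda>s y. run (word b) s (run (word a) s (run (inv_word (word b)) s (run (inv_word (word a)) s y))))"
    by (simp add: fun_eq_iff)
  ultimately show ?case by simp
qed

lemma leads_inv_word: "leads R0 (tree_order t) (\<lambda>x. - tree_field F t x) (run (inv_word (word t)))"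
  by (rule leads_inverse[OF leads_word near_id_run smooth_tree_field[OF smooth_F] h_pos])
     (simp add: run_run_inv_word)

text \<open>One of the two times is zero, so that the move follows the word or its inverse according
  to the sign of \<open>t\<close>; the root makes the displacement linear in \<open>t\<close>.\<close>

definition move :: "'l bracket_tree \<Rightarrow> real \<Rightarrow> 'a \<Rightarrow> 'a" where
  "move \<tau> t y = run (word \<tau>) (root (tree_order \<tau>) (max 0 t))
     (run (inv_word (word \<tau>)) (root (tree_order \<tau>) (max 0 (- t))) y)"

lemma move_cases:
  "t \<ge> 0 \<Longrightarrow> move \<tau> t y = run (word \<tau>) (root (tree_order \<tau>) \<bar>t\<bar>) y"
  "t \<le> 0 \<Longrightarrow> move \<tau> t y = run (inv_word (word \<tau>)) (root (tree_order \<tau>) \<bar>t\<bar>) y"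
  by (simp_all add: move_def run_0 max_def)

lemma root_le_iff_power:
  assumes "n \<ge> 1" "0 \<le> d" "\<bar>t\<bar> \<le> d ^ n"
  shows "root n \<bar>t\<bar> \<in> {0..d}"
proof -
  have "root n \<bar>t\<bar> \<le> root n (d ^ n)"
    using assms by (intro real_root_le_mono) auto
  also have "\<dots> = d" using assms by (simp add: real_root_power_cancel)
  finally show ?thesis using assms by simp
qed

text \<open>With the duration \<open>s\<close> equal to the root of \<open>\<bar>t\<bar>\<close> of
  order \<open>tree_order \<tau>\<close>, the leading term is linear in \<open>\<bar>t\<bar>\<close>
  and the remainder is \<open>\<bar>t\<bar>\<close> times \<open>O(s)\<close>. For negative
  \<open>t\<close> the inverse word supplies the opposite field.\<close>

lemma move_linear_approx:
  assumes R: "R < R0" and \<eta>: "\<eta> > 0"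
  shows "\<exists>\<delta>>0. \<forall>t y. \<bar>t\<bar> \<le> \<delta> \<longrightarrow> norm y \<le> R \<longrightarrow>
     norm (move \<tau> t y - y - t *\<^sub>R tree_field F \<tau> y) \<le> \<eta> * \<bar>t\<bar>"
proof -
  let ?k = "tree_order \<tau>"
  have main: "\<exists>\<delta>>0. \<forall>t y. \<bar>t\<bar> \<le> \<delta> \<longrightarrow> norm y \<le> R \<longrightarrow>
     norm (P (root ?k \<bar>t\<bar>) y - y - \<bar>t\<bar> *\<^sub>R X y) \<le> \<eta> * \<bar>t\<bar>" if lead: "leads R0 ?k X P"
    for X :: "'a \<Rightarrow> 'a" and P
  proof -
    have "\<exists>C\<ge>0. \<exists>d>0. \<forall>s y. 0 \<le> s \<longrightarrow> s \<le> d \<longrightarrow> norm y \<le> R \<longrightarrow>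
        \<bar>(P s y - y - s ^ ?k *\<^sub>R X y) \<bullet> b\<bar> \<le> C * s ^ (?k + 1)" for b :: 'a
    proof -
      \<comment> \<open>Tested on a coordinate function, \<open>leads\<close> becomes the estimate
        of one component of the displacement.\<close>
      have "frechet_derivative (\<lambda>x::'a. x \<bullet> b) (at y) = (\<lambda>x. x \<bullet> b)" for y :: 'a
        by (rule frechet_derivative_at[symmetric]) (auto intro!: derivative_eq_intros)
      then have "unif_bigo (?k + 1) R (\<lambda>s y. P s y \<bullet> b - y \<bullet> b - s ^ ?k * (X y \<bullet> b))"
        using lead R smooth_inner_left[of b] unfolding leads_def by (auto simp: lie_derivative_def)
      from unif_bigoE[OF this] show ?thesis by (simp add: inner_diff_left) metis
    qed
    then obtain C d where C: "\<And>b. C b \<ge> 0" and d: "\<And>b. d b > 0"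
      "\<And>b s y. 0 \<le> s \<Longrightarrow> s \<le> d b \<Longrightarrow> norm y \<le> R \<Longrightarrow>
         \<bar>(P s y - y - s ^ ?k *\<^sub>R X y) \<bullet> b\<bar> \<le> C b * s ^ (?k + 1)" by metis
    define Cs where "Cs = (\<Sum>b\<in>Basis. C b)"
    have Cs: "Cs \<ge> 0" unfolding Cs_def by (intro sum_nonneg C)
    \<comment> \<open>A bound on the duration: within the range of every component estimate, and
      with \<open>Cs * e \<le> \<eta>\<close>. In terms of the parameter it reads
      \<open>\<bar>t\<bar> \<le> e ^ ?k\<close>.\<close>
    define e where "e = min (Min (d ` (Basis :: 'a set))) (\<eta> / (Cs + 1))"
    have e: "e > 0" "b \<in> Basis \<Longrightarrow> e \<le> d b" for b
      using d \<eta> Cs by (auto simp: e_def min_le_iff_disj)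
    have "Cs * e \<le> \<eta>"
    proof -
      have "e * (Cs + 1) \<le> \<eta>" using Cs by (simp add: pos_le_divide_eq[symmetric] e_def)
      then show ?thesis using e(1) by (simp add: algebra_simps)
    qed
    have "norm (P (root ?k \<bar>t\<bar>) y - y - \<bar>t\<bar> *\<^sub>R X y) \<le> \<eta> * \<bar>t\<bar>" if t: "\<bar>t\<bar> \<le> e ^ ?k" and y: "norm y \<le> R" for t y
    proof -
      define s where "s = root ?k \<bar>t\<bar>"
      have s: "0 \<le> s" "s \<le> e" using root_le_iff_power[OF tree_order_pos _ t] e by (auto simp: s_def)
      have sk: "s ^ ?k = \<bar>t\<bar>" using tree_order_pos[of \<tau>] by (simp add: s_def)
      have "norm (P s y - y - s ^ ?k *\<^sub>R X y) \<le> (\<Sum>b\<in>Basis. \<bar>(P s y - y - s ^ ?k *\<^sub>R X y) \<bullet> b\<bar>)"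
        by (rule norm_le_l1)
      also have "\<dots> \<le> (\<Sum>b\<in>Basis. C b * s ^ (?k + 1))"
        using e s y by (intro sum_mono d) (auto intro: order_trans)
      also have "\<dots> = Cs * s * \<bar>t\<bar>"
        by (simp add: Cs_def sum_distrib_right[symmetric] sk)
      also have "\<dots> \<le> \<eta> * \<bar>t\<bar>"
        using mult_left_mono[OF s(2) Cs] \<open>Cs * e \<le> \<eta>\<close> by (intro mult_right_mono) auto
      finally show ?thesis unfolding sk unfolding s_def .
    qed
    then show ?thesis using e(1) by (intro exI[of _ "e ^ ?k"]) auto
  qed
  obtain \<delta>1 where 1: "\<delta>1 > 0" "\<And>t y. \<bar>t\<bar> \<le> \<delta>1 \<Longrightarrow> norm y \<le> R \<Longrightarrow>
     norm (run (word \<tau>) (root ?k \<bar>t\<bar>) y - y - \<bar>t\<bar> *\<^sub>R tree_field F \<tau> y) \<le> \<eta> * \<bar>t\<bar>"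
    using main[OF leads_word] by blast
  obtain \<delta>2 where 2: "\<delta>2 > 0" "\<And>t y. \<bar>t\<bar> \<le> \<delta>2 \<Longrightarrow> norm y \<le> R \<Longrightarrow>
     norm (run (inv_word (word \<tau>)) (root ?k \<bar>t\<bar>) y - y - \<bar>t\<bar> *\<^sub>R - tree_field F \<tau> y) \<le> \<eta> * \<bar>t\<bar>"
    using main[OF leads_inv_word] by blast
  have "norm (move \<tau> t y - y - t *\<^sub>R tree_field F \<tau> y) \<le> \<eta> * \<bar>t\<bar>"
    if "\<bar>t\<bar> \<le> min \<delta>1 \<delta>2" "norm y \<le> R" for t y
  proof (cases "t \<ge> 0")
    case True
    then show ?thesis using 1(2)[of t y] that move_cases(1)[OF True, of \<tau> y] by simp
  next
    case False
    then have "t \<le> 0" by simp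
    then show ?thesis using 2(2)[of t y] that move_cases(2)[OF \<open>t \<le> 0\<close>, of \<tau> y] by simp
  qed
  then show ?thesis using 1(1) 2(1) by (intro exI[of _ "min \<delta>1 \<delta>2"]) auto
qed

lemma continuous_on_move:
  assumes "continuous_on A t" "continuous_on A y" "\<And>x. x \<in> A \<Longrightarrow> \<bar>t x\<bar> \<le> h ^ tree_order \<tau>"
  shows "continuous_on A (\<lambda>x. move \<tau> (t x) (y x))"
proof -
  have "root (tree_order \<tau>) (max 0 (t x)) \<in> {0..h}" "root (tree_order \<tau>) (max 0 (- t x)) \<in> {0..h}" if "x \<in> A" for x
    using root_le_iff_power[OF tree_order_pos, of h "max 0 (t x)" \<tau>]
      root_le_iff_power[OF tree_order_pos, of h "max 0 (- t x)" \<tau>] assms(3)[OF that] h_pos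
    by auto
  then show ?thesis
    unfolding move_def by (intro continuous_on_run continuous_intros assms) auto
qed

text \<open>The estimate for single flows is summed over the letters; the margin
  \<open>length w * M * s\<close> keeps every intermediate curve in the ball of radius
  \<open>R\<close>.\<close>

lemma run_variation:
  fixes v :: "'a \<Rightarrow> real" and C s :: real
  assumes v: "\<And>l s y. s \<in> {0..h} \<Longrightarrow> (\<And>\<sigma>. \<sigma> \<in> {0..s} \<Longrightarrow> norm (\<phi> l \<sigma> y) \<le> R) \<Longrightarrow> \<bar>v (\<phi> l s y) - v y\<bar> \<le> C * s"
    and s: "s \<in> {0..h}"
  shows "norm y + length w * M * s \<le> R \<Longrightarrow> \<bar>v (run w s y) - v y\<bar> \<le> length w * C * s"
proof (induction w arbitrary: y)
  case (Cons l w)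
  have near: "norm (\<phi> l \<sigma> y) \<le> norm y + M * s" if "\<sigma> \<in> {0..s}" for \<sigma>
  proof -
    have "norm (\<phi> l \<sigma> y - y) \<le> M * \<sigma>" using that s by (intro flow_near) auto
    moreover have "M * \<sigma> \<le> M * s" using that M_nonneg by (intro mult_left_mono) auto
    ultimately show ?thesis using norm_triangle_ineq[of "\<phi> l \<sigma> y - y" y] by simp
  qed
  have split: "norm y + M * s + length w * M * s \<le> R" using Cons.prems by (simp add: algebra_simps)
  have "0 \<le> length w * M * s" using M_nonneg s by simp
  then have "\<bar>v (\<phi> l s y) - v y\<bar> \<le> C * s"
    using near split by (intro v s) (smt (verit))
  moreover have "\<bar>v (run w s (\<phi> l s y)) - v (\<phi> l s y)\<bar> \<le> length w * C * s"
    using near[of s] split s by (intro Cons.IH) auto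
  ultimately show ?case by (simp add: algebra_simps)
qed simp

text \<open>An analogue of canonical coordinates of the second kind: one bracket
  \<open>\<tau> b\<close> per basis vector, run one after the other, with the coordinates of
  \<open>t\<close> as parameters.\<close>

definition moves :: "('a \<Rightarrow> 'l bracket_tree) \<Rightarrow> 'a list \<Rightarrow> 'a \<Rightarrow> 'a \<Rightarrow> 'a" where
  "moves \<tau> bs t y = fold (\<lambda>b. move (\<tau> b) (t \<bullet> b)) bs y"

lemma moves_simps [simp]:
  "moves \<tau> [] t y = y" "moves \<tau> (b # bs) t y = moves \<tau> bs t (move (\<tau> b) (t \<bullet> b) y)"
  by (simp_all add: moves_def)

lemma continuous_on_moves:
  assumes "set bs \<subseteq> Basis" "\<And>b. b \<in> set bs \<Longrightarrow> r \<le> h ^ tree_order (\<tau> b)" "continuous_on (cball 0 r) y"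
  shows "continuous_on (cball 0 r) (\<lambda>t. moves \<tau> bs t (y t))"
  using assms
proof (induction bs arbitrary: y)
  case (Cons b bs)
  have "\<bar>t \<bullet> b\<bar> \<le> h ^ tree_order (\<tau> b)" if "t \<in> cball 0 r" for t
    using that Basis_le_norm[of b t] Cons.prems(1) Cons.prems(2)[of b] by auto
  then have "continuous_on (cball 0 r) (\<lambda>t. move (\<tau> b) (t \<bullet> b) (y t))"
    by (intro continuous_on_move Cons.prems continuous_intros)
  then show ?case using Cons by simp
qed simp

text \<open>The first move displaces the base point by \<open>O(norm t)\<close>, and the linear part
  of the remaining moves already carries a factor \<open>norm t\<close>, so it changes by
  \<open>o(norm t)\<close> only. The tolerance is shared by three errors: the remaining moves, this
  change, and the first move.\<close>

lemma moves_linear_approx: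
  assumes "set bs \<subseteq> Basis" "R < R0" "\<eta> > 0"
  shows "\<exists>\<delta>>0. \<forall>t y. norm t \<le> \<delta> \<longrightarrow> norm y \<le> R \<longrightarrow>
     norm (moves \<tau> bs t y - y - (\<Sum>b\<leftarrow>bs. (t \<bullet> b) *\<^sub>R tree_field F (\<tau> b) y)) \<le> \<eta> * norm t"
  using assms
proof (induction bs arbitrary: R \<eta>)
  case Nil
  then show ?case by (intro exI[of _ 1]) auto
next
  case (Cons b bs)
  let ?X = "\<lambda>b. tree_field F (\<tau> b)"
  let ?L = "\<lambda>t y. (\<Sum>b\<leftarrow>bs. (t \<bullet> b) *\<^sub>R ?X b y)"
  define R' where "R' = (R + R0) / 2"
  have R': "R < R'" "R' < R0" using Cons.prems by (auto simp: R'_def)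
  obtain \<delta>1 where 1: "\<delta>1 > 0" "\<And>t y. norm t \<le> \<delta>1 \<Longrightarrow> norm y \<le> R' \<Longrightarrow>
     norm (moves \<tau> bs t y - y - ?L t y) \<le> (\<eta> / 3) * norm t"
    using Cons.IH[of R' "\<eta> / 3"] Cons.prems R' by auto
  define \<eta>' where "\<eta>' = \<eta> / 3"
  have \<eta>': "\<eta>' > 0" using Cons.prems by (simp add: \<eta>'_def)
  obtain \<delta>2 where 2: "\<delta>2 > 0" "\<And>t y. \<bar>t\<bar> \<le> \<delta>2 \<Longrightarrow> norm y \<le> R \<Longrightarrow>
     norm (move (\<tau> b) t y - y - t *\<^sub>R ?X b y) \<le> \<eta>' * \<bar>t\<bar>"
    using move_linear_approx[OF Cons.prems(2) \<eta>', of "\<tau> b"] by blast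
  have C1: "Ck (Suc 0) (?X c)" for c using smooth_Ck smooth_tree_field smooth_F by blast
  obtain K where K: "\<And>c. K c \<ge> 0"
    "\<And>c x y. x \<in> cball 0 R' \<Longrightarrow> y \<in> cball 0 R' \<Longrightarrow> norm (?X c x - ?X c y) \<le> K c * norm (x - y)"
    using C1_lipschitz_on_cball[OF C1, of 0 R'] by metis
  have "bounded (?X b ` cball 0 R)"
    using Ck_continuous[OF C1] by (intro compact_imp_bounded compact_continuous_image) (auto intro: continuous_on_subset)
  then obtain B where B: "B > 0" "\<And>y. y \<in> cball 0 R \<Longrightarrow> norm (?X b y) \<le> B"
    unfolding bounded_pos by blast
  define Ks where "Ks = (\<Sum>c\<leftarrow>bs. K c)"
  have Ks: "Ks \<ge> 0" unfolding Ks_def by (intro sum_list_nonneg) (use K in auto)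
  have Lip: "norm (?L t x - ?L t y) \<le> norm t * Ks * norm (x - y)"
    if "x \<in> cball 0 R'" "y \<in> cball 0 R'" for t x y
    using Cons.prems(1) unfolding Ks_def
  proof (induction bs)
    case (Cons c cs)
    have "norm ((t \<bullet> c) *\<^sub>R (?X c x - ?X c y)) \<le> norm t * (K c * norm (x - y))"
      unfolding norm_scaleR using Cons.prems Basis_le_norm[of c t] K(2)[OF that, of c]
      by (intro mult_mono) auto
    moreover have "norm ((\<Sum>b\<leftarrow>cs. (t \<bullet> b) *\<^sub>R ?X b x) - (\<Sum>b\<leftarrow>cs. (t \<bullet> b) *\<^sub>R ?X b y)) \<le> norm t * (\<Sum>c\<leftarrow>cs. K c) * norm (x - y)"
      using Cons by auto
    moreover have "(\<Sum>b\<leftarrow>c # cs. (t \<bullet> b) *\<^sub>R ?X b x) - (\<Sum>b\<leftarrow>c # cs. (t \<bullet> b) *\<^sub>R ?X b y)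
      = (t \<bullet> c) *\<^sub>R (?X c x - ?X c y) + ((\<Sum>b\<leftarrow>cs. (t \<bullet> b) *\<^sub>R ?X b x) - (\<Sum>b\<leftarrow>cs. (t \<bullet> b) *\<^sub>R ?X b y))"
      by (simp add: scaleR_diff_right)
    ultimately show ?case
      using norm_triangle_ineq[of "(t \<bullet> c) *\<^sub>R (?X c x - ?X c y)" "(\<Sum>b\<leftarrow>cs. (t \<bullet> b) *\<^sub>R ?X b x) - (\<Sum>b\<leftarrow>cs. (t \<bullet> b) *\<^sub>R ?X b y)"]
      by (simp add: algebra_simps)
  qed simp
  define E where "E = B + \<eta>'"
  have E: "E > 0" using B \<eta>' by (simp add: E_def)
  \<comment> \<open>\<open>E\<close> is the displacement per unit of \<open>norm t\<close>. The
    third bound keeps the displaced point in the ball of radius \<open>R'\<close>; the fourth makes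
    the change of the linear part at most \<open>\<eta>' * norm t\<close>.\<close>
  define \<delta> where "\<delta> = min (min \<delta>1 \<delta>2) (min ((R' - R) / E) (\<eta>' / ((Ks + 1) * E)))"
  have \<delta>: "\<delta> > 0" "\<delta> \<le> \<delta>1" "\<delta> \<le> \<delta>2" "\<delta> * E \<le> R' - R" "\<delta> * ((Ks + 1) * E) \<le> \<eta>'"
  proof -
    have "(Ks + 1) * E > 0" using Ks E by simp
    then show "\<delta> > 0" "\<delta> \<le> \<delta>1" "\<delta> \<le> \<delta>2" "\<delta> * E \<le> R' - R" "\<delta> * ((Ks + 1) * E) \<le> \<eta>'"
      using 1(1) 2(1) R' E \<eta>' unfolding \<delta>_def
      by (simp_all add: pos_le_divide_eq[symmetric])
  qed
  have "norm (moves \<tau> (b # bs) t y - y - (\<Sum>b\<leftarrow>b # bs. (t \<bullet> b) *\<^sub>R ?X b y)) \<le> \<eta> * norm t"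
    if t: "norm t \<le> \<delta>" and y: "norm y \<le> R" for t y
  proof -
    let ?y = "move (\<tau> b) (t \<bullet> b) y"
    have tb: "\<bar>t \<bullet> b\<bar> \<le> norm t" using Basis_le_norm[of b t] Cons.prems(1) by simp
    have a: "norm (?y - y - (t \<bullet> b) *\<^sub>R ?X b y) \<le> \<eta>' * norm t"
    proof -
      have "norm (?y - y - (t \<bullet> b) *\<^sub>R ?X b y) \<le> \<eta>' * \<bar>t \<bullet> b\<bar>"
        using 2(2)[of "t \<bullet> b" y] tb t \<delta> y by simp
      also have "\<dots> \<le> \<eta>' * norm t" using tb \<eta>' by (intro mult_left_mono) auto
      finally show ?thesis .
    qed
    have "norm ((t \<bullet> b) *\<^sub>R ?X b y) \<le> norm t * B"
      unfolding norm_scaleR using tb B(2)[of y] y by (intro mult_mono) auto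
    then have yy: "norm (?y - y) \<le> norm t * E"
      using a norm_triangle_ineq[of "?y - y - (t \<bullet> b) *\<^sub>R ?X b y" "(t \<bullet> b) *\<^sub>R ?X b y"]
      by (simp add: E_def algebra_simps)
    also have tE: "norm t * E \<le> \<delta> * E" using t E by (intro mult_right_mono) auto
    finally have "norm (?y - y) \<le> R' - R" using \<delta> by simp
    then have y': "norm ?y \<le> R'" using y norm_triangle_ineq[of "?y - y" y] by simp
    have b: "norm (moves \<tau> bs t ?y - ?y - ?L t ?y) \<le> \<eta>' * norm t"
      using 1(2)[of t ?y] t \<delta> y' by (simp add: \<eta>'_def)
    have "norm (?L t ?y - ?L t y) \<le> norm t * Ks * norm (?y - y)"
      using y' y R' by (intro Lip) auto
    also have "\<dots> \<le> norm t * Ks * (\<delta> * E)"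
      using yy tE Ks by (intro mult_left_mono) auto
    also have "\<dots> = norm t * (\<delta> * (Ks * E))" by simp
    also have "\<dots> \<le> norm t * \<eta>'"
    proof (rule mult_left_mono)
      have "\<delta> * (Ks * E) \<le> \<delta> * ((Ks + 1) * E)"
        using \<delta>(1) E by (intro mult_left_mono mult_right_mono) auto
      then show "\<delta> * (Ks * E) \<le> \<eta>'" using \<delta>(5) by simp
    qed simp
    finally have c: "norm (?L t ?y - ?L t y) \<le> \<eta>' * norm t" by (simp add: mult.commute)
    have "moves \<tau> (b # bs) t y - y - (\<Sum>b\<leftarrow>b # bs. (t \<bullet> b) *\<^sub>R ?X b y)
      = (moves \<tau> bs t ?y - ?y - ?L t ?y) + (?L t ?y - ?L t y) + (?y - y - (t \<bullet> b) *\<^sub>R ?X b y)"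
      by simp
    also have "norm \<dots> \<le> \<eta>' * norm t + \<eta>' * norm t + \<eta>' * norm t"
      using a b c by (intro norm_triangle_le add_mono) auto
    also have "\<dots> = \<eta> * norm t" by (simp add: \<eta>'_def)
    finally show ?thesis .
  qed
  then show ?case using \<delta>(1) by blast
qed

text \<open>The durations are roots of the parameters, so the variation is of Hoelder type in
  \<open>t\<close>. The functions in \<open>W\<close> enter only through the common constant
  \<open>C\<close>, which yields one \<open>\<delta>\<close> for the whole family.\<close>

lemma moves_variation:
  fixes W :: "('a \<Rightarrow> real) set" and C :: real
  assumes v: "\<And>v l s y. v \<in> W \<Longrightarrow> s \<in> {0..h} \<Longrightarrow> (\<And>\<sigma>. \<sigma> \<in> {0..s} \<Longrightarrow> norm (\<phi> l \<sigma> y) \<le> R1) \<Longrightarrow>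
      \<bar>v (\<phi> l s y) - v y\<bar> \<le> C * s"
    and C: "C \<ge> 0"
  shows "set bs \<subseteq> Basis \<Longrightarrow> R < R1 \<Longrightarrow> \<epsilon> > 0 \<Longrightarrow>
    \<exists>\<delta>>0. \<forall>v t y. v \<in> W \<longrightarrow> norm t \<le> \<delta> \<longrightarrow> norm y \<le> R \<longrightarrow> \<bar>v (moves \<tau> bs t y) - v y\<bar> \<le> \<epsilon>"
proof (induction bs arbitrary: R \<epsilon>)
  case Nil
  then show ?case by (intro exI[of _ 1]) auto
next
  case (Cons b bs)
  define R' where "R' = (R + R1) / 2"
  have R': "R < R'" "R' < R1" using Cons.prems by (auto simp: R'_def)
  obtain \<delta>1 where 1: "\<delta>1 > 0" "\<And>v t y. v \<in> W \<Longrightarrow> norm t \<le> \<delta>1 \<Longrightarrow> norm y \<le> R' \<Longrightarrow>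
     \<bar>v (moves \<tau> bs t y) - v y\<bar> \<le> \<epsilon> / 2"
    using Cons.IH[of R' "\<epsilon> / 2"] Cons.prems R' by auto
  let ?w = "word (\<tau> b)" let ?k = "tree_order (\<tau> b)"
  define N where "N = real (length ?w)"
  \<comment> \<open>For durations up to \<open>e\<close> the word moves points by at most
    \<open>R' - R\<close> and changes \<open>v\<close> by at most
    \<open>\<epsilon> / 2\<close>.\<close>
  define e where "e = min h (min ((R' - R) / (N * M + 1)) (\<epsilon> / 2 / (N * C + 1)))"
  have NM: "N * M \<ge> 0" "N * C \<ge> 0" using M_nonneg C by (auto simp: N_def)
  have e: "e > 0" "e \<le> h" "e * (N * M + 1) \<le> R' - R" "e * (N * C + 1) \<le> \<epsilon> / 2"
  proof -
    have pos: "N * M + 1 > 0" "N * C + 1 > 0" using NM by linarith+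
    show "e > 0" using pos h_pos R' Cons.prems(3) by (simp add: e_def)
    show "e \<le> h" by (simp add: e_def)
    show "e * (N * M + 1) \<le> R' - R" by (simp only: pos_le_divide_eq[OF pos(1), symmetric]) (simp add: e_def)
    show "e * (N * C + 1) \<le> \<epsilon> / 2" by (simp only: pos_le_divide_eq[OF pos(2), symmetric]) (simp add: e_def)
  qed
  have "\<bar>v (moves \<tau> (b # bs) t y) - v y\<bar> \<le> \<epsilon>"
    if vW: "v \<in> W" and t: "norm t \<le> min \<delta>1 (e ^ ?k)" and y: "norm y \<le> R" for v t y
  proof -
    let ?s = "root ?k \<bar>t \<bullet> b\<bar>"
    have "\<bar>t \<bullet> b\<bar> \<le> e ^ ?k" using Basis_le_norm[of b t] Cons.prems(1) t by simp
    then have s: "0 \<le> ?s" "?s \<le> e"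
      using root_le_iff_power[OF tree_order_pos, of e "t \<bullet> b"] e by auto
    then have sh: "?s \<in> {0..h}" using e by simp
    obtain w where w: "move (\<tau> b) (t \<bullet> b) y = run w ?s y" "length w = length ?w"
      using move_cases[of "t \<bullet> b" "\<tau> b" y] length_inv_word by (metis linear)
    have "N * M * ?s \<le> N * M * e" "N * C * ?s \<le> N * C * e"
      using s NM by (auto intro!: mult_left_mono)
    then have b: "N * M * ?s \<le> R' - R" "N * C * ?s \<le> \<epsilon> / 2"
      using e by (auto simp: algebra_simps)
    have "norm (run w ?s y - y) \<le> N * M * ?s"
      using run_near[OF sh, of w y] w by (simp add: N_def)
    then have "norm (run w ?s y) \<le> R'"
      using b y norm_triangle_ineq[of "run w ?s y - y" y] by simp
    then have "\<bar>v (moves \<tau> bs t (run w ?s y)) - v (run w ?s y)\<bar> \<le> \<epsilon> / 2"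
      using 1(2)[OF vW] t by simp
    moreover have "\<bar>v (run w ?s y) - v y\<bar> \<le> length w * C * ?s"
      using b y R' w by (intro run_variation[OF v[OF vW] sh, where R=R1]) (auto simp: N_def)
    moreover have "length w * C * ?s \<le> \<epsilon> / 2" using b w by (simp add: N_def)
    ultimately have "\<bar>v (moves \<tau> bs t (run w ?s y)) - v y\<bar> \<le> \<epsilon>" by linarith
    then show ?thesis using w by simp
  qed
  then show ?case using 1(1) e(1) by (intro exI[of _ "min \<delta>1 (e ^ ?k)"]) auto
qed

end

subsection \<open>Chow's theorem\<close>

text \<open>With \<open>B\<close> the inverse of \<open>A\<close>, solutions of
  \<open>\<Phi> t = y\<close> are the fixed points of a simplified Newton step. Multiplied by
  \<open>\<beta>\<close>, the linearization error and the distance from \<open>y\<close> to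
  \<open>x0\<close> account for half the radius each, so the step maps the ball into itself.
  Continuity of \<open>\<Phi>\<close> is what maps built from roots can offer.\<close>

lemma brouwer_covering:
  fixes \<Phi> :: "'a::euclidean_space \<Rightarrow> 'a"
  assumes r: "r > 0" and cont: "continuous_on (cball 0 r) \<Phi>"
    and B: "linear B" "\<And>v. A (B v) = v" "\<And>v. B (A v) = v" "\<And>v. norm (B v) \<le> \<beta> * norm v" "\<beta> > 0"
    and approx: "\<And>t. norm t \<le> r \<Longrightarrow> norm (\<Phi> t - x0 - A t) \<le> r / (2 * \<beta>)"
    and y: "norm (y - x0) \<le> r / (2 * \<beta>)"
  shows "\<exists>t. norm t \<le> r \<and> \<Phi> t = y"
proof -
  let ?f = "\<lambda>t. t - B (\<Phi> t - y)"
  have "continuous_on (cball 0 r) ?f"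
    by (intro continuous_intros linear_continuous_on_compose[OF _ B(1)] cont)
  moreover have "?f ` cball 0 r \<subseteq> cball 0 r"
  proof (rule image_subsetI)
    fix t :: 'a assume t: "t \<in> cball 0 r"
    have "?f t = B ((y - x0) - (\<Phi> t - x0 - A t))"
      by (simp add: linear_diff[OF B(1)] B(3))
    then have "norm (?f t) \<le> \<beta> * norm ((y - x0) - (\<Phi> t - x0 - A t))"
      using B(4)[of "(y - x0) - (\<Phi> t - x0 - A t)"] by simp
    also have "\<dots> \<le> \<beta> * (r / (2 * \<beta>) + r / (2 * \<beta>))"
      using y approx[of t] t B(5) by (intro mult_left_mono order_trans[OF norm_triangle_ineq4 add_mono]) auto
    also have "\<dots> = r" using B(5) by (simp add: field_simps)
    finally show "?f t \<in> cball 0 r" by simp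
  qed
  ultimately obtain t where t: "t \<in> cball 0 r" "?f t = t"
    using brouwer[of "cball 0 r" ?f] r by (auto simp: image_subset_iff_funcset)
  then have "B (\<Phi> t - y) = 0" by simp
  then have "\<Phi> t - y = 0" using B(2)[of "\<Phi> t - y"] linear_0[OF B(1)] B(3)[of 0] B(2)[of 0] by metis
  then show ?thesis using t by auto
qed

text \<open>Every \<open>y\<close> near \<open>x0\<close> is the end point of \<open>moves\<close>
  with small parameters, and along these all members of \<open>W\<close> vary by at most
  \<open>\<epsilon>\<close>.\<close>

lemma (in local_flows) equicontinuous_at:
  fixes W :: "('a \<Rightarrow> real) set" and C :: real
  assumes span: "span (range (\<lambda>\<tau>. tree_field F \<tau> x0)) = UNIV" and x0: "norm x0 < R1" "R1 < R0"
    and v: "\<And>v l s y. v \<in> W \<Longrightarrow> s \<in> {0..h} \<Longrightarrow> (\<And>\<sigma>. \<sigma> \<in> {0..s} \<Longrightarrow> norm (\<phi> l \<sigma> y) \<le> R1) \<Longrightarrow>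
      \<bar>v (\<phi> l s y) - v y\<bar> \<le> C * s"
    and C: "C \<ge> 0" and \<epsilon>: "\<epsilon> > 0"
  shows "\<exists>\<delta>>0. \<forall>v\<in>W. \<forall>y. norm (y - x0) \<le> \<delta> \<longrightarrow> \<bar>v y - v x0\<bar> \<le> \<epsilon>"
proof -
  let ?V = "range (\<lambda>\<tau>. tree_field F \<tau> x0)"
  obtain G where G: "G \<subseteq> ?V" "independent G" "?V \<subseteq> span G" "card G = dim ?V"
    using basis_exists[of ?V] by blast
  have finG: "finite G" using G(2) by (rule independent_imp_finite)
  have spanG: "span G = UNIV" using span_mono[OF G(3)] span by (metis span_span top.extremum_uniqueI)
  have "card G = DIM('a)" using G(4) dim_span[of ?V] span by simp
  \<comment> \<open>A basis of bracket values is indexed by the standard basis, so that the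
    parameters live in the space of the points, as Brouwer's theorem demands.\<close>
  then obtain e where e: "bij_betw e (Basis :: 'a set) G"
    using finite_same_card_bij[OF finite_Basis finG] by auto
  have "\<exists>\<tau>. b \<in> Basis \<longrightarrow> e b = tree_field F \<tau> x0" for b
    using e G(1) bij_betwE by (cases "b \<in> Basis") blast+
  then obtain \<tau> where \<tau>: "\<And>b. b \<in> Basis \<Longrightarrow> e b = tree_field F (\<tau> b) x0" by metis
  define A where "A t = (\<Sum>b\<in>Basis. (t \<bullet> b) *\<^sub>R e b)" for t :: 'a
  have linA: "linear A"
    unfolding A_def by (intro linearI) (simp_all add: inner_add_left scaleR_add_left sum.distrib scaleR_sum_right)
  have "A b = e b" if "b \<in> Basis" for b
  proof -
    have "A b = (\<Sum>c\<in>Basis. if c = b then e b else 0)"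
      unfolding A_def by (rule sum.cong) (auto simp: inner_Basis that)
    then show ?thesis using that by simp
  qed
  then have "G \<subseteq> range A"
    using bij_betw_imp_surj_on[OF e] by (metis image_subset_iff rangeI)
  then have "span G \<subseteq> range A"
    by (rule span_minimal) (rule linear_subspace_image[OF linA subspace_UNIV])
  then have "surj A" using spanG by auto
  then obtain B where B: "linear B" "\<And>x. B (A x) = x" "\<And>x. A (B x) = x"
    using linear_surjective_isomorphism[OF linA] by blast
  obtain \<beta> where \<beta>: "\<beta> > 0" "\<And>x. norm (B x) \<le> \<beta> * norm x"
    using linear_bounded_pos[OF B(1)] by blast
  obtain bs where bs: "set bs = (Basis :: 'a set)" "distinct bs"
    using finite_distinct_list[OF finite_Basis] by blast
  have sum_bs: "(\<Sum>b\<leftarrow>bs. (t \<bullet> b) *\<^sub>R tree_field F (\<tau> b) x0) = A t" for t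
    using bs \<tau> by (simp add: A_def sum_list_distinct_conv_sum_set)
  \<comment> \<open>The relative precision \<open>1 / (2 * \<beta>)\<close> becomes the error
    \<open>r / (2 * \<beta>)\<close> of \<open>brouwer_covering\<close> on the ball of radius
    \<open>r\<close>.\<close>
  obtain \<delta>1 where \<delta>1: "\<delta>1 > 0" "\<And>t y. norm t \<le> \<delta>1 \<Longrightarrow> norm y \<le> norm x0 \<Longrightarrow>
     norm (moves \<tau> bs t y - y - (\<Sum>b\<leftarrow>bs. (t \<bullet> b) *\<^sub>R tree_field F (\<tau> b) y)) \<le> 1 / (2 * \<beta>) * norm t"
    using moves_linear_approx[of bs "norm x0" "1 / (2 * \<beta>)" \<tau>] bs x0 \<beta>(1) by auto
  obtain \<delta>2 where \<delta>2: "\<delta>2 > 0" "\<And>v t y. v \<in> W \<Longrightarrow> norm t \<le> \<delta>2 \<Longrightarrow> norm y \<le> norm x0 \<Longrightarrow>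
     \<bar>v (moves \<tau> bs t y) - v y\<bar> \<le> \<epsilon>"
    using moves_variation[of W R1 C bs "norm x0" \<epsilon> \<tau>] v C bs x0 \<epsilon> by auto
  define r where "r = min (min \<delta>1 \<delta>2) (Min ((\<lambda>b. h ^ tree_order (\<tau> b)) ` Basis))"
  have r: "r > 0" "r \<le> \<delta>1" "r \<le> \<delta>2" "\<And>b. b \<in> Basis \<Longrightarrow> r \<le> h ^ tree_order (\<tau> b)"
    using \<delta>1(1) \<delta>2(1) h_pos by (auto simp: r_def min_le_iff_disj)
  have "\<bar>v y - v x0\<bar> \<le> \<epsilon>" if "v \<in> W" and y: "norm (y - x0) \<le> r / (2 * \<beta>)" for v y
  proof -
    have "\<exists>t. norm t \<le> r \<and> moves \<tau> bs t x0 = y"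
    proof (rule brouwer_covering[OF r(1) _ B(1) B(3) B(2) \<beta>(2,1) _ y])
      show "continuous_on (cball 0 r) (\<lambda>t. moves \<tau> bs t x0)"
        using bs r by (intro continuous_on_moves) auto
      show "norm (moves \<tau> bs t x0 - x0 - A t) \<le> r / (2 * \<beta>)" if "norm t \<le> r" for t
      proof -
        have "norm (moves \<tau> bs t x0 - x0 - A t) \<le> 1 / (2 * \<beta>) * norm t"
          using \<delta>1(2)[of t x0] that r sum_bs[of t] by simp
        also have "\<dots> \<le> 1 / (2 * \<beta>) * r" using that \<beta> by (intro mult_left_mono) auto
        finally show ?thesis by simp
      qed
    qed
    then obtain t where "norm t \<le> r" "moves \<tau> bs t x0 = y" by blast
    then show ?thesis using \<delta>2(2)[OF \<open>v \<in> W\<close>, of t x0] r by simp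
  qed
  then show ?thesis using r(1) \<beta>(1) by (intro exI[of _ "r / (2 * \<beta>)"]) auto
qed

section \<open>From the generated Lie algebra to iterated brackets of the fields\<close>

inductive_set tree_span :: "('l \<Rightarrow> 'a::euclidean_space \<Rightarrow> 'a) \<Rightarrow> ('a \<Rightarrow> 'a) set" for F where
  base: "tree_field F \<tau> \<in> tree_span F"
| add: "X \<in> tree_span F \<Longrightarrow> Y \<in> tree_span F \<Longrightarrow> (\<lambda>x. X x + Y x) \<in> tree_span F"
| scale: "X \<in> tree_span F \<Longrightarrow> (\<lambda>x. c *\<^sub>R X x) \<in> tree_span F"

context
  fixes F :: "'l \<Rightarrow> 'a::euclidean_space \<Rightarrow> 'a"
  assumes smooth_F: "\<And>l. smooth (F l)"
begin

lemma smooth_tree_span: "X \<in> tree_span F \<Longrightarrow> smooth X"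
  by (induction rule: tree_span.induct) (auto intro: smooth_tree_field smooth_F smooth_add smooth_scaleR)

text \<open>Iterated brackets are closed under bracketing by construction. Linearity extends this in
  the right argument; antisymmetry exchanges the arguments, and the same extension is applied
  again.\<close>

lemma tree_span_lie_bracket:
  assumes "X \<in> tree_span F" "Y \<in> tree_span F"
  shows "lie_bracket X Y \<in> tree_span F"
proof -
  have fd_add: "frechet_derivative (\<lambda>x. X x + Y x) (at x) = (\<lambda>v. frechet_derivative X (at x) v + frechet_derivative Y (at x) v)"
    if "smooth X" "smooth Y" for X Y :: "'a \<Rightarrow> 'a" and x
    by (rule frechet_derivative_at[symmetric]) (intro has_derivative_add smooth_has_derivative that)
  have fd_scale: "frechet_derivative (\<lambda>x. c *\<^sub>R X x) (at x) = (\<lambda>v. c *\<^sub>R frechet_derivative X (at x) v)"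
    if "smooth X" for X :: "'a \<Rightarrow> 'a" and x c
    by (rule frechet_derivative_at[symmetric]) (intro has_derivative_scaleR_right smooth_has_derivative that)
  have lin: "linear (frechet_derivative X (at x))" if "smooth X" for X :: "'a \<Rightarrow> 'a" and x
    using has_derivative_linear[OF smooth_has_derivative[OF that]] .
  have anti: "lie_bracket Y X = (\<lambda>x. (-1) *\<^sub>R lie_bracket X Y x)" for X Y :: "'a \<Rightarrow> 'a"
    by (simp add: lie_bracket_def)
  have add_right: "lie_bracket X (\<lambda>x. Y x + Z x) = (\<lambda>x. lie_bracket X Y x + lie_bracket X Z x)"
    if "smooth X" "smooth Y" "smooth Z" for X Y Z :: "'a \<Rightarrow> 'a"
    by (simp add: lie_bracket_def fd_add[OF that(2,3)] linear_add[OF lin[OF that(1)]] fun_eq_iff)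
  have scale_right: "lie_bracket X (\<lambda>x. c *\<^sub>R Y x) = (\<lambda>x. c *\<^sub>R lie_bracket X Y x)"
    if "smooth X" "smooth Y" for X Y :: "'a \<Rightarrow> 'a" and c
    by (simp add: lie_bracket_def fd_scale[OF that(2)] linear_scale[OF lin[OF that(1)]] scaleR_diff_right fun_eq_iff)
  have right: "lie_bracket X Y \<in> tree_span F"
    if "Y \<in> tree_span F" "smooth X" "\<And>\<sigma>. lie_bracket X (tree_field F \<sigma>) \<in> tree_span F" for X Y
    using that(1)
  proof (induction rule: tree_span.induct)
    case (add Y Z)
    then show ?case
      using that(2) by (simp add: add_right smooth_tree_span tree_span.add)
  next
    case (scale Y c)
    then show ?case
      using that(2) by (simp add: scale_right smooth_tree_span tree_span.scale)
  qed (use that(3) in simp)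
  have "lie_bracket (tree_field F \<sigma>) X \<in> tree_span F" for \<sigma>
    by (rule right[OF assms(1) smooth_tree_field[OF smooth_F]])
       (metis tree_field.simps(2) tree_span.base)
  then have "lie_bracket X (tree_field F \<sigma>) \<in> tree_span F" for \<sigma>
    unfolding anti[of X] by (rule tree_span.scale)
  then show ?thesis
    by (rule right[OF assms(2) smooth_tree_span[OF assms(1)]])
qed

end

lemma generated_lie_algebra_tree_span:
  assumes "\<And>l. smooth (F l)" "X \<in> generated_lie_algebra F"
  shows "X \<in> tree_span F"
  using assms(2)
proof (induction rule: generated_lie_algebra.induct)
  case (generator i)
  then show ?case using tree_span.base[of F "Gen i"] by simp
qed (auto intro: tree_span.intros tree_span_lie_bracket assms(1))

lemma tree_span_span: "X \<in> tree_span F \<Longrightarrow> X x \<in> span (range (\<lambda>\<tau>. tree_field F \<tau> x))"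
  by (induction rule: tree_span.induct) (auto intro: span_base span_add span_scale)

lemma tree_field_reindex: "tree_field (\<lambda>i. G (j i)) \<tau> = tree_field G (map_bracket_tree j \<tau>)"
  by (induction \<tau>) auto

text \<open>A quantitative form of the Chow--Rashevskii theorem.\<close>

theorem chow_equicontinuous:
  fixes f :: "'m::finite \<Rightarrow> 'a::euclidean_space \<Rightarrow> 'a" and W :: "('a \<Rightarrow> real) set"
  assumes f: "\<And>i. smooth (f i)" and chow: "chow_condition f"
    and v: "\<And>R. \<exists>C\<ge>0. \<forall>v\<in>W. \<forall>i c \<gamma> s. c \<in> {-1, 1} \<longrightarrow> 0 < s \<longrightarrow> s \<le> 1 \<longrightarrow>
       (\<forall>t\<in>{0..s}. norm (\<gamma> t) \<le> R \<and> (\<gamma> has_vector_derivative c *\<^sub>R f i (\<gamma> t)) (at t within {0..s})) \<longrightarrow>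
       v (\<gamma> 0) \<le> v (\<gamma> s) + C * s"
    and \<epsilon>: "\<epsilon> > 0"
  shows "\<exists>\<delta>>0. \<forall>v\<in>W. \<forall>y. norm (y - x0) \<le> \<delta> \<longrightarrow> \<bar>v y - v x0\<bar> \<le> \<epsilon>"
proof -
  \<comment> \<open>Each field is listed with its opposite; \<open>rv\<close> flips the
    sign.\<close>
  define F where "F l = (if snd l then f (fst l) else (\<lambda>x. - f (fst l) x))" for l :: "'m \<times> bool"
  define rv where "rv l = (fst l, \<not> snd l)" for l :: "'m \<times> bool"
  \<comment> \<open>Curves on which \<open>v\<close> is compared stay in the ball of radius
    \<open>R1\<close>, strictly inside the ball of radius \<open>R0\<close> where the flows obey the
    original fields.\<close>
  define R0 where "R0 = norm x0 + 2"
  define R1 where "R1 = norm x0 + 1"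
  have smF: "smooth (F l)" for l
    using f smooth_minus[OF f] by (simp add: F_def)
  have Frv: "F (rv l) x = - F l x" for l x by (simp add: F_def rv_def)
  have "R0 \<ge> 0" by (simp add: R0_def)
  from local_flows_exist[of F rv R0, OF smooth_Ck[OF smF] Frv this]
  obtain h0 M \<phi> where h0: "h0 > 0" "M \<ge> 0" and "\<forall>l y. \<phi> l 0 y = y"
    and "\<forall>l y y'. \<forall>s\<in>{0..h0}. \<forall>t\<in>{0..h0}. norm (\<phi> l s y - \<phi> l t y') \<le> M * \<bar>s - t\<bar> + 2 * norm (y - y')"
    and "\<forall>l y. \<forall>t\<in>{0..h0}. \<phi> l t y \<in> cball 0 R0 \<longrightarrow>
        ((\<lambda>t. \<phi> l t y) has_vector_derivative F l (\<phi> l t y)) (at t within {0..h0})"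
    and "\<forall>l y. \<forall>t\<in>{0..h0}. \<phi> (rv l) t (\<phi> l t y) = y"
    by blast
  then have \<phi>: "\<And>l y. \<phi> l 0 y = y"
      "\<And>l y y' s t. s \<in> {0..h0} \<Longrightarrow> t \<in> {0..h0} \<Longrightarrow> norm (\<phi> l s y - \<phi> l t y') \<le> M * \<bar>s - t\<bar> + 2 * norm (y - y')"
      "\<And>l y t. t \<in> {0..h0} \<Longrightarrow> \<phi> l t y \<in> cball 0 R0 \<Longrightarrow>
        ((\<lambda>t. \<phi> l t y) has_vector_derivative F l (\<phi> l t y)) (at t within {0..h0})"
      "\<And>l y t. t \<in> {0..h0} \<Longrightarrow> \<phi> (rv l) t (\<phi> l t y) = y"
    by blast+
  \<comment> \<open>The hypothesis on \<open>W\<close> concerns durations up to 1.\<close>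
  define h where "h = min h0 1"
  have sub: "{0..h} \<subseteq> {0..h0}" by (auto simp: h_def)
  interpret local_flows F rv \<phi> h M R0
  proof
    show "((\<lambda>t. \<phi> l t y) has_vector_derivative F l (\<phi> l t y)) (at t within {0..h})"
      if "t \<in> {0..h}" "\<phi> l t y \<in> cball 0 R0" for t l y
      using \<phi>(3)[of t l y] that sub by (auto intro: has_vector_derivative_within_subset)
  qed (use smF h0 \<phi> sub in \<open>auto simp: rv_def h_def\<close>)
  have "span (range (\<lambda>\<tau>. tree_field F \<tau> x0)) = UNIV"
  proof -
    have "(\<lambda>X. X x0) ` generated_lie_algebra f \<subseteq> span (range (\<lambda>\<tau>. tree_field F \<tau> x0))"
    proof safe
      fix X assume "X \<in> generated_lie_algebra f"
      then have "X x0 \<in> span (range (\<lambda>\<tau>. tree_field f \<tau> x0))"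
        by (rule tree_span_span[OF generated_lie_algebra_tree_span[of f, OF f]])
      moreover have "f = (\<lambda>i. F (i, True))" by (simp add: F_def)
      then have "range (\<lambda>\<tau>. tree_field f \<tau> x0) \<subseteq> range (\<lambda>\<tau>. tree_field F \<tau> x0)"
        using tree_field_reindex[of F "\<lambda>i. (i, True)"] by auto
      ultimately show "X x0 \<in> span (range (\<lambda>\<tau>. tree_field F \<tau> x0))"
        using span_mono by blast
    qed
    then have "span ((\<lambda>X. X x0) ` generated_lie_algebra f) \<subseteq> span (range (\<lambda>\<tau>. tree_field F \<tau> x0))"
      by (rule span_minimal) (rule subspace_span)
    then show ?thesis using chow unfolding chow_condition_def by auto
  qed
  moreover obtain C where C: "C \<ge> 0" and Cv': "\<forall>v\<in>W. \<forall>i c \<gamma> s. c \<in> {-1, 1} \<longrightarrow> 0 < s \<longrightarrow> s \<le> 1 \<longrightarrow>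
       (\<forall>t\<in>{0..s}. norm (\<gamma> t) \<le> R1 \<and> (\<gamma> has_vector_derivative c *\<^sub>R f i (\<gamma> t)) (at t within {0..s})) \<longrightarrow>
       v (\<gamma> 0) \<le> v (\<gamma> s) + C * s"
    using v[of R1] by (elim exE conjE) (rule that)
  note Cv = Cv'[rule_format]
  moreover have "\<bar>v (\<phi> l s y) - v y\<bar> \<le> C * s"
    if vW: "v \<in> W" and s: "s \<in> {0..h}" and R: "\<And>\<sigma>. \<sigma> \<in> {0..s} \<Longrightarrow> norm (\<phi> l \<sigma> y) \<le> R1" for v l s y
  proof (cases "s = 0")
    case True
    then show ?thesis by (simp add: flow_0)
  next
    case False
    then have s': "0 < s" "s \<le> 1" using s by (auto simp: h_def)
    define c :: real where "c = (if snd l then 1 else - 1)"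
    have c: "c \<in> {-1, 1}" "- c \<in> {-1, 1}" by (auto simp: c_def)
    have Fc: "F l x = c *\<^sub>R f (fst l) x" for x by (simp add: F_def c_def)
    have der: "((\<lambda>t. \<phi> l t y) has_vector_derivative c *\<^sub>R f (fst l) (\<phi> l t y)) (at t within {0..s})"
      if "t \<in> {0..s}" for t
      using R[OF that] flow_derivative[of t l y] that s
      by (auto simp: R0_def R1_def Fc intro: has_vector_derivative_within_subset)
    have "v (\<phi> l 0 y) \<le> v (\<phi> l s y) + C * s"
      using R der by (intro Cv[OF vW c(1) s', where \<gamma>="\<lambda>t. \<phi> l t y"]) auto
    \<comment> \<open>The reversed curve follows the opposite field and gives the other
      inequality.\<close>
    moreover have "v (\<phi> l (s - 0) y) \<le> v (\<phi> l (s - s) y) + C * s"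
    proof (rule Cv[OF vW c(2) s', where \<gamma>="\<lambda>t. \<phi> l (s - t) y"])
      fix t assume t: "t \<in> {0..s}"
      have 1: "((\<lambda>t. s - t) has_vector_derivative - 1) (at t within {0..s})"
        by (auto intro!: derivative_eq_intros)
      have "(\<lambda>t. s - t) ` {0..s} \<subseteq> {0..s}" by auto
      then have 2: "((\<lambda>t. \<phi> l t y) has_vector_derivative c *\<^sub>R f (fst l) (\<phi> l (s - t) y))
          (at (s - t) within (\<lambda>t. s - t) ` {0..s})"
        using der[of "s - t"] t by (auto intro: has_vector_derivative_within_subset)
      have "((\<lambda>t. \<phi> l (s - t) y) has_vector_derivative (- c) *\<^sub>R f (fst l) (\<phi> l (s - t) y)) (at t within {0..s})"
        using vector_diff_chain_within[OF 1 2] by (simp add: o_def)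
      then show "norm (\<phi> l (s - t) y) \<le> R1 \<and> ((\<lambda>t. \<phi> l (s - t) y) has_vector_derivative (- c) *\<^sub>R f (fst l) (\<phi> l (s - t) y)) (at t within {0..s})"
        using R[of "s - t"] t by simp
    qed
    ultimately show ?thesis by (simp add: flow_0)
  qed
  ultimately show ?thesis
    using C \<epsilon> by (intro equicontinuous_at[of x0 R1 W C]) (auto simp: R0_def R1_def)
qed

subsection \<open>Absolutely continuous curves\<close>

abbreviation "AC \<equiv> abs_continuous_on_interval"

lemma AC_E:
  assumes "AC s0 s1 g" "e > 0"
  obtains d where "d > 0" "\<And>P. finite P \<Longrightarrow> (\<And>a b. (a,b) \<in> P \<Longrightarrow> s0 \<le> a \<and> a \<le> b \<and> b \<le> s1) \<Longrightarrow>
        pairwise (\<lambda>I J. {fst I<..<snd I} \<inter> {fst J<..<snd J} = {}) P \<Longrightarrow>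
        (\<Sum>(a,b)\<in>P. b - a) < d \<Longrightarrow> (\<Sum>(a,b)\<in>P. norm (g b - g a)) < e"
proof -
  obtain d where d: "d > 0" and *: "\<forall>P. finite P \<longrightarrow>
        (\<forall>(a,b)\<in>P. s0 \<le> a \<and> a \<le> b \<and> b \<le> s1) \<longrightarrow>
        pairwise (\<lambda>I J. {fst I<..<snd I} \<inter> {fst J<..<snd J} = {}) P \<longrightarrow>
        (\<Sum>(a,b)\<in>P. b - a) < d \<longrightarrow> (\<Sum>(a,b)\<in>P. norm (g b - g a)) < e"
    using assms unfolding abs_continuous_on_interval_def by blast
  show ?thesis
    by (rule that[OF d]) (use * in \<open>blast\<close>)
qed

lemma AC_I:
  assumes "\<And>e. e > 0 \<Longrightarrow> \<exists>d>0. \<forall>P. finite P \<longrightarrow> (\<forall>a b. (a,b) \<in> P \<longrightarrow> s0 \<le> a \<and> a \<le> b \<and> b \<le> s1) \<longrightarrow>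
        pairwise (\<lambda>I J. {fst I<..<snd I} \<inter> {fst J<..<snd J} = {}) P \<longrightarrow>
        (\<Sum>(a,b)\<in>P. b - a) < d \<longrightarrow> (\<Sum>(a,b)\<in>P. norm (g b - g a)) < e"
  shows "AC s0 s1 g"
  unfolding abs_continuous_on_interval_def
proof (intro allI impI)
  fix e :: real assume "e > 0"
  from assms[OF this] obtain d where "d > 0" and *: "\<forall>P. finite P \<longrightarrow> (\<forall>a b. (a,b) \<in> P \<longrightarrow> s0 \<le> a \<and> a \<le> b \<and> b \<le> s1) \<longrightarrow>
        pairwise (\<lambda>I J. {fst I<..<snd I} \<inter> {fst J<..<snd J} = {}) P \<longrightarrow>
        (\<Sum>(a,b)\<in>P. b - a) < d \<longrightarrow> (\<Sum>(a,b)\<in>P. norm (g b - g a)) < e" by blast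
  then show "\<exists>d>0. \<forall>P. finite P \<longrightarrow>
        (\<forall>(a,b)\<in>P. s0 \<le> a \<and> a \<le> b \<and> b \<le> s1) \<longrightarrow>
        pairwise (\<lambda>I J. {fst I<..<snd I} \<inter> {fst J<..<snd J} = {}) P \<longrightarrow>
        (\<Sum>(a,b)\<in>P. b - a) < d \<longrightarrow> (\<Sum>(a,b)\<in>P. norm (g b - g a)) < e"
    by (intro exI[of _ d]) blast
qed

lemma AC_subset:
  assumes "AC s0 s1 g" "s0 \<le> t0" "t1 \<le> s1"
  shows "AC t0 t1 g"
proof (rule AC_I)
  fix e :: real assume "e > 0"
  from AC_E[OF assms(1) this] obtain d where d: "d > 0" "\<And>P. finite P \<Longrightarrow> (\<And>a b. (a,b) \<in> P \<Longrightarrow> s0 \<le> a \<and> a \<le> b \<and> b \<le> s1) \<Longrightarrow>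
        pairwise (\<lambda>I J. {fst I<..<snd I} \<inter> {fst J<..<snd J} = {}) P \<Longrightarrow>
        (\<Sum>(a,b)\<in>P. b - a) < d \<Longrightarrow> (\<Sum>(a,b)\<in>P. norm (g b - g a)) < e" by blast
  show "\<exists>d>0. \<forall>P. finite P \<longrightarrow> (\<forall>a b. (a,b) \<in> P \<longrightarrow> t0 \<le> a \<and> a \<le> b \<and> b \<le> t1) \<longrightarrow>
        pairwise (\<lambda>I J. {fst I<..<snd I} \<inter> {fst J<..<snd J} = {}) P \<longrightarrow>
        (\<Sum>(a,b)\<in>P. b - a) < d \<longrightarrow> (\<Sum>(a,b)\<in>P. norm (g b - g a)) < e"
    using d assms(2,3) by (intro exI[of _ d] conjI allI impI d(2)) (auto intro: order_trans)
qed

text \<open>This covers composition with a Lipschitz map and, with \<open>K = 1\<close>, the passage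
  to a function that agrees with \<open>g\<close> on the interval.\<close>

lemma AC_dominated:
  assumes "AC s0 s1 g" "K \<ge> 0"
    and "\<And>x y. x \<in> {s0..s1} \<Longrightarrow> y \<in> {s0..s1} \<Longrightarrow> norm (f x - f y) \<le> K * norm (g x - g y)"
  shows "AC s0 s1 f"
proof (rule AC_I)
  fix e :: real assume e: "e > 0"
  then have "e / (K + 1) > 0" using assms(2) by simp
  from AC_E[OF assms(1) this] obtain d where d: "d > 0" "\<And>P. finite P \<Longrightarrow> (\<And>a b. (a,b) \<in> P \<Longrightarrow> s0 \<le> a \<and> a \<le> b \<and> b \<le> s1) \<Longrightarrow>
        pairwise (\<lambda>I J. {fst I<..<snd I} \<inter> {fst J<..<snd J} = {}) P \<Longrightarrow>
        (\<Sum>(a,b)\<in>P. b - a) < d \<Longrightarrow> (\<Sum>(a,b)\<in>P. norm (g b - g a)) < e / (K + 1)" by blast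
  show "\<exists>d>0. \<forall>P. finite P \<longrightarrow> (\<forall>a b. (a,b) \<in> P \<longrightarrow> s0 \<le> a \<and> a \<le> b \<and> b \<le> s1) \<longrightarrow>
        pairwise (\<lambda>I J. {fst I<..<snd I} \<inter> {fst J<..<snd J} = {}) P \<longrightarrow>
        (\<Sum>(a,b)\<in>P. b - a) < d \<longrightarrow> (\<Sum>(a,b)\<in>P. norm (f b - f a)) < e"
  proof (intro exI[of _ d] conjI allI impI d(1))
    fix P assume P: "finite P" "\<forall>a b. (a,b) \<in> P \<longrightarrow> s0 \<le> a \<and> a \<le> b \<and> b \<le> s1"
        "pairwise (\<lambda>I J. {fst I<..<snd I} \<inter> {fst J<..<snd J} = {}) P" "(\<Sum>(a,b)\<in>P. b - a) < d"
    have "(\<Sum>(a,b)\<in>P. norm (f b - f a)) \<le> (\<Sum>(a,b)\<in>P. K * norm (g b - g a))"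
    proof (rule sum_mono)
      fix p assume "p \<in> P"
      moreover obtain a b where "p = (a, b)" by (cases p)
      moreover from calculation P(2) have "s0 \<le> a" "a \<le> b" "b \<le> s1" by blast+
      ultimately show "(case p of (a, b) \<Rightarrow> norm (f b - f a)) \<le> (case p of (a, b) \<Rightarrow> K * norm (g b - g a))"
        using assms(3)[of b a] by simp
    qed
    also have "\<dots> = K * (\<Sum>(a,b)\<in>P. norm (g b - g a))"
      by (simp add: sum_distrib_left case_prod_beta)
    also have "\<dots> \<le> K * (e / (K + 1))"
      using d(2)[of P] P assms(2) by (intro mult_left_mono) auto
    also have "\<dots> < e"
      using e assms(2) by (simp add: field_simps)
    finally show "(\<Sum>(a,b)\<in>P. norm (f b - f a)) < e" .
  qed
qed

lemma AC_ident: "AC s0 s1 (\<lambda>t::real. t)"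
proof (rule AC_I)
  fix e :: real assume e: "e > 0"
  have "(\<Sum>(a,b)\<in>P. norm (b - a)) = (\<Sum>(a,b)\<in>P. b - a)"
    if "\<forall>a b. (a,b) \<in> P \<longrightarrow> s0 \<le> a \<and> a \<le> b \<and> b \<le> s1" for P
    using that by (intro sum.cong) auto
  then show "\<exists>d>0. \<forall>P. finite P \<longrightarrow> (\<forall>a b. (a,b) \<in> P \<longrightarrow> s0 \<le> a \<and> a \<le> b \<and> b \<le> s1) \<longrightarrow>
        pairwise (\<lambda>I J. {fst I<..<snd I} \<inter> {fst J<..<snd J} = {}) P \<longrightarrow>
        (\<Sum>(a,b)\<in>P. b - a) < d \<longrightarrow> (\<Sum>(a,b)\<in>P. norm (b - a)) < e"
    using e by (intro exI[of _ e]) auto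
qed

lemma AC_lipschitz:
  assumes "K \<ge> 0" "\<And>x y. x \<in> {s0..s1} \<Longrightarrow> y \<in> {s0..s1} \<Longrightarrow> norm (f x - f y) \<le> K * \<bar>x - y\<bar>"
  shows "AC s0 s1 f"
  using AC_dominated[OF AC_ident assms(1), of s0 s1 f] assms(2) by simp

lemma AC_close:
  assumes "AC s0 s1 g" "e > 0"
  obtains d where "d > 0" "\<And>a b. s0 \<le> a \<Longrightarrow> a \<le> b \<Longrightarrow> b \<le> s1 \<Longrightarrow> b - a < d \<Longrightarrow> norm (g b - g a) < e"
proof -
  from AC_E[OF assms] obtain d where d: "d > 0" "\<And>P. finite P \<Longrightarrow> (\<And>a b. (a,b) \<in> P \<Longrightarrow> s0 \<le> a \<and> a \<le> b \<and> b \<le> s1) \<Longrightarrow>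
        pairwise (\<lambda>I J. {fst I<..<snd I} \<inter> {fst J<..<snd J} = {}) P \<Longrightarrow>
        (\<Sum>(a,b)\<in>P. b - a) < d \<Longrightarrow> (\<Sum>(a,b)\<in>P. norm (g b - g a)) < e" by blast
  have "norm (g b - g a) < e" if "s0 \<le> a" "a \<le> b" "b \<le> s1" "b - a < d" for a b
    using d(2)[of "{(a, b)}"] that by simp
  then show ?thesis using that d(1) by blast
qed

lemma AC_continuous:
  assumes "AC s0 s1 g"
  shows "continuous_on {s0..s1} g"
proof (rule continuous_onI)
  fix x e :: real assume x: "x \<in> {s0..s1}" and "e > 0"
  from AC_close[OF assms this(2)] obtain d where d: "d > 0"
    "\<And>a b. s0 \<le> a \<Longrightarrow> a \<le> b \<Longrightarrow> b \<le> s1 \<Longrightarrow> b - a < d \<Longrightarrow> norm (g b - g a) < e" by blast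
  have "dist (g y) (g x) \<le> e" if "y \<in> {s0..s1}" "dist y x < d" for y
  proof (cases "x \<le> y")
    case True
    then show ?thesis using d(2)[of x y] x that by (simp add: dist_norm less_imp_le)
  next
    case False
    then show ?thesis using d(2)[of y x] x that by (simp add: dist_norm norm_minus_commute less_imp_le)
  qed
  then show "\<exists>d>0. \<forall>x'\<in>{s0..s1}. dist x' x < d \<longrightarrow> dist (g x') (g x) \<le> e" using d(1) by blast
qed

lemma AC_glue:
  assumes "AC s0 \<tau> g" "AC \<tau> s1 g"
  shows "AC s0 s1 g"
proof (rule AC_I)
  fix e :: real assume "e > 0"
  then have e4: "e / 4 > 0" by simp
  let ?ok = "\<lambda>P. pairwise (\<lambda>I J. {fst I<..<snd I} \<inter> {fst J<..<snd J} = ({}::real set)) P"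
  from AC_E[OF assms(1) e4] obtain d1 where 1: "d1 > 0" "\<And>P. finite P \<Longrightarrow> (\<And>a b. (a,b) \<in> P \<Longrightarrow> s0 \<le> a \<and> a \<le> b \<and> b \<le> \<tau>) \<Longrightarrow>
        ?ok P \<Longrightarrow> (\<Sum>(a,b)\<in>P. b - a) < d1 \<Longrightarrow> (\<Sum>(a,b)\<in>P. norm (g b - g a)) < e / 4" by blast
  from AC_E[OF assms(2) e4] obtain d2 where 2: "d2 > 0" "\<And>P. finite P \<Longrightarrow> (\<And>a b. (a,b) \<in> P \<Longrightarrow> \<tau> \<le> a \<and> a \<le> b \<and> b \<le> s1) \<Longrightarrow>
        ?ok P \<Longrightarrow> (\<Sum>(a,b)\<in>P. b - a) < d2 \<Longrightarrow> (\<Sum>(a,b)\<in>P. norm (g b - g a)) < e / 4" by blast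
  show "\<exists>d>0. \<forall>P. finite P \<longrightarrow> (\<forall>a b. (a,b) \<in> P \<longrightarrow> s0 \<le> a \<and> a \<le> b \<and> b \<le> s1) \<longrightarrow> ?ok P \<longrightarrow>
        (\<Sum>(a,b)\<in>P. b - a) < d \<longrightarrow> (\<Sum>(a,b)\<in>P. norm (g b - g a)) < e"
  proof (intro exI[of _ "min d1 d2"] conjI allI impI)
    fix P assume P: "finite P" "\<forall>a b. (a,b) \<in> P \<longrightarrow> s0 \<le> a \<and> a \<le> b \<and> b \<le> s1" "?ok P"
      and len: "(\<Sum>(a,b)\<in>P. b - a) < min d1 d2"
    \<comment> \<open>At most one interval straddles \<open>\<tau>\<close>; it is cut there and
      takes two of the four quarters of \<open>e\<close>. A degenerate interval at
      \<open>\<tau>\<close> would lie on both sides, hence the subtraction of \<open>A\<close> in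
      \<open>B\<close>.\<close>
    define A where "A = {p \<in> P. snd p \<le> \<tau>}"
    define B where "B = {p \<in> P. \<tau> \<le> fst p} - A"
    define S where "S = {p \<in> P. fst p < \<tau> \<and> \<tau> < snd p}"
    have part: "P = A \<union> B \<union> S" "A \<inter> B = {}" "(A \<union> B) \<inter> S = {}"
      unfolding A_def B_def S_def by auto
    have AB: "A \<subseteq> P" "B \<subseteq> P" by (auto simp: A_def B_def)
    have fin: "finite A" "finite B" "finite S" using P(1) by (auto simp: A_def B_def S_def)
    have len_le: "(\<Sum>(a,b)\<in>Q. b - a) \<le> (\<Sum>(a,b)\<in>P. b - a)" if "Q \<subseteq> P" for Q
      using P(1,2) that by (intro sum_mono2) auto
    have ok: "?ok Q" if "Q \<subseteq> P" for Q by (rule pairwise_subset[OF P(3) that])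
    have sA: "(\<Sum>(a,b)\<in>A. norm (g b - g a)) < e / 4"
    proof (rule 1(2)[OF fin(1) _ ok])
      show "(\<Sum>(a,b)\<in>A. b - a) < d1" using len_le[OF AB(1)] len by simp
    qed (use P(2) AB in \<open>auto simp: A_def\<close>)
    have sB: "(\<Sum>(a,b)\<in>B. norm (g b - g a)) < e / 4"
    proof (rule 2(2)[OF fin(2) _ ok])
      show "(\<Sum>(a,b)\<in>B. b - a) < d2" using len_le[OF AB(2)] len by simp
    qed (use P(2) AB in \<open>auto simp: B_def\<close>)
    have "(\<Sum>(a,b)\<in>S. norm (g b - g a)) \<le> e / 2"
    proof (cases "S = {}")
      case False
      then obtain a b where ab: "(a, b) \<in> S" by auto
      have "q = (a, b)" if "q \<in> S" for q
      proof (rule ccontr)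
        assume "q \<noteq> (a, b)"
        then have "{fst q<..<snd q} \<inter> {a<..<b} = {}"
          using pairwiseD[OF P(3), of q "(a, b)"] that ab by (auto simp: S_def)
        moreover have "\<tau> \<in> {fst q<..<snd q} \<inter> {a<..<b}" using that ab by (auto simp: S_def)
        ultimately show False by blast
      qed
      then have S: "S = {(a, b)}" using ab by blast
      have abP: "(a, b) \<in> P" and ab': "a < \<tau>" "\<tau> < b" using ab by (auto simp: S_def)
      from abP P(2) have ab'': "s0 \<le> a" "b \<le> s1" by blast+
      have ab3: "b - a < min d1 d2" using len_le[of "{(a, b)}"] abP len by simp
      have "norm (g \<tau> - g a) < e / 4" using 1(2)[of "{(a, \<tau>)}"] ab' ab'' ab3 by simp
      moreover have "norm (g b - g \<tau>) < e / 4" using 2(2)[of "{(\<tau>, b)}"] ab' ab'' ab3 by simp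
      ultimately show ?thesis
        using norm_triangle_ineq[of "g b - g \<tau>" "g \<tau> - g a"] by (simp add: S)
    qed (use \<open>e > 0\<close> in simp)
    moreover have "(\<Sum>(a,b)\<in>P. norm (g b - g a)) = (\<Sum>(a,b)\<in>A. norm (g b - g a)) + (\<Sum>(a,b)\<in>B. norm (g b - g a)) + (\<Sum>(a,b)\<in>S. norm (g b - g a))"
      using part fin by (metis finite_Un sum.union_disjoint)
    ultimately show "(\<Sum>(a,b)\<in>P. norm (g b - g a)) < e" using sA sB by simp
  qed (use 1(1) 2(1) in simp)
qed

text \<open>\<open>T x y\<close> stands for the image of an interval with its end points in
  increasing order; increasing and decreasing changes of time are thus handled together.\<close>

lemma AC_reparam:
  assumes g: "AC s0 s1 g" and K: "K > 0"
    and T: "\<And>x y. t0 \<le> x \<Longrightarrow> x \<le> y \<Longrightarrow> y \<le> t1 \<Longrightarrow> s0 \<le> fst (T x y) \<and> fst (T x y) \<le> snd (T x y) \<and> snd (T x y) \<le> s1 \<and>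
       snd (T x y) - fst (T x y) = K * (y - x) \<and> norm (g (snd (T x y)) - g (fst (T x y))) = norm (f y - f x)"
    and inj: "\<And>x y x' y'. T x y = T x' y' \<Longrightarrow> x = x' \<and> y = y'"
    and disj: "\<And>x y x' y'. {x<..<y} \<inter> {x'<..<y'} = {} \<Longrightarrow>
       {fst (T x y)<..<snd (T x y)} \<inter> {fst (T x' y')<..<snd (T x' y')} = {}"
  shows "AC t0 t1 f"
proof (rule AC_I)
  fix e :: real assume "e > 0"
  from AC_E[OF g this] obtain d where d: "d > 0" "\<And>P. finite P \<Longrightarrow> (\<And>a b. (a,b) \<in> P \<Longrightarrow> s0 \<le> a \<and> a \<le> b \<and> b \<le> s1) \<Longrightarrow>
        pairwise (\<lambda>I J. {fst I<..<snd I} \<inter> {fst J<..<snd J} = {}) P \<Longrightarrow>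
        (\<Sum>(a,b)\<in>P. b - a) < d \<Longrightarrow> (\<Sum>(a,b)\<in>P. norm (g b - g a)) < e" by blast
  show "\<exists>d>0. \<forall>P. finite P \<longrightarrow> (\<forall>a b. (a,b) \<in> P \<longrightarrow> t0 \<le> a \<and> a \<le> b \<and> b \<le> t1) \<longrightarrow>
        pairwise (\<lambda>I J. {fst I<..<snd I} \<inter> {fst J<..<snd J} = {}) P \<longrightarrow>
        (\<Sum>(a,b)\<in>P. b - a) < d \<longrightarrow> (\<Sum>(a,b)\<in>P. norm (f b - f a)) < e"
  proof (intro exI[of _ "d / K"] conjI allI impI)
    fix P assume P: "finite P" "\<forall>a b. (a,b) \<in> P \<longrightarrow> t0 \<le> a \<and> a \<le> b \<and> b \<le> t1"
        "pairwise (\<lambda>I J. {fst I<..<snd I} \<inter> {fst J<..<snd J} = {}) P" "(\<Sum>(a,b)\<in>P. b - a) < d / K"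
    define U where "U p = T (fst p) (snd p)" for p
    have injU: "inj_on U P" using inj by (auto simp: inj_on_def U_def)
    have "(\<Sum>(a,b)\<in>U ` P. b - a) = (\<Sum>(a,b)\<in>P. K * (b - a))"
      using P(2) T by (subst sum.reindex[OF injU]) (auto simp: U_def case_prod_beta intro!: sum.cong)
    also have "\<dots> = K * (\<Sum>(a,b)\<in>P. b - a)" by (simp add: sum_distrib_left case_prod_beta)
    also have "\<dots> < d" using P(4) K by (simp add: pos_less_divide_eq mult.commute)
    finally have "(\<Sum>(a,b)\<in>U ` P. norm (g b - g a)) < e"
    proof (intro d(2))
      show "pairwise (\<lambda>I J. {fst I<..<snd I} \<inter> {fst J<..<snd J} = {}) (U ` P)"
        using P(3) disj unfolding pairwise_image by (auto simp: pairwise_def U_def)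
      show "s0 \<le> a \<and> a \<le> b \<and> b \<le> s1" if "(a, b) \<in> U ` P" for a b
        using that T P(2) by (auto simp: U_def) (metis fst_conv snd_conv)+
    qed (use P(1) in auto)
    moreover have "(\<Sum>(a,b)\<in>U ` P. norm (g b - g a)) = (\<Sum>(a,b)\<in>P. norm (f b - f a))"
      using P(2) T by (subst sum.reindex[OF injU]) (auto simp: U_def case_prod_beta intro!: sum.cong)
    ultimately show "(\<Sum>(a,b)\<in>P. norm (f b - f a)) < e" by simp
  qed (use d(1) K in simp)
qed

lemma AC_affine:
  assumes g: "AC s0 s1 g" and m: "m \<noteq> 0" and sub: "\<And>t. t \<in> {t0..t1} \<Longrightarrow> m * t + q \<in> {s0..s1}"
  shows "AC t0 t1 (\<lambda>t. g (m * t + q))"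
proof (cases "m > 0")
  case True
  show ?thesis
  proof (rule AC_reparam[OF g True, where T="\<lambda>x y. (m * x + q, m * y + q)"])
    fix x y assume "t0 \<le> x" "x \<le> y" "y \<le> t1"
    then show "s0 \<le> fst (m * x + q, m * y + q) \<and> fst (m * x + q, m * y + q) \<le> snd (m * x + q, m * y + q) \<and>
       snd (m * x + q, m * y + q) \<le> s1 \<and> snd (m * x + q, m * y + q) - fst (m * x + q, m * y + q) = m * (y - x) \<and>
       norm (g (snd (m * x + q, m * y + q)) - g (fst (m * x + q, m * y + q))) = norm (g (m * y + q) - g (m * x + q))"
      using True sub[of x] sub[of y] by (simp add: algebra_simps)
  next
    fix x y x' y' :: real assume *: "{x<..<y} \<inter> {x'<..<y'} = {}"
    show "{fst (m * x + q, m * y + q)<..<snd (m * x + q, m * y + q)} \<inter>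
       {fst (m * x' + q, m * y' + q)<..<snd (m * x' + q, m * y' + q)} = {}"
    proof (rule ccontr)
      assume "\<not> ?thesis"
      then obtain z where "z \<in> {m * x + q<..<m * y + q} \<inter> {m * x' + q<..<m * y' + q}"
        unfolding fst_conv snd_conv by blast
      then have "m * x + q < z" "z < m * y + q" "m * x' + q < z" "z < m * y' + q" by simp_all
      then have "(z - q) / m \<in> {x<..<y} \<inter> {x'<..<y'}" using True by (auto simp: field_simps)
      then show False using * by blast
    qed
  qed (use m in auto)
next
  case False
  then have m0: "- m > 0" using m by simp
  show ?thesis
  proof (rule AC_reparam[OF g m0, where T="\<lambda>x y. (m * y + q, m * x + q)"])
    fix x y assume "t0 \<le> x" "x \<le> y" "y \<le> t1"
    then show "s0 \<le> fst (m * y + q, m * x + q) \<and> fst (m * y + q, m * x + q) \<le> snd (m * y + q, m * x + q) \<and>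
       snd (m * y + q, m * x + q) \<le> s1 \<and> snd (m * y + q, m * x + q) - fst (m * y + q, m * x + q) = - m * (y - x) \<and>
       norm (g (snd (m * y + q, m * x + q)) - g (fst (m * y + q, m * x + q))) = norm (g (m * y + q) - g (m * x + q))"
      using m0 sub[of x] sub[of y] by (simp add: algebra_simps norm_minus_commute mult_left_mono_neg)
  next
    fix x y x' y' :: real assume *: "{x<..<y} \<inter> {x'<..<y'} = {}"
    show "{fst (m * y + q, m * x + q)<..<snd (m * y + q, m * x + q)} \<inter>
       {fst (m * y' + q, m * x' + q)<..<snd (m * y' + q, m * x' + q)} = {}"
    proof (rule ccontr)
      assume "\<not> ?thesis"
      then obtain z where "z \<in> {m * y + q<..<m * x + q} \<inter> {m * y' + q<..<m * x' + q}"
        unfolding fst_conv snd_conv by blast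
      then have "m * y + q < z" "z < m * x + q" "m * y' + q < z" "z < m * x' + q" by simp_all
      then have "(z - q) / m \<in> {x<..<y} \<inter> {x'<..<y'}" using m0 by (auto simp: field_simps)
      then show False using * by blast
    qed
  qed (use m in auto)
qed

text \<open>The null set of bad tags is controlled by a gauge for its indicator function, whose
  Henstock--Kurzweil integral vanishes.\<close>

lemma AC_fundamental_theorem:
  fixes g :: "real \<Rightarrow> 'a::euclidean_space"
  assumes ac: "AC a b g" and ab: "a \<le> b" and N: "negligible N"
    and der: "\<And>t. t \<in> {a..b} - N \<Longrightarrow> (g has_vector_derivative g' t) (at t within {a..b})"
  shows "(g' has_integral (g b - g a)) {a..b}"
proof -
  define f where "f t = (if t \<in> N then 0 else g' t)" for t
  have "(f has_integral (g b - g a)) {a..b}"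
    unfolding has_integral_real
  proof (intro allI impI)
    fix \<epsilon>' :: real assume \<epsilon>': "\<epsilon>' > 0"
    define c where "c = b - a + 1"
    have c: "c > 0" using ab by (simp add: c_def)
    define \<epsilon> where "\<epsilon> = \<epsilon>' / c / 2"
    have \<epsilon>: "\<epsilon> > 0" "\<epsilon> * (b - a) + \<epsilon> < \<epsilon>'"
    proof -
      show "\<epsilon> > 0" using \<epsilon>' c by (simp add: \<epsilon>_def)
      have "\<epsilon> * (b - a) + \<epsilon> = \<epsilon> * c" by (simp add: c_def algebra_simps)
      also have "\<dots> = \<epsilon>' / 2" using c by (simp add: \<epsilon>_def)
      finally show "\<epsilon> * (b - a) + \<epsilon> < \<epsilon>'" using \<epsilon>' by simp
    qed
    from AC_E[OF ac \<epsilon>(1)] obtain d where d: "d > 0" "\<And>P. finite P \<Longrightarrow> (\<And>x y. (x,y) \<in> P \<Longrightarrow> a \<le> x \<and> x \<le> y \<and> y \<le> b) \<Longrightarrow>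
        pairwise (\<lambda>I J. {fst I<..<snd I} \<inter> {fst J<..<snd J} = {}) P \<Longrightarrow>
        (\<Sum>(x,y)\<in>P. y - x) < d \<Longrightarrow> (\<Sum>(x,y)\<in>P. norm (g y - g x)) < \<epsilon>"
      by blast
    have "((indicator N :: real \<Rightarrow> real) has_integral 0) {a..b}"
      using N unfolding negligible_def by (metis box_real(2))
    from has_integral_real[THEN iffD1, OF this, rule_format, OF d(1)]
    obtain \<gamma>1 where \<gamma>1: "gauge \<gamma>1" and "\<forall>D. D tagged_division_of {a..b} \<and> \<gamma>1 fine D \<longrightarrow>
       norm ((\<Sum>(x,k)\<in>D. measure lborel k *\<^sub>R (indicator N x :: real)) - 0) < d"
      by blast
    then have \<gamma>1': "norm ((\<Sum>(x,k)\<in>D. measure lborel k *\<^sub>R (indicator N x :: real)) - 0) < d"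
      if "D tagged_division_of {a..b}" "\<gamma>1 fine D" for D
      using that by blast
    have "\<forall>x. \<exists>r>0. x \<in> {a..b} - N \<longrightarrow> (\<forall>y\<in>{a..b}. \<bar>y - x\<bar> < r \<longrightarrow> norm (g y - g x - (y - x) *\<^sub>R g' x) \<le> \<epsilon> * \<bar>y - x\<bar>)"
    proof
      fix x show "\<exists>r>0. x \<in> {a..b} - N \<longrightarrow> (\<forall>y\<in>{a..b}. \<bar>y - x\<bar> < r \<longrightarrow> norm (g y - g x - (y - x) *\<^sub>R g' x) \<le> \<epsilon> * \<bar>y - x\<bar>)"
      proof (cases "x \<in> {a..b} - N")
        case True
        from der[OF this] show ?thesis
          unfolding has_vector_derivative_def has_derivative_within_alt using \<epsilon>(1) by fastforce
      qed (auto intro!: exI[of _ 1])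
    qed
    then obtain r where r: "\<And>x. r x > 0" "\<And>x y. x \<in> {a..b} - N \<Longrightarrow> y \<in> {a..b} \<Longrightarrow> \<bar>y - x\<bar> < r x \<Longrightarrow>
       norm (g y - g x - (y - x) *\<^sub>R g' x) \<le> \<epsilon> * \<bar>y - x\<bar>"
      by metis
    define \<gamma> where "\<gamma> x = \<gamma>1 x \<inter> ball x (r x)" for x
    have gauge: "gauge \<gamma>" using \<gamma>1 r(1) unfolding \<gamma>_def gauge_def by auto
    have main: "norm ((\<Sum>(x,k)\<in>D. measure lborel k *\<^sub>R f x) - (g b - g a)) < \<epsilon>'"
      if D: "D tagged_division_of {a..b}" and fine: "\<gamma> fine D" for D
    proof -
      have fine1: "\<gamma>1 fine D" and fine2: "(\<lambda>x. ball x (r x)) fine D"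
        using fine unfolding \<gamma>_def fine_Int by auto
      have K: "\<exists>u v. K = {u..v} \<and> u \<le> x \<and> x \<le> v \<and> a \<le> u \<and> v \<le> b \<and> Inf K = u \<and> Sup K = v \<and> measure lborel K = v - u"
        if xK: "(x, K) \<in> D" for x K
      proof -
        obtain u v where uv: "K = cbox u v" using tagged_division_ofD(4)[OF D xK] by blast
        have x: "x \<in> K" using tagged_division_ofD(2)[OF D xK] .
        have "K \<subseteq> {a..b}" using tagged_division_ofD(3)[OF D xK] .
        then show ?thesis using uv x by (intro exI[of _ u] exI[of _ v]) auto
      qed
      have finD: "finite D" using D by auto
      define DN where "DN = {p \<in> D. fst p \<in> N}"
      define U where "U p = (Inf (snd p), Sup (snd p))" for p :: "real \<times> real set"
      \<comment> \<open>Tagged intervals are determined by their end points: two nondegenerate ones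
        with the same end points would overlap, and a degenerate one determines its tag. Passing to
        end points therefore loses no summand.\<close>
      have eqU: "p = q" if p: "p \<in> D" and q: "q \<in> D" and "U p = U q" for p q
      proof -
        obtain x A where pA: "p = (x, A)" by force
        obtain y B where qB: "q = (y, B)" by force
        obtain u v where 1: "A = {u..v}" "u \<le> x" "x \<le> v" "Inf A = u" "Sup A = v" using K p pA by metis
        obtain u' v' where 2: "B = {u'..v'}" "u' \<le> y" "y \<le> v'" "Inf B = u'" "Sup B = v'" using K q qB by metis
        have eq: "u = u'" "v = v'" using \<open>U p = U q\<close> 1 2 pA qB by (auto simp: U_def)
        show ?thesis
        proof (rule ccontr)
          assume "p \<noteq> q"
          then have "interior A \<inter> interior B = {}"
            using tagged_division_ofD(5)[OF D p[unfolded pA] q[unfolded qB]] pA qB by blast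
          then have "{u<..<v} = {}" using 1(1) 2(1) eq by simp
          then have "u = v" using 1 by (simp add: greaterThanLessThan_empty_iff)
          then show False using \<open>p \<noteq> q\<close> 1 2 eq pA qB by auto
        qed
      qed
      then have injU: "inj_on U D" by (auto simp: inj_on_def)
      have injUN: "inj_on U DN" using injU by (rule inj_on_subset) (auto simp: DN_def)
      \<comment> \<open>The total length of the intervals with tags in \<open>N\<close> is a Riemann
        sum of the indicator of \<open>N\<close>, small by the choice of
        \<open>\<gamma>1\<close>.\<close>
      have lenN: "(\<Sum>(x,y)\<in>U ` DN. y - x) < d"
      proof -
        have "(\<Sum>(x,y)\<in>U ` DN. y - x) = (\<Sum>(x,k)\<in>DN. measure lborel k)"
        proof (subst sum.reindex[OF injUN], rule sum.cong)
          fix p assume "p \<in> DN"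
          then have "(fst p, snd p) \<in> D" by (simp add: DN_def)
          from K[OF this] show "((\<lambda>(x, y). y - x) \<circ> U) p = (case p of (x, k) \<Rightarrow> measure lborel k)"
            by (auto simp: U_def case_prod_beta)
        qed simp
        also have "\<dots> = (\<Sum>(x,k)\<in>D. measure lborel k *\<^sub>R (indicator N x :: real))"
          by (rule sum.mono_neutral_cong_left) (auto simp: DN_def indicator_def finD)
        also have "\<dots> < d" using \<gamma>1'[OF D fine1] by simp
        finally show ?thesis .
      qed
      have "(\<Sum>(x,y)\<in>U ` DN. norm (g y - g x)) < \<epsilon>"
      proof (rule d(2)[OF _ _ _ lenN])
        show "finite (U ` DN)" using finD by (simp add: DN_def)
        show "a \<le> x \<and> x \<le> y \<and> y \<le> b" if xyU: "(x, y) \<in> U ` DN" for x y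
        proof -
          obtain p where "p \<in> DN" "(x, y) = U p" using xyU by blast
          then show ?thesis using K[of "fst p" "snd p"] by (auto simp: U_def DN_def)
        qed
        show "pairwise (\<lambda>I J. {fst I<..<snd I} \<inter> {fst J<..<snd J} = {}) (U ` DN)"
        proof (rule pairwiseI)
          fix I J assume I: "I \<in> U ` DN" and J: "J \<in> U ` DN" and "I \<noteq> J"
          obtain p where p: "p \<in> DN" "I = U p" using I by blast
          obtain q where q: "q \<in> DN" "J = U q" using J by blast
          obtain x A where xA: "(x, A) \<in> D" "I = U (x, A)" using p by (cases p) (auto simp: DN_def)
          obtain y B where yB: "(y, B) \<in> D" "J = U (y, B)" using q by (cases q) (auto simp: DN_def)
          have "(x, A) \<noteq> (y, B)" using \<open>I \<noteq> J\<close> xA yB by auto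
          from tagged_division_ofD(5)[OF D xA(1) yB(1) this]
          have "interior A \<inter> interior B = {}" .
          moreover have "interior A = {fst I<..<snd I}"
            using K[OF xA(1)] xA(2) interior_atLeastAtMost_real by (metis U_def fst_conv snd_conv)
          moreover have "interior B = {fst J<..<snd J}"
            using K[OF yB(1)] yB(2) interior_atLeastAtMost_real by (metis U_def fst_conv snd_conv)
          ultimately show "{fst I<..<snd I} \<inter> {fst J<..<snd J} = {}" by simp
        qed
      qed
      then have sumN: "(\<Sum>p\<in>DN. norm (g (Sup (snd p)) - g (Inf (snd p)))) < \<epsilon>"
        by (subst (asm) sum.reindex[OF injUN]) (simp add: U_def case_prod_beta)
      \<comment> \<open>Outside \<open>N\<close> the derivative at the tag controls the increment. A
        tag in \<open>N\<close> contributes the increment of \<open>g\<close> itself, which absolute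
        continuity controls in sum.\<close>
      have bound: "norm (measure lborel K *\<^sub>R f x - (g (Sup K) - g (Inf K))) \<le>
          (if x \<in> N then norm (g (Sup K) - g (Inf K)) else 0) + \<epsilon> * measure lborel K" if xK: "(x, K) \<in> D" for x K
      proof (cases "x \<in> N")
        case True
        have "0 \<le> \<epsilon> * measure lborel K" using \<epsilon>(1) by simp
        then show ?thesis using True norm_minus_commute[of "g (Inf K)" "g (Sup K)"] by (simp add: f_def)
      next
        case False
        obtain u v where uv: "K = {u..v}" "u \<le> x" "x \<le> v" "a \<le> u" "v \<le> b" "Inf K = u" "Sup K = v" "measure lborel K = v - u"
          using K[OF xK] by blast
        have "K \<subseteq> ball x (r x)" using fineD[OF fine2 xK] .
        moreover have "u \<in> K" "v \<in> K" using uv by auto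
        ultimately have "u \<in> ball x (r x)" "v \<in> ball x (r x)" by blast+
        then have 1: "norm (g u - g x - (u - x) *\<^sub>R g' x) \<le> \<epsilon> * \<bar>u - x\<bar>"
          and 2: "norm (g v - g x - (v - x) *\<^sub>R g' x) \<le> \<epsilon> * \<bar>v - x\<bar>"
          using r(2)[of x u] r(2)[of x v] False uv by (auto simp: dist_real_def abs_minus_commute)
        have "measure lborel K *\<^sub>R f x - (g (Sup K) - g (Inf K)) = (g u - g x - (u - x) *\<^sub>R g' x) - (g v - g x - (v - x) *\<^sub>R g' x)"
          using False uv by (simp add: f_def algebra_simps)
        also have "norm \<dots> \<le> \<epsilon> * \<bar>u - x\<bar> + \<epsilon> * \<bar>v - x\<bar>"
          using 1 2 by (intro order_trans[OF norm_triangle_ineq4 add_mono])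
        also have "\<dots> = \<epsilon> * measure lborel K" using uv by (simp add: algebra_simps)
        finally show ?thesis using False by simp
      qed
      have "(\<Sum>(x,k)\<in>D. measure lborel k *\<^sub>R f x) - (g b - g a) = (\<Sum>(x,k)\<in>D. measure lborel k *\<^sub>R f x - (g (Sup k) - g (Inf k)))"
        using additive_tagged_division_1[OF ab D, of g] by (simp add: sum_subtractf case_prod_beta)
      also have "norm \<dots> \<le> (\<Sum>(x,k)\<in>D. (if x \<in> N then norm (g (Sup k) - g (Inf k)) else 0) + \<epsilon> * measure lborel k)"
        using bound by (intro sum_norm_le) auto
      also have "\<dots> = (\<Sum>p\<in>DN. norm (g (Sup (snd p)) - g (Inf (snd p)))) + \<epsilon> * (\<Sum>(x,k)\<in>D. measure lborel k)"
      proof -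
        have "(\<Sum>p\<in>D. if fst p \<in> N then norm (g (Sup (snd p)) - g (Inf (snd p))) else 0) =
            (\<Sum>p\<in>DN. norm (g (Sup (snd p)) - g (Inf (snd p))))"
          by (rule sum.mono_neutral_cong_right) (auto simp: DN_def finD)
        then show ?thesis by (simp add: sum.distrib sum_distrib_left case_prod_beta)
      qed
      also have "(\<Sum>(x,k)\<in>D. measure lborel k) = b - a"
        using additive_content_tagged_division[of D a b] D ab by simp
      also have "(\<Sum>p\<in>DN. norm (g (Sup (snd p)) - g (Inf (snd p)))) + \<epsilon> * (b - a) < \<epsilon>'"
        using sumN \<epsilon> by simp
      finally show ?thesis .
    qed
    show "\<exists>\<gamma>. gauge \<gamma> \<and> (\<forall>D. D tagged_division_of {a..b} \<and> \<gamma> fine D \<longrightarrow>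
        norm ((\<Sum>(x,k)\<in>D. measure lborel k *\<^sub>R f x) - (g b - g a)) < \<epsilon>')"
    proof (intro exI[of _ \<gamma>] conjI allI impI gauge)
      fix D assume "D tagged_division_of {a..b} \<and> \<gamma> fine D"
      then show "norm ((\<Sum>(x,k)\<in>D. measure lborel k *\<^sub>R f x) - (g b - g a)) < \<epsilon>'"
        by (elim conjE) (rule main)
    qed
  qed
  then show ?thesis
    by (rule has_integral_spike[OF N, rotated]) (simp add: f_def)
qed

subsection \<open>Controlled trajectories\<close>

lemma AE_lebesgue_negligibleE:
  assumes "AE t in lebesgue. P t"
  obtains N where "negligible N" "\<And>t. t \<notin> N \<Longrightarrow> P t"
  using AE_E3[OF assms] by (auto simp: negligible_iff_null_sets)

lemma AE_lebesgue_negligibleI: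
  assumes "negligible N" "\<And>t. t \<notin> N \<Longrightarrow> P t"
  shows "AE t in lebesgue. P t"
  using assms AE_not_in[of N lebesgue] by (auto simp: negligible_iff_null_sets elim: eventually_mono)

lemma lebesgue_real_affine_measurable:
  "m \<noteq> 0 \<Longrightarrow> (\<lambda>t::real. m * t + q) \<in> lebesgue \<rightarrow>\<^sub>M lebesgue"
  using lebesgue_affine_measurable[of "\<lambda>x::real. m" q] by (simp add: add.commute)

lemma AE_lebesgue_real_affine:
  fixes P :: "real \<Rightarrow> bool"
  assumes "AE t in lebesgue. P t" and m: "m \<noteq> 0"
  shows "AE t in lebesgue. P (m * t + q)"
proof -
  obtain N where N: "negligible N" "\<And>t. t \<notin> N \<Longrightarrow> P t"
    using AE_lebesgue_negligibleE[OF assms(1)] by blast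
  have null: "N \<in> null_sets lebesgue" using N(1) by (simp add: negligible_iff_null_sets)
  then have meas: "(indicator N :: real \<Rightarrow> ennreal) \<in> borel_measurable lebesgue"
    by (intro borel_measurable_indicator) auto
  have "0 = (\<integral>\<^sup>+t. indicator N t \<partial>lebesgue)"
    using null by (subst nn_integral_indicator) (auto simp: null_setsD1)
  also have "\<dots> = ennreal \<bar>m\<bar> * (\<integral>\<^sup>+t. indicator N (q + m * t) \<partial>lebesgue)"
    by (rule nn_integral_real_affine_lebesgue[OF meas m])
  finally have "(\<integral>\<^sup>+t. indicator N (q + m * t) \<partial>lebesgue) = 0"
    using m by simp
  moreover have "(\<lambda>t. indicator N (q + m * t) :: ennreal) \<in> borel_measurable lebesgue"
    using measurable_compose[OF lebesgue_real_affine_measurable[OF m, of q] meas] by (simp add: add.commute)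
  ultimately have "AE t in lebesgue. (indicator N (q + m * t) :: ennreal) = 0"
    by (simp add: nn_integral_0_iff_AE)
  then show ?thesis
    by (rule eventually_mono) (use N(2) in \<open>auto simp: add.commute split: split_indicator_asm\<close>)
qed

lemma borel_measurable_indicator_scaleR:
  fixes g :: "'a \<Rightarrow> 'b::euclidean_space"
  assumes "S \<in> sets M" "g \<in> borel_measurable M"
  shows "(\<lambda>t. indicator S t *\<^sub>R g t) \<in> borel_measurable M"
  using assms by (intro borel_measurable_scaleR borel_measurable_indicator)

lemma measurable_lebesgue_on_iff:
  fixes u :: "real \<Rightarrow> 'a::euclidean_space"
  assumes "S \<in> sets lebesgue"
  shows "u \<in> borel_measurable (lebesgue_on S) \<longleftrightarrow> (\<lambda>t. indicator S t *\<^sub>R u t) \<in> borel_measurable lebesgue"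
  using assms by (subst borel_measurable_restrict_space_iff) auto

lemma measurable_half_line:
  fixes g :: "real \<Rightarrow> 'a::euclidean_space"
  assumes "\<And>T. T > 0 \<Longrightarrow> g \<in> borel_measurable (lebesgue_on {0..T})"
  shows "g \<in> borel_measurable (lebesgue_on {0..})"
proof -
  have "(\<lambda>t. indicator {0..} t *\<^sub>R g t) \<in> borel_measurable lebesgue"
  proof (rule borel_measurable_LIMSEQ_metric)
    show "(\<lambda>t. indicator {0..real (Suc n)} t *\<^sub>R g t) \<in> borel_measurable lebesgue" for n
      using assms[of "real (Suc n)"] measurable_lebesgue_on_iff[of "{0..real (Suc n)}" g] by simp
    show "(\<lambda>n. indicator {0..real (Suc n)} t *\<^sub>R g t) \<longlonglongrightarrow> indicator {0..} t *\<^sub>R g t" for t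
    proof (rule tendsto_eventually)
      obtain n0 :: nat where "t \<le> real n0" using real_arch_simple by blast
      then show "\<forall>\<^sub>F n in sequentially. indicator {0..real (Suc n)} t *\<^sub>R g t = indicator {0..} t *\<^sub>R g t"
        by (intro eventually_sequentiallyI[of n0]) (auto simp: indicator_def)
    qed
  qed
  then show ?thesis by (subst measurable_lebesgue_on_iff) auto
qed

context
  fixes f :: "'m::finite \<Rightarrow> real^'d \<Rightarrow> real^'d"
begin

abbreviation "velocity x u \<equiv> control_matrix f x *v u"

lemma velocity_sum: "velocity x u = (\<Sum>i\<in>UNIV. (u $ i) *\<^sub>R f i x)"
  by (simp add: vec_eq_iff matrix_vector_mult_def control_matrix_def mult.commute)

lemma velocity_scaleR: "velocity x (m *\<^sub>R u) = m *\<^sub>R velocity x u"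
  by (simp add: velocity_sum scaleR_sum_right)

lemma trajectories_iff:
  "(\<gamma>, u) \<in> trajectories f a b \<longleftrightarrow> AC a b \<gamma> \<and>
     (\<lambda>t. indicator {a..b} t *\<^sub>R u t) \<in> borel_measurable lebesgue \<and>
     set_integrable lebesgue {a..b} (\<lambda>t. (norm (u t))\<^sup>2) \<and>
     (AE t in lebesgue. t \<in> {a..b} \<longrightarrow> (\<gamma> has_vector_derivative velocity (\<gamma> t) (u t)) (at t))"
  by (auto simp: trajectories_def measurable_lebesgue_on_iff integrable_restrict_space AE_restrict_space_iff set_integrable_def)

lemma trajectories_subinterval:
  assumes "(\<gamma>, u) \<in> trajectories f a b" "a \<le> a'" "b' \<le> b"
  shows "(\<gamma>, u) \<in> trajectories f a' b'"
proof -
  have sub: "{a'..b'} \<subseteq> {a..b}" using assms by auto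
  have "(\<lambda>t. indicator {a'..b'} t *\<^sub>R (indicator {a..b} t *\<^sub>R u t)) \<in> borel_measurable lebesgue"
    by (rule borel_measurable_indicator_scaleR) (use assms(1) in \<open>auto simp: trajectories_iff\<close>)
  moreover have "(\<lambda>t. indicator {a'..b'} t *\<^sub>R (indicator {a..b} t *\<^sub>R u t)) = (\<lambda>t. indicator {a'..b'} t *\<^sub>R u t)"
    using sub by (auto simp: indicator_def)
  moreover have "set_integrable lebesgue {a'..b'} (\<lambda>t. (norm (u t))\<^sup>2)"
    by (rule set_integrable_subset[OF _ _ sub]) (use assms(1) in \<open>auto simp: trajectories_iff\<close>)
  moreover have "AE t in lebesgue. t \<in> {a'..b'} \<longrightarrow> (\<gamma> has_vector_derivative velocity (\<gamma> t) (u t)) (at t)"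
    using assms(1) sub by (auto simp: trajectories_iff elim!: eventually_mono)
  moreover have "AC a' b' \<gamma>" using assms AC_subset by (auto simp: trajectories_iff)
  ultimately show ?thesis by (simp add: trajectories_iff)
qed

text \<open>Negative \<open>m\<close> is allowed and means time reversal, with the control reversed
  as well.\<close>

lemma trajectories_affine:
  assumes \<gamma>: "(\<gamma>, u) \<in> trajectories f a b" and m: "m \<noteq> 0"
    and sub: "\<And>t. t \<in> {a'..b'} \<Longrightarrow> m * t + q \<in> {a..b}"
  shows "(\<lambda>t. \<gamma> (m * t + q), \<lambda>t. m *\<^sub>R u (m * t + q)) \<in> trajectories f a' b'"
proof -
  let ?A = "\<lambda>t. m * t + q"
  note A = lebesgue_real_affine_measurable[OF m, of q]
  have "(\<lambda>t. indicator {a..b} (?A t) *\<^sub>R u (?A t)) \<in> borel_measurable lebesgue"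
    using measurable_compose[OF A, of "\<lambda>t. indicator {a..b} t *\<^sub>R u t" borel] \<gamma> by (simp add: trajectories_iff)
  then have "(\<lambda>t. indicator {a'..b'} t *\<^sub>R (m *\<^sub>R (indicator {a..b} (?A t) *\<^sub>R u (?A t)))) \<in> borel_measurable lebesgue"
    by (intro borel_measurable_indicator_scaleR borel_measurable_const_scaleR) auto
  moreover have eq: "indicator {a'..b'} t *\<^sub>R (m *\<^sub>R (indicator {a..b} (?A t) *\<^sub>R u (?A t))) = indicator {a'..b'} t *\<^sub>R m *\<^sub>R u (?A t)" for t
    using sub[of t] by (auto simp: indicator_def)
  ultimately have 1: "(\<lambda>t. indicator {a'..b'} t *\<^sub>R m *\<^sub>R u (?A t)) \<in> borel_measurable lebesgue"
    unfolding eq by simp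
  have "integrable lebesgue (\<lambda>t. indicator {a..b} t *\<^sub>R (norm (u t))\<^sup>2)"
    using \<gamma> by (simp add: trajectories_iff set_integrable_def)
  then have "integrable lebesgue (\<lambda>t. indicator {a..b} (?A t) *\<^sub>R (norm (u (?A t)))\<^sup>2)"
    using lebesgue_integrable_real_affine_iff[OF m, of "\<lambda>t. indicator {a..b} t *\<^sub>R (norm (u t))\<^sup>2" q]
    by (simp add: add.commute)
  then have int: "integrable lebesgue (\<lambda>t. indicator {a'..b'} t *\<^sub>R (m\<^sup>2 * (indicator {a..b} (?A t) *\<^sub>R (norm (u (?A t)))\<^sup>2)))"
    by (intro integrable_mult_indicator integrable_mult_right) auto
  have 2: "set_integrable lebesgue {a'..b'} (\<lambda>t. (norm (m *\<^sub>R u (?A t)))\<^sup>2)"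
  proof -
    have eq: "indicator {a'..b'} t *\<^sub>R (m\<^sup>2 * (indicator {a..b} (?A t) *\<^sub>R (norm (u (?A t)))\<^sup>2)) =
       indicator {a'..b'} t *\<^sub>R (norm (m *\<^sub>R u (?A t)))\<^sup>2" for t
      using sub[of t] by (auto simp: indicator_def power_mult_distrib)
    show ?thesis using int unfolding eq set_integrable_def .
  qed
  have "AE t in lebesgue. t \<in> {a..b} \<longrightarrow> (\<gamma> has_vector_derivative velocity (\<gamma> t) (u t)) (at t)"
    using \<gamma> by (simp add: trajectories_iff)
  from AE_lebesgue_real_affine[OF this m, of q]
  have "AE t in lebesgue. t \<in> {a'..b'} \<longrightarrow> ((\<lambda>t. \<gamma> (?A t)) has_vector_derivative velocity (\<gamma> (?A t)) (m *\<^sub>R u (?A t))) (at t)"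
  proof (rule eventually_mono, intro impI)
    fix t assume *: "?A t \<in> {a..b} \<longrightarrow> (\<gamma> has_vector_derivative velocity (\<gamma> (?A t)) (u (?A t))) (at (?A t))" and t: "t \<in> {a'..b'}"
    have "(?A has_vector_derivative m) (at t)" by (auto intro!: derivative_eq_intros)
    moreover have "(\<gamma> has_vector_derivative velocity (\<gamma> (?A t)) (u (?A t))) (at (?A t))" using * sub[OF t] by blast
    ultimately show "((\<lambda>t. \<gamma> (?A t)) has_vector_derivative velocity (\<gamma> (?A t)) (m *\<^sub>R u (?A t))) (at t)"
      using vector_diff_chain_at[of ?A m t \<gamma>] by (simp add: o_def velocity_scaleR)
  qed
  then show ?thesis
    using 1 2 AC_affine[of a b \<gamma> m a' b' q] m sub \<gamma> by (auto simp: trajectories_iff)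
qed

text \<open>The controls are compared on the open interval only, since a concatenated control takes
  its value at the junction from one of its pieces.\<close>

lemma trajectories_cong:
  assumes \<gamma>: "(\<gamma>, u) \<in> trajectories f a b"
    and eq: "\<And>t. t \<in> {a..b} \<Longrightarrow> \<gamma>' t = \<gamma> t" "\<And>t. t \<in> {a<..<b} \<Longrightarrow> u' t = u t"
  shows "(\<gamma>', u') \<in> trajectories f a b"
proof -
  have "AC a b \<gamma>'"
    using \<gamma> eq(1) AC_dominated[of a b \<gamma> 1 \<gamma>'] by (simp add: trajectories_iff)
  moreover have "(\<lambda>t. indicator {a..b} t *\<^sub>R u' t) \<in> borel_measurable lebesgue"
  proof (rule measurable_discrete_difference[where X="{a,b}"])
    show "(\<lambda>t. indicator {a..b} t *\<^sub>R u t) \<in> borel_measurable lebesgue"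
      using \<gamma> by (simp add: trajectories_iff)
    show "indicator {a..b} t *\<^sub>R u t = indicator {a..b} t *\<^sub>R u' t" if "t \<notin> {a, b}" for t
      using that eq(2)[of t] by (auto simp: indicator_def)
  qed auto
  moreover have "set_integrable lebesgue {a..b} (\<lambda>t. (norm (u' t))\<^sup>2)"
  proof -
    have "integrable lebesgue (\<lambda>t. indicator {a..b} t *\<^sub>R (norm (u t))\<^sup>2) \<longleftrightarrow>
       integrable lebesgue (\<lambda>t. indicator {a..b} t *\<^sub>R (norm (u' t))\<^sup>2)"
    proof (rule integrable_discrete_difference[where X="{a,b}"])
      show "indicator {a..b} t *\<^sub>R (norm (u t))\<^sup>2 = indicator {a..b} t *\<^sub>R (norm (u' t))\<^sup>2" if "t \<notin> {a, b}" for t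
        using that eq(2)[of t] by (auto simp: indicator_def)
    qed auto
    then show ?thesis using \<gamma> by (simp add: trajectories_iff set_integrable_def)
  qed
  moreover have "AE t in lebesgue. t \<in> {a..b} \<longrightarrow> (\<gamma>' has_vector_derivative velocity (\<gamma>' t) (u' t)) (at t)"
  proof -
    have "AE t in lebesgue. t \<notin> {a, b}"
      by (rule AE_lebesgue_negligibleI[of "{a, b}"]) auto
    moreover have "AE t in lebesgue. t \<in> {a..b} \<longrightarrow> (\<gamma> has_vector_derivative velocity (\<gamma> t) (u t)) (at t)"
      using \<gamma> by (simp add: trajectories_iff)
    ultimately show ?thesis
    proof eventually_elim
      case (elim t)
      show ?case
      proof
        assume "t \<in> {a..b}"
        then have t: "t \<in> {a<..<b}" using elim by auto
        have "(\<gamma> has_vector_derivative velocity (\<gamma> t) (u t)) (at t)" using elim t by simp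
        then have "(\<gamma>' has_vector_derivative velocity (\<gamma> t) (u t)) (at t)"
          by (rule has_vector_derivative_transform_within_open[OF _ open_greaterThanLessThan t])
             (simp add: eq(1))
        then show "(\<gamma>' has_vector_derivative velocity (\<gamma>' t) (u' t)) (at t)"
          using t eq by simp
      qed
    qed
  qed
  ultimately show ?thesis by (simp add: trajectories_iff)
qed

lemma trajectories_glue:
  assumes 1: "(\<gamma>, u) \<in> trajectories f a b" and 2: "(\<gamma>, u) \<in> trajectories f b c" and abc: "a \<le> b" "b \<le> c"
  shows "(\<gamma>, u) \<in> trajectories f a c"
proof -
  have un: "{a..c} = {a..b} \<union> {b..c}" using abc by auto
  have "AC a c \<gamma>" using 1 2 AC_glue by (auto simp: trajectories_iff)
  moreover have "(\<lambda>t. indicator {a..c} t *\<^sub>R u t) \<in> borel_measurable lebesgue"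
  proof -
    have "(\<lambda>t. indicator {a..b} t *\<^sub>R u t + indicator {b..c} t *\<^sub>R u t) \<in> borel_measurable lebesgue"
      using 1 2 by (intro borel_measurable_add) (auto simp: trajectories_iff)
    then show ?thesis
    proof (rule measurable_discrete_difference[where X="{b}"])
      show "indicator {a..b} t *\<^sub>R u t + indicator {b..c} t *\<^sub>R u t = indicator {a..c} t *\<^sub>R u t" if "t \<notin> {b}" for t
        using that abc by (auto simp: indicator_def)
    qed auto
  qed
  moreover have "set_integrable lebesgue {a..c} (\<lambda>t. (norm (u t))\<^sup>2)"
    unfolding un using 1 2 by (intro set_integrable_Un) (auto simp: trajectories_iff)
  moreover have "AE t in lebesgue. t \<in> {a..c} \<longrightarrow> (\<gamma> has_vector_derivative velocity (\<gamma> t) (u t)) (at t)"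
  proof -
    have "AE t in lebesgue. t \<in> {a..b} \<longrightarrow> (\<gamma> has_vector_derivative velocity (\<gamma> t) (u t)) (at t)"
      "AE t in lebesgue. t \<in> {b..c} \<longrightarrow> (\<gamma> has_vector_derivative velocity (\<gamma> t) (u t)) (at t)"
      using 1 2 by (auto simp: trajectories_iff)
    then show ?thesis by eventually_elim auto
  qed
  ultimately show ?thesis by (simp add: trajectories_iff)
qed

lemma trajectories_C1:
  assumes der: "\<And>t. t \<in> {a..b} \<Longrightarrow> (\<gamma> has_vector_derivative velocity (\<gamma> t) w) (at t within {a..b})"
    and f: "\<And>i. continuous_on UNIV (f i)"
  shows "(\<gamma>, \<lambda>_. w) \<in> trajectories f a b"
proof -
  have "continuous_on {a..b} \<gamma>"
    using der by (meson continuous_on_eq_continuous_within has_vector_derivative_continuous)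
  then have "continuous_on {a..b} (\<lambda>t. velocity (\<gamma> t) w)"
    unfolding velocity_sum by (intro continuous_intros continuous_on_compose2[OF f]) auto
  then have "bounded ((\<lambda>t. velocity (\<gamma> t) w) ` {a..b})"
    by (intro compact_imp_bounded compact_continuous_image) auto
  then obtain M where M: "M > 0" "\<forall>x\<in>(\<lambda>t. velocity (\<gamma> t) w) ` {a..b}. norm x \<le> M"
    unfolding bounded_pos by blast
  have "AC a b \<gamma>"
  proof (rule AC_lipschitz[of M])
    fix x y assume xy: "x \<in> {a..b}" "y \<in> {a..b}"
    have "norm (\<gamma> x - \<gamma> y) \<le> M * norm (x - y)"
    proof (rule differentiable_bound[where S="{a..b}"])
      show "(\<gamma> has_derivative (\<lambda>r. r *\<^sub>R velocity (\<gamma> t) w)) (at t within {a..b})" if "t \<in> {a..b}" for t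
        using der[OF that] by (simp add: has_vector_derivative_def)
      show "onorm (\<lambda>r. r *\<^sub>R velocity (\<gamma> t) w) \<le> M" if "t \<in> {a..b}" for t
      proof (rule onorm_bound)
        show "norm (r *\<^sub>R velocity (\<gamma> t) w) \<le> M * norm r" for r
          using M that by (simp add: mult.commute[of M] mult_left_mono)
      qed (use M in simp)
    qed (use xy in auto)
    then show "norm (\<gamma> x - \<gamma> y) \<le> M * \<bar>x - y\<bar>" by simp
  qed (use M in simp)
  moreover have "AE t in lebesgue. t \<in> {a..b} \<longrightarrow> (\<gamma> has_vector_derivative velocity (\<gamma> t) w) (at t)"
  proof (rule AE_lebesgue_negligibleI[of "{a, b}"])
    fix t assume "t \<notin> {a, b}"
    then show "t \<in> {a..b} \<longrightarrow> (\<gamma> has_vector_derivative velocity (\<gamma> t) w) (at t)"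
      using der[of t] at_within_Icc_at[of a t b] by auto
  qed auto
  moreover have "set_integrable lebesgue {a..b} (\<lambda>t. (norm w)\<^sup>2)"
    unfolding set_integrable_def by (intro integrable_scaleR_left integrable_real_indicator) (auto simp: emeasure_lborel_Icc_eq)
  moreover have "(\<lambda>t. indicator {a..b} t *\<^sub>R w) \<in> borel_measurable lebesgue"
    by (intro borel_measurable_indicator_scaleR) auto
  ultimately show ?thesis by (simp add: trajectories_iff)
qed

lemma trajectories_norm_integrable:
  assumes "(\<gamma>, u) \<in> trajectories f a b"
  shows "set_integrable lebesgue {a..b} (\<lambda>t. norm (u t))"
  unfolding set_integrable_def
proof (rule Bochner_Integration.integrable_bound)
  show "integrable lebesgue (\<lambda>t. indicator {a..b} t *\<^sub>R 1 + indicator {a..b} t *\<^sub>R (norm (u t))\<^sup>2)"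
    using assms unfolding trajectories_iff set_integrable_def
    by (intro Bochner_Integration.integrable_add integrable_scaleR_left integrable_real_indicator) (auto simp: emeasure_lborel_Icc_eq)
  have "(\<lambda>t. indicator {a..b} t *\<^sub>R u t) \<in> borel_measurable lebesgue"
    using assms by (simp add: trajectories_iff)
  from measurable_compose[OF this, of norm borel]
  show "(\<lambda>t. indicator {a..b} t *\<^sub>R norm (u t)) \<in> borel_measurable lebesgue"
    by simp
  have "norm (u t) \<le> 1 + (norm (u t))\<^sup>2" for t
    using sum_squares_bound[of "norm (u t)" 1] by (simp add: power2_eq_square) (use norm_ge_zero[of "u t"] in linarith)
  then show "AE t in lebesgue. norm (indicator {a..b} t *\<^sub>R norm (u t)) \<le>
      norm (indicator {a..b} t *\<^sub>R 1 + indicator {a..b} t *\<^sub>R (norm (u t))\<^sup>2 :: real)"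
    by (auto simp: indicator_def)
qed

text \<open>\<open>\<psi>\<close> is Lipschitz on a ball containing the curve, so the composition is
  absolutely continuous; the chain rule applies wherever the curve is differentiable.\<close>

lemma trajectories_C1_function:
  fixes \<psi> :: "real^'d \<Rightarrow> 'b::euclidean_space"
  assumes \<gamma>: "(\<gamma>, u) \<in> trajectories f a b" and ab: "a \<le> b" and \<psi>: "Ck (Suc 0) \<psi>"
  shows "((\<lambda>t. frechet_derivative \<psi> (at (\<gamma> t)) (velocity (\<gamma> t) (u t))) has_integral (\<psi> (\<gamma> b) - \<psi> (\<gamma> a))) {a..b}"
proof -
  have ac: "AC a b \<gamma>" using \<gamma> by (simp add: trajectories_iff)
  have "bounded (\<gamma> ` {a..b})"
    using AC_continuous[OF ac] by (intro compact_imp_bounded compact_continuous_image) auto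
  then obtain R where R: "\<forall>x\<in>\<gamma> ` {a..b}. norm x \<le> R" unfolding bounded_iff by blast
  obtain K where K: "K \<ge> 0" "\<And>x y. x \<in> cball 0 R \<Longrightarrow> y \<in> cball 0 R \<Longrightarrow> norm (\<psi> x - \<psi> y) \<le> K * norm (x - y)"
    using C1_lipschitz_on_cball[OF \<psi>, of 0 R] by blast
  have "AC a b (\<lambda>t. \<psi> (\<gamma> t))"
    using R K by (intro AC_dominated[OF ac K(1)]) auto
  moreover have "AE t in lebesgue. t \<in> {a..b} \<longrightarrow> (\<gamma> has_vector_derivative velocity (\<gamma> t) (u t)) (at t)"
    using \<gamma> by (simp add: trajectories_iff)
  then obtain N where N: "negligible N" "\<And>t. t \<notin> N \<Longrightarrow> t \<in> {a..b} \<longrightarrow> (\<gamma> has_vector_derivative velocity (\<gamma> t) (u t)) (at t)"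
    by (rule AE_lebesgue_negligibleE) blast
  moreover have "((\<lambda>t. \<psi> (\<gamma> t)) has_vector_derivative frechet_derivative \<psi> (at (\<gamma> t)) (velocity (\<gamma> t) (u t))) (at t within {a..b})"
    if t: "t \<in> {a..b} - N" for t
  proof -
    have "(\<gamma> has_vector_derivative velocity (\<gamma> t) (u t)) (at t)" using N(2)[of t] t by blast
    then have "(\<gamma> has_derivative (\<lambda>r. r *\<^sub>R velocity (\<gamma> t) (u t))) (at t within {a..b})"
      unfolding has_vector_derivative_def by (rule has_derivative_at_withinI)
    from has_derivative_compose[OF this Ck_Suc_has_derivative[OF \<psi>]]
    show ?thesis
      unfolding has_vector_derivative_def
      using linear_scale[OF has_derivative_linear[OF Ck_Suc_has_derivative[OF \<psi>]]] by simp
  qed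
  ultimately show ?thesis
    by (intro AC_fundamental_theorem[OF _ ab N(1)]) auto
qed

context
  fixes c :: real
  assumes growth: "\<And>x i. norm (f i x) \<le> c * (1 + norm x)" and c: "c \<ge> 1"
begin

definition "velocity_bound = c * real CARD('m)"

lemma velocity_bound_pos: "velocity_bound > 0"
  using c by (simp add: velocity_bound_def)

lemma norm_velocity: "norm (velocity x u) \<le> velocity_bound * (1 + norm x) * norm u"
proof -
  have "norm (velocity x u) \<le> (\<Sum>i\<in>(UNIV::'m set). norm u * (c * (1 + norm x)))"
    unfolding velocity_sum
    using growth by (intro sum_norm_le) (auto intro!: mult_mono component_le_norm_cart)
  then show ?thesis by (simp add: velocity_bound_def mult_ac)
qed

lemma trajectories_displacement:
  assumes \<gamma>: "(\<gamma>, u) \<in> trajectories f a b" and R: "\<And>t. t \<in> {a..b} \<Longrightarrow> norm (\<gamma> t) \<le> R"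
    and t: "t \<in> {a..b}"
  shows "norm (\<gamma> t - \<gamma> a) \<le> velocity_bound * (1 + R) * (LINT s:{a..b}|lebesgue. norm (u s))"
proof -
  have R0: "R \<ge> 0" using R[OF t] norm_ge_zero[of "\<gamma> t"] by linarith
  have at: "a \<le> t" using t by simp
  have \<gamma>t: "(\<gamma>, u) \<in> trajectories f a t"
    using trajectories_subinterval[OF \<gamma>, of a t] t by simp
  have si: "set_integrable lebesgue {a..b} (\<lambda>s. norm (u s))" "set_integrable lebesgue {a..t} (\<lambda>s. norm (u s))"
    using trajectories_norm_integrable \<gamma> \<gamma>t by blast+
  have "Ck (Suc 0) (\<lambda>x::real^'d. x)" by (rule Ck_bounded_linear) (rule bounded_linear_ident)
  from trajectories_C1_function[OF \<gamma>t at this]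
  have I: "((\<lambda>s. velocity (\<gamma> s) (u s)) has_integral (\<gamma> t - \<gamma> a)) {a..t}" by simp
  have "norm (integral {a..t} (\<lambda>s. velocity (\<gamma> s) (u s))) \<le> integral {a..t} (\<lambda>s. velocity_bound * (1 + R) * norm (u s))"
  proof (rule integral_norm_bound_integral)
    show "(\<lambda>s. velocity (\<gamma> s) (u s)) integrable_on {a..t}" using I by blast
    show "(\<lambda>s. velocity_bound * (1 + R) * norm (u s)) integrable_on {a..t}"
      using set_lebesgue_integral_eq_integral(1)[OF si(2)] by (intro integrable_cmul[where 'b=real, unfolded real_scaleR_def])
    fix s assume s: "s \<in> {a..t}"
    have "velocity_bound * (1 + norm (\<gamma> s)) * norm (u s) \<le> velocity_bound * (1 + R) * norm (u s)"
      using R[of s] s t velocity_bound_pos by (intro mult_right_mono mult_left_mono) auto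
    then show "norm (velocity (\<gamma> s) (u s)) \<le> velocity_bound * (1 + R) * norm (u s)"
      using norm_velocity[of "\<gamma> s" "u s"] by simp
  qed
  also have "\<dots> = velocity_bound * (1 + R) * (LINT s:{a..t}|lebesgue. norm (u s))"
    using set_lebesgue_integral_eq_integral(2)[OF si(2)] by simp
  also have "\<dots> \<le> velocity_bound * (1 + R) * (LINT s:{a..b}|lebesgue. norm (u s))"
    using si t R0 velocity_bound_pos unfolding set_lebesgue_integral_def set_integrable_def
    by (intro mult_left_mono integral_mono) (auto simp: indicator_def)
  finally show ?thesis using integral_unique[OF I] by simp
qed

text \<open>At the point \<open>\<gamma> m\<close> of largest norm the displacement is at most
  \<open>(1 + norm (\<gamma> m)) / 2\<close>, and the term in \<open>\<gamma> m\<close> is absorbed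
  on the left.\<close>

lemma trajectories_bounded:
  assumes \<gamma>: "(\<gamma>, u) \<in> trajectories f a b" and small: "velocity_bound * (LINT s:{a..b}|lebesgue. norm (u s)) \<le> 1 / 2"
    and t: "t \<in> {a..b}"
  shows "norm (\<gamma> t) \<le> 2 * norm (\<gamma> a) + 1"
proof -
  have "continuous_on {a..b} (\<lambda>t. norm (\<gamma> t))"
    using AC_continuous \<gamma> by (intro continuous_on_norm) (auto simp: trajectories_iff)
  then obtain m where m: "m \<in> {a..b}" "\<And>t. t \<in> {a..b} \<Longrightarrow> norm (\<gamma> t) \<le> norm (\<gamma> m)"
    using continuous_attains_sup[of "{a..b}" "\<lambda>t. norm (\<gamma> t)"] t by auto
  have "norm (\<gamma> m - \<gamma> a) \<le> velocity_bound * (1 + norm (\<gamma> m)) * (LINT s:{a..b}|lebesgue. norm (u s))"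
    by (rule trajectories_displacement[OF \<gamma> m(2) m(1)])
  also have "\<dots> = (1 + norm (\<gamma> m)) * (velocity_bound * (LINT s:{a..b}|lebesgue. norm (u s)))" by simp
  also have "\<dots> \<le> (1 + norm (\<gamma> m)) * (1 / 2)" using small by (intro mult_left_mono) auto
  finally have "norm (\<gamma> m) \<le> 2 * norm (\<gamma> a) + 1"
    using norm_triangle_sub[of "\<gamma> m" "\<gamma> a"] by simp
  then show ?thesis using m(2)[OF t] by simp
qed

end

end

subsection \<open>The discounted value function\<close>

lemma borel_measurable_ennreal_indicator:
  fixes g :: "real \<Rightarrow> real"
  assumes g: "g \<in> borel_measurable (lebesgue_on S)" and S: "S \<in> sets lebesgue" "T \<in> sets lebesgue" "T \<subseteq> S"
  shows "(\<lambda>t. ennreal (g t) * indicator T t) \<in> borel_measurable lebesgue"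
proof -
  have "(\<lambda>t. indicator S t *\<^sub>R g t) \<in> borel_measurable lebesgue"
    using g measurable_lebesgue_on_iff[OF S(1), of g] by simp
  then have "(\<lambda>t. ennreal (indicator S t *\<^sub>R g t) * indicator T t) \<in> borel_measurable lebesgue"
    using S(2) by (intro borel_measurable_times_ennreal borel_measurable_indicator measurable_compose[OF _ measurable_ennreal])
  moreover have "ennreal (indicator S t *\<^sub>R g t) * indicator T t = ennreal (g t) * indicator T t" for t
    using S(3) by (auto simp: indicator_def)
  ultimately show ?thesis by simp
qed

lemma nn_integral_shift:
  fixes H :: "real \<Rightarrow> ennreal"
  assumes "H \<in> borel_measurable lebesgue"
  shows "(\<integral>\<^sup>+t. H (t + q) \<partial>lebesgue) = (\<integral>\<^sup>+t. H t \<partial>lebesgue)"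
  using nn_integral_real_affine_lebesgue[OF assms, of 1 q] by (simp add: add.commute)

text \<open>The hypotheses in the form in which they act: \<open>B\<close> bounds the growth of
  \<open>L\<close> on balls, and \<open>\<kappa>\<close> measures its quadratic coercivity, which
  will come from convexity in the control.\<close>

locale control_problem =
  fixes f :: "'m::finite \<Rightarrow> real^'d \<Rightarrow> real^'d" and L :: "(real^'d) \<times> (real^'m) \<Rightarrow> real"
    and c \<kappa> l1 :: real and B :: "real \<Rightarrow> real" and xstar :: "real^'d"
  assumes smooth_f: "\<And>i. smooth (f i)"
    and growth: "\<And>x i. norm (f i x) \<le> c * (1 + norm x)" and c: "c \<ge> 1"
    and chow: "chow_condition f"
    and L_cont: "continuous_on UNIV L"
    and L_nonneg: "\<And>x u. L (x, u) \<ge> 0"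
    and L_upper: "\<And>x u R. norm x \<le> R \<Longrightarrow> L (x, u) \<le> B R * (1 + (norm u)\<^sup>2)"
    and \<kappa>: "\<kappa> > 0" and L_lower: "\<And>x u. \<kappa> * (norm u)\<^sup>2 \<le> L (x, u)"
    and L_lipschitz: "\<And>x y u. L (x, u) \<le> L (y, u) + l1 * (1 + (norm u)\<^sup>2) * norm (x - y)" and l1: "l1 > 0"
    and L_star: "L (xstar, 0) = 0"
begin

lemma B_nonneg: "R \<ge> 0 \<Longrightarrow> B R \<ge> 0"
  using L_upper[of 0 R 0] L_nonneg[of 0 0] by simp

text \<open>Extended nonnegative values give the cost a meaning before integrability is known. The
  case \<open>lam = 0\<close> is the undiscounted cost, a common bound for the discounted
  ones.\<close>

definition cost :: "real \<Rightarrow> (real \<Rightarrow> real^'d) \<Rightarrow> (real \<Rightarrow> real^'m) \<Rightarrow> real set \<Rightarrow> ennreal" where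
  "cost lam \<gamma> u A = (\<integral>\<^sup>+t. ennreal (exp (- lam * t) * L (\<gamma> t, u t)) * indicator A t \<partial>lebesgue)"

abbreviation "v \<equiv> discounted_value f L"
abbreviation "admissible \<equiv> trajectories_discounted f"

lemma L_measurable:
  assumes "(\<gamma>, u) \<in> trajectories f a b"
  shows "(\<lambda>t. exp (- lam * t) * L (\<gamma> t, u t)) \<in> borel_measurable (lebesgue_on {a..b})"
proof -
  have "\<gamma> \<in> borel_measurable (lebesgue_on {a..b})"
    using AC_continuous assms by (intro continuous_imp_measurable_on_sets_lebesgue) (auto simp: trajectories_iff)
  moreover have "u \<in> borel_measurable (lebesgue_on {a..b})"
    using assms measurable_lebesgue_on_iff[of "{a..b}" u] by (simp add: trajectories_iff)
  ultimately have "(\<lambda>t. (\<gamma> t, u t)) \<in> borel_measurable (lebesgue_on {a..b})"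
    by (rule borel_measurable_Pair)
  then have "(\<lambda>t. L (\<gamma> t, u t)) \<in> borel_measurable (lebesgue_on {a..b})"
    by (rule measurable_compose[OF _ borel_measurable_continuous_onI[OF L_cont]])
  moreover have "(\<lambda>t. exp (- lam * t)) \<in> borel_measurable (lebesgue_on {a..b})"
    by (intro continuous_imp_measurable_on_sets_lebesgue continuous_intros) auto
  ultimately show ?thesis by (rule borel_measurable_times[rotated])
qed

lemma admissible_trajectory: "(\<gamma>, u) \<in> admissible lam x \<Longrightarrow> T > 0 \<Longrightarrow> (\<gamma>, u) \<in> trajectories f 0 T"
  by (auto simp: trajectories_discounted_def trajectories_from_def)

lemma admissible_start: "(\<gamma>, u) \<in> admissible lam x \<Longrightarrow> \<gamma> 0 = x"
  unfolding trajectories_discounted_def trajectories_from_def using zero_less_one by blast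

lemma admissible_integrable: "(\<gamma>, u) \<in> admissible lam x \<Longrightarrow> set_integrable lebesgue {0..} (\<lambda>t. exp (- lam * t) * (norm (u t))\<^sup>2)"
  by (auto simp: trajectories_discounted_def integrable_restrict_space set_integrable_def)

lemma admissibleI:
  assumes "\<And>T. T > 0 \<Longrightarrow> (\<gamma>, u) \<in> trajectories f 0 T" "\<gamma> 0 = x"
    "set_integrable lebesgue {0..} (\<lambda>t. exp (- lam * t) * (norm (u t))\<^sup>2)"
  shows "(\<gamma>, u) \<in> admissible lam x"
  using assms by (auto simp: trajectories_discounted_def trajectories_from_def integrable_restrict_space set_integrable_def)

lemma admissible_L_measurable:
  assumes "(\<gamma>, u) \<in> admissible lam x"
  shows "(\<lambda>t. exp (- mu * t) * L (\<gamma> t, u t)) \<in> borel_measurable (lebesgue_on {0..})"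
  by (rule measurable_half_line) (intro L_measurable admissible_trajectory[OF assms])

lemma ext_integral_cost:
  "ext_integral (lebesgue_on {0..}) (\<lambda>t. exp (- lam * t) * L (\<gamma> t, u t)) = enn2ereal (cost lam \<gamma> u {0..})"
proof -
  have "(\<integral>\<^sup>+ t. ennreal (- (exp (- lam * t) * L (\<gamma> t, u t))) \<partial>lebesgue_on {0..}) = 0"
    using L_nonneg by (simp add: ennreal_neg)
  moreover have "(\<integral>\<^sup>+ t. ennreal (exp (- lam * t) * L (\<gamma> t, u t)) \<partial>lebesgue_on {0..}) = cost lam \<gamma> u {0..}"
    unfolding cost_def by (rule nn_integral_restrict_space) simp
  ultimately show ?thesis by (simp add: ext_integral_def zero_ennreal.rep_eq)
qed

lemma ext_value_INF:
  "ext_discounted_value f L lam x = (INF (\<gamma>, u)\<in>admissible lam x. enn2ereal (cost lam \<gamma> u {0..}))"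
  by (simp only: ext_discounted_value_def ext_integral_cost)

lemma constant_trajectory: "(\<lambda>_. x, \<lambda>_. 0) \<in> trajectories f a b"
  by (rule trajectories_C1) (use smooth_f smooth_continuous in \<open>auto simp: velocity_sum\<close>)

lemma constant_admissible: "(\<lambda>_. x, \<lambda>_. 0) \<in> admissible lam x"
  by (rule admissibleI) (auto intro: constant_trajectory simp: set_integrable_def)

lemma constant_cost:
  assumes "lam > 0"
  shows "cost lam (\<lambda>_. x) (\<lambda>_. 0) {0..} = ennreal (L (x, 0) / lam)"
proof -
  have "((\<lambda>t. L (x, 0) * exp (- lam * t)) has_integral L (x, 0) * (exp (- lam * 0) / lam)) {0..}"
    using has_integral_exp_minus_to_infinity[OF assms, of 0] by (rule has_integral_mult_right)
  then have "(\<integral>\<^sup>+t. ennreal (indicator {0..} t * (L (x, 0) * exp (- lam * t))) \<partial>lborel) = ennreal (L (x, 0) / lam)"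
    using L_nonneg by (subst nn_integral_has_integral_lebesgue) (auto simp: mult_nonneg_nonneg)
  then show ?thesis
    unfolding cost_def by (subst nn_integral_completion) (simp add: indicator_mult_ennreal mult.commute)
qed

lemma
  assumes lam: "lam > 0"
  shows ext_value_eq: "ext_discounted_value f L lam x = ereal (v lam x)"
    and value_nonneg: "v lam x \<ge> 0"
proof -
  let ?e = "ext_discounted_value f L lam x"
  have "0 \<le> ?e" unfolding ext_value_INF by (rule INF_greatest) auto
  moreover have "?e \<le> enn2ereal (cost lam (\<lambda>_. x) (\<lambda>_. 0) {0..})"
    unfolding ext_value_INF by (rule INF_lower2[OF constant_admissible]) simp
  then have "?e \<le> ereal (L (x, 0) / lam)"
    using L_nonneg lam by (simp add: constant_cost[OF lam] enn2ereal_ennreal)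
  ultimately have "\<bar>?e\<bar> \<noteq> \<infinity>" by auto
  then show "?e = ereal (v lam x)" by (simp add: discounted_value_def ereal_real)
  then show "v lam x \<ge> 0" using \<open>0 \<le> ?e\<close> by simp
qed

lemma value_le:
  assumes "lam > 0" "(\<gamma>, u) \<in> admissible lam x"
  shows "ennreal (v lam x) \<le> cost lam \<gamma> u {0..}"
proof -
  have "ereal (v lam x) \<le> enn2ereal (cost lam \<gamma> u {0..})"
    unfolding ext_value_eq[OF assms(1), symmetric] ext_value_INF by (rule INF_lower2[OF assms(2)]) simp
  then have "e2ennreal (ereal (v lam x)) \<le> e2ennreal (enn2ereal (cost lam \<gamma> u {0..}))"
    by (rule e2ennreal_mono)
  then show ?thesis by (simp add: e2ennreal_enn2ereal ennreal.abs_eq)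
qed

lemma value_near:
  assumes "lam > 0" "\<delta> > 0"
  obtains \<gamma> u where "(\<gamma>, u) \<in> admissible lam x" "cost lam \<gamma> u {0..} \<le> ennreal (v lam x + \<delta>)"
proof -
  have "ext_discounted_value f L lam x < ereal (v lam x + \<delta>)"
    using assms by (simp add: ext_value_eq)
  then obtain \<gamma> u where *: "(\<gamma>, u) \<in> admissible lam x" "enn2ereal (cost lam \<gamma> u {0..}) < ereal (v lam x + \<delta>)"
    unfolding ext_value_INF by (auto simp: INF_less_iff)
  have "e2ennreal (enn2ereal (cost lam \<gamma> u {0..})) \<le> e2ennreal (ereal (v lam x + \<delta>))"
    using *(2) by (intro e2ennreal_mono) auto
  then show ?thesis using that[OF *(1)] by (simp add: e2ennreal_enn2ereal ennreal.abs_eq)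
qed

lemma cost_split:
  assumes "(\<lambda>t. exp (- lam * t) * L (\<gamma> t, u t)) \<in> borel_measurable (lebesgue_on {0..})" "h > 0"
  shows "cost lam \<gamma> u {0..} = cost lam \<gamma> u {0..h} + cost lam \<gamma> u {h<..}"
proof -
  have "cost lam \<gamma> u {0..h} + cost lam \<gamma> u {h<..} =
     (\<integral>\<^sup>+t. ennreal (exp (- lam * t) * L (\<gamma> t, u t)) * indicator {0..h} t +
        ennreal (exp (- lam * t) * L (\<gamma> t, u t)) * indicator {h<..} t \<partial>lebesgue)"
    unfolding cost_def using assms(2)
    by (intro nn_integral_add[symmetric] borel_measurable_ennreal_indicator[OF assms(1)]) auto
  also have "\<dots> = cost lam \<gamma> u {0..}"
    unfolding cost_def using assms(2) by (intro nn_integral_cong) (auto simp: indicator_def)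
  finally show ?thesis ..
qed

text \<open>The discount factor decreases in \<open>lam\<close> and \<open>L \<ge> 0\<close>, so a
  nearly optimal trajectory for \<open>mu\<close> stays admissible for \<open>lam\<close> and costs
  no more.\<close>

lemma value_mono:
  assumes "0 < mu" "mu \<le> lam"
  shows "v lam x \<le> v mu x"
proof (rule field_le_epsilon)
  fix \<delta> :: real assume "\<delta> > 0"
  have lam: "lam > 0" using assms by simp
  obtain \<gamma> u where *: "(\<gamma>, u) \<in> admissible mu x" "cost mu \<gamma> u {0..} \<le> ennreal (v mu x + \<delta>)"
    using value_near[OF assms(1) \<open>\<delta> > 0\<close>] by blast
  have le: "exp (- lam * t) \<le> exp (- mu * t)" if "t \<ge> 0" for t
    using assms that by (simp add: mult_right_mono)
  have adm: "(\<gamma>, u) \<in> admissible lam x"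
  proof (rule admissibleI)
    show "set_integrable lebesgue {0..} (\<lambda>t. exp (- lam * t) * (norm (u t))\<^sup>2)"
      unfolding set_integrable_def
    proof (rule Bochner_Integration.integrable_bound)
      show "integrable lebesgue (\<lambda>t. indicat_real {0..} t *\<^sub>R (exp (- mu * t) * (norm (u t))\<^sup>2))"
        using admissible_integrable[OF *(1)] by (simp add: set_integrable_def)
      then have "(\<lambda>t. indicator {0..} t *\<^sub>R (exp (- mu * t) * (norm (u t))\<^sup>2)) \<in> borel_measurable lebesgue"
        by (rule borel_measurable_integrable)
      then have *: "(\<lambda>t. exp ((mu - lam) * t) * (indicator {0..} t *\<^sub>R (exp (- mu * t) * (norm (u t))\<^sup>2))) \<in> borel_measurable lebesgue"
        by (intro borel_measurable_times[OF _] ) (auto intro!: measurable_completion)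
      have eq: "exp ((mu - lam) * t) * (indicator {0..} t *\<^sub>R (exp (- mu * t) * (norm (u t))\<^sup>2)) =
          indicator {0..} t *\<^sub>R (exp (- lam * t) * (norm (u t))\<^sup>2)" for t
      proof -
        have "exp ((mu - lam) * t) * exp (- mu * t) = exp (- lam * t)"
          by (simp add: exp_add[symmetric] algebra_simps)
        then show ?thesis by (simp add: indicator_def mult.assoc[symmetric])
      qed
      show "(\<lambda>t. indicator {0..} t *\<^sub>R (exp (- lam * t) * (norm (u t))\<^sup>2)) \<in> borel_measurable lebesgue"
        using * unfolding eq .
      show "AE t in lebesgue. norm (indicat_real {0..} t *\<^sub>R (exp (- lam * t) * (norm (u t))\<^sup>2)) \<le>
          norm (indicat_real {0..} t *\<^sub>R (exp (- mu * t) * (norm (u t))\<^sup>2))"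
        using le by (intro AE_I2) (auto simp: indicator_def mult_right_mono)
    qed
  qed (use admissible_trajectory admissible_start * in auto)
  have "cost lam \<gamma> u {0..} \<le> cost mu \<gamma> u {0..}"
    unfolding cost_def using le L_nonneg
    by (intro nn_integral_mono) (auto simp: indicator_def intro!: ennreal_leI mult_right_mono)
  then have "ennreal (v lam x) \<le> ennreal (v mu x + \<delta>)"
    using value_le[OF lam adm] *(2) by order
  then show "v lam x \<le> v mu x + \<delta>"
    by (rule ennreal_le_iff[THEN iffD1, rotated]) (use value_nonneg[OF assms(1), of x] \<open>\<delta> > 0\<close> in simp)
qed

text \<open>The discount is dropped on the first piece and on the tail. The inequality becomes
  weaker, but \<open>C\<close> is independent of \<open>lam\<close>, which makes the estimates
  derived from it uniform.\<close>

lemma dpp_upper: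
  assumes lam: "lam > 0" and \<tau>: "\<tau> > 0" and \<gamma>: "(\<gamma>, u) \<in> trajectories f 0 \<tau>"
    and C: "cost 0 \<gamma> u {0..\<tau>} \<le> ennreal C" "C \<ge> 0"
  shows "v lam (\<gamma> 0) \<le> C + v lam (\<gamma> \<tau>)"
proof (rule field_le_epsilon)
  fix \<delta> :: real assume "\<delta> > 0"
  obtain \<gamma>2 u2 where 2: "(\<gamma>2, u2) \<in> admissible lam (\<gamma> \<tau>)" "cost lam \<gamma>2 u2 {0..} \<le> ennreal (v lam (\<gamma> \<tau>) + \<delta>)"
    using value_near[OF lam \<open>\<delta> > 0\<close>] by blast
  define g where "g t = (if t \<le> \<tau> then \<gamma> t else \<gamma>2 (t - \<tau>))" for t
  define w where "w t = (if t \<le> \<tau> then u t else u2 (t - \<tau>))" for t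
  have traj: "(g, w) \<in> trajectories f 0 T" for T
  proof -
    have 1: "(g, w) \<in> trajectories f 0 \<tau>"
      by (rule trajectories_cong[OF \<gamma>]) (auto simp: g_def w_def)
    \<comment> \<open>An end time beyond \<open>\<tau>\<close> gives both pieces positive length;
      other end times follow by restriction.\<close>
    define T' where "T' = max T (\<tau> + 1)"
    have "(\<gamma>2, u2) \<in> trajectories f 0 (T' - \<tau>)"
      by (rule admissible_trajectory[OF 2(1)]) (simp add: T'_def)
    then have "(\<lambda>t. \<gamma>2 (1 * t + - \<tau>), \<lambda>t. 1 *\<^sub>R u2 (1 * t + - \<tau>)) \<in> trajectories f \<tau> T'"
      by (rule trajectories_affine) auto
    then have "(g, w) \<in> trajectories f \<tau> T'"
    proof (rule trajectories_cong)
      show "g t = \<gamma>2 (1 * t + - \<tau>)" if "t \<in> {\<tau>..T'}" for t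
        using that admissible_start[OF 2(1)] by (cases "t = \<tau>") (auto simp: g_def)
    qed (auto simp: w_def)
    with 1 have "(g, w) \<in> trajectories f 0 T'"
      by (rule trajectories_glue) (use \<tau> in \<open>auto simp: T'_def\<close>)
    then show ?thesis by (rule trajectories_subinterval) (auto simp: T'_def)
  qed
  have adm: "(g, w) \<in> admissible lam (\<gamma> 0)"
  proof (rule admissibleI[OF traj])
    show "g 0 = \<gamma> 0" using \<tau> by (simp add: g_def)
    have "set_integrable lebesgue {0..\<tau>} (\<lambda>t. (norm (w t))\<^sup>2)"
      using traj[of \<tau>] by (simp add: trajectories_iff)
    then have "set_integrable lebesgue {0..\<tau>} (\<lambda>t. exp (- lam * t) * (norm (w t))\<^sup>2)"
      unfolding set_integrable_def
    proof (rule Bochner_Integration.integrable_bound)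
      have "(\<lambda>t. exp (- lam * t) * (indicator {0..\<tau>} t *\<^sub>R (norm (w t))\<^sup>2)) \<in> borel_measurable lebesgue"
        using \<open>set_integrable lebesgue {0..\<tau>} (\<lambda>t. (norm (w t))\<^sup>2)\<close> unfolding set_integrable_def
        by (intro borel_measurable_times[OF _ borel_measurable_integrable]) (auto intro!: measurable_completion)
      then show "(\<lambda>t. indicator {0..\<tau>} t *\<^sub>R (exp (- lam * t) * (norm (w t))\<^sup>2)) \<in> borel_measurable lebesgue"
        by (simp add: mult.left_commute)
      show "AE t in lebesgue. norm (indicat_real {0..\<tau>} t *\<^sub>R (exp (- lam * t) * (norm (w t))\<^sup>2)) \<le>
          norm (indicat_real {0..\<tau>} t *\<^sub>R (norm (w t))\<^sup>2)"
        using lam by (intro AE_I2) (auto simp: indicator_def mult_left_le_one_le)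
    qed
    moreover have "set_integrable lebesgue {\<tau><..} (\<lambda>t. exp (- lam * t) * (norm (w t))\<^sup>2)"
    proof -
      have "set_integrable lebesgue {0<..} (\<lambda>t. exp (- lam * t) * (norm (u2 t))\<^sup>2)"
        by (rule set_integrable_subset[OF admissible_integrable[OF 2(1)]]) auto
      then have "integrable lebesgue (\<lambda>t. indicator {0<..} (- \<tau> + 1 * t) *\<^sub>R (exp (- lam * (- \<tau> + 1 * t)) * (norm (u2 (- \<tau> + 1 * t)))\<^sup>2))"
        unfolding set_integrable_def by (subst lebesgue_integrable_real_affine_iff[where f="\<lambda>t. indicator {0<..} t *\<^sub>R (exp (- lam * t) * (norm (u2 t))\<^sup>2)"]) auto
      from integrable_mult_right[OF this, of "exp (- lam * \<tau>)"]
      have int: "integrable lebesgue (\<lambda>t. exp (- lam * \<tau>) * (indicator {0<..} (- \<tau> + 1 * t) *\<^sub>R (exp (- lam * (- \<tau> + 1 * t)) * (norm (u2 (- \<tau> + 1 * t)))\<^sup>2)))" .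
      have eq: "exp (- lam * \<tau>) * (indicator {0<..} (- \<tau> + 1 * t) *\<^sub>R (exp (- lam * (- \<tau> + 1 * t)) * (norm (u2 (- \<tau> + 1 * t)))\<^sup>2))
         = indicator {\<tau><..} t *\<^sub>R (exp (- lam * t) * (norm (w t))\<^sup>2)" for t
      proof (cases "t > \<tau>")
        case True
        have "exp (- lam * \<tau>) * exp (- lam * (- \<tau> + 1 * t)) = exp (- lam * t)"
          by (simp add: exp_add[symmetric] algebra_simps)
        then show ?thesis using True by (simp add: w_def mult.assoc[symmetric])
      qed auto
      show ?thesis using int unfolding eq set_integrable_def .
    qed
    ultimately have "set_integrable lebesgue ({0..\<tau>} \<union> {\<tau><..}) (\<lambda>t. exp (- lam * t) * (norm (w t))\<^sup>2)"
      by (rule set_integrable_Un) auto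
    moreover have "{0..\<tau>} \<union> {\<tau><..} = {0..}" using \<tau> by auto
    ultimately show "set_integrable lebesgue {0..} (\<lambda>t. exp (- lam * t) * (norm (w t))\<^sup>2)" by simp
  qed
  have "cost lam g w {0..\<tau>} \<le> ennreal C"
  proof -
    have "cost lam g w {0..\<tau>} \<le> cost 0 \<gamma> u {0..\<tau>}"
      unfolding cost_def using lam L_nonneg
      by (intro nn_integral_mono) (auto simp: indicator_def g_def w_def intro!: ennreal_leI mult_left_le_one_le)
    then show ?thesis using C by order
  qed
  moreover have "cost lam g w {\<tau><..} \<le> cost lam \<gamma>2 u2 {0..}"
  proof -
    have "cost lam g w {\<tau><..} \<le> (\<integral>\<^sup>+t. ennreal (exp (- lam * (t + - \<tau>)) * L (\<gamma>2 (t + - \<tau>), u2 (t + - \<tau>))) * indicator {0..} (t + - \<tau>) \<partial>lebesgue)"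
      unfolding cost_def
    proof (rule nn_integral_mono)
      fix t
      have "exp (- lam * t) * L (\<gamma>2 (t - \<tau>), u2 (t - \<tau>)) \<le> exp (- lam * (t - \<tau>)) * L (\<gamma>2 (t - \<tau>), u2 (t - \<tau>))"
        using lam \<tau> L_nonneg by (intro mult_right_mono) (auto simp: algebra_simps)
      then show "ennreal (exp (- lam * t) * L (g t, w t)) * indicator {\<tau><..} t
         \<le> ennreal (exp (- lam * (t + - \<tau>)) * L (\<gamma>2 (t + - \<tau>), u2 (t + - \<tau>))) * indicator {0..} (t + - \<tau>)"
        by (auto simp: indicator_def g_def w_def intro!: ennreal_leI)
    qed
    also have "\<dots> = cost lam \<gamma>2 u2 {0..}"
      unfolding cost_def
      using nn_integral_shift[OF borel_measurable_ennreal_indicator[OF admissible_L_measurable[OF 2(1), of lam]], of "{0..}" "- \<tau>"]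
      by simp
    finally show ?thesis .
  qed
  ultimately have "cost lam g w {0..} \<le> ennreal C + ennreal (v lam (\<gamma> \<tau>) + \<delta>)"
    unfolding cost_split[OF admissible_L_measurable[OF adm] \<tau>]
    using 2(2) by (intro add_mono) auto
  then have "ennreal (v lam (\<gamma> 0)) \<le> ennreal C + ennreal (v lam (\<gamma> \<tau>) + \<delta>)"
    using value_le[OF lam adm] by order
  also have "\<dots> = ennreal (C + (v lam (\<gamma> \<tau>) + \<delta>))"
    using C value_nonneg[OF lam, of "\<gamma> \<tau>"] \<open>\<delta> > 0\<close> by (intro ennreal_plus[symmetric]) auto
  finally have "v lam (\<gamma> 0) \<le> C + (v lam (\<gamma> \<tau>) + \<delta>)"
    by (rule ennreal_le_iff[THEN iffD1, rotated])
       (use C value_nonneg[OF lam, of "\<gamma> \<tau>"] \<open>\<delta> > 0\<close> in auto)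
  then show "v lam (\<gamma> 0) \<le> C + v lam (\<gamma> \<tau>) + \<delta>" by simp
qed

text \<open>The tail of the trajectory, shifted by \<open>h\<close>, is admissible from
  \<open>\<gamma> h\<close>, and the shift turns the discount into the factor
  \<open>exp (- lam * h)\<close>. In a lower bound this factor has to be kept.\<close>

lemma dpp_lower:
  assumes lam: "lam > 0" and h: "h > 0" and \<gamma>: "(\<gamma>, u) \<in> admissible lam x"
  shows "cost lam \<gamma> u {0..h} + ennreal (exp (- lam * h) * v lam (\<gamma> h)) \<le> cost lam \<gamma> u {0..}"
proof -
  let ?g = "\<lambda>t. \<gamma> (1 * t + h)" and ?w = "\<lambda>t. 1 *\<^sub>R u (1 * t + h)"
  have adm: "(?g, ?w) \<in> admissible lam (\<gamma> h)"
  proof (rule admissibleI)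
    show "(?g, ?w) \<in> trajectories f 0 T" if "T > 0" for T
      using h that by (intro trajectories_affine[OF admissible_trajectory[OF \<gamma>, of "T + h"]]) auto
    have "set_integrable lebesgue {h..} (\<lambda>t. exp (- lam * t) * (norm (u t))\<^sup>2)"
      using h by (intro set_integrable_subset[OF admissible_integrable[OF \<gamma>]]) auto
    then have "integrable lebesgue (\<lambda>t. indicator {h..} (h + 1 * t) *\<^sub>R (exp (- lam * (h + 1 * t)) * (norm (u (h + 1 * t)))\<^sup>2))"
      unfolding set_integrable_def by (subst lebesgue_integrable_real_affine_iff[where f="\<lambda>t. indicator {h..} t *\<^sub>R (exp (- lam * t) * (norm (u t))\<^sup>2)"]) auto
    from integrable_mult_right[OF this, of "exp (lam * h)"]
    have int: "integrable lebesgue (\<lambda>t. exp (lam * h) * (indicator {h..} (h + 1 * t) *\<^sub>R (exp (- lam * (h + 1 * t)) * (norm (u (h + 1 * t)))\<^sup>2)))" .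
    have eq: "exp (lam * h) * (indicator {h..} (h + 1 * t) *\<^sub>R (exp (- lam * (h + 1 * t)) * (norm (u (h + 1 * t)))\<^sup>2))
         = indicator {0..} t *\<^sub>R (exp (- lam * t) * (norm (?w t))\<^sup>2)" for t
    proof (cases "t \<ge> 0")
      case True
      have "exp (lam * h) * exp (- lam * (h + 1 * t)) = exp (- lam * t)"
        by (simp add: exp_add[symmetric] algebra_simps)
      then show ?thesis using True by (simp add: mult.assoc[symmetric] add.commute)
    qed auto
    show "set_integrable lebesgue {0..} (\<lambda>t. exp (- lam * t) * (norm (?w t))\<^sup>2)"
      using int unfolding eq set_integrable_def .
  qed simp
  have "ennreal (exp (- lam * h) * v lam (\<gamma> h)) = ennreal (exp (- lam * h)) * ennreal (v lam (\<gamma> h))"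
    using value_nonneg[OF lam] by (simp add: ennreal_mult)
  also have "\<dots> \<le> ennreal (exp (- lam * h)) * cost lam ?g ?w {0..}"
    by (intro mult_left_mono value_le[OF lam adm]) auto
  also have "\<dots> = (\<integral>\<^sup>+t. ennreal (exp (- lam * h)) * (ennreal (exp (- lam * t) * L (?g t, ?w t)) * indicator {0..} t) \<partial>lebesgue)"
    unfolding cost_def
    by (intro nn_integral_cmult[symmetric] borel_measurable_ennreal_indicator[OF admissible_L_measurable[OF adm]]) auto
  also have "\<dots> = (\<integral>\<^sup>+t. ennreal (exp (- lam * (t + h)) * L (\<gamma> (t + h), u (t + h))) * indicator {h..} (t + h) \<partial>lebesgue)"
  proof (rule nn_integral_cong)
    fix t
    have "exp (- lam * (t + h)) = exp (- lam * h) * exp (- lam * t)"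
      by (simp add: exp_add[symmetric] algebra_simps)
    then have "ennreal (exp (- lam * (t + h)) * L (\<gamma> (t + h), u (t + h))) =
       ennreal (exp (- lam * h)) * ennreal (exp (- lam * t) * L (\<gamma> (t + h), u (t + h)))"
      using L_nonneg by (simp add: ennreal_mult mult.assoc)
    then show "ennreal (exp (- lam * h)) * (ennreal (exp (- lam * t) * L (?g t, ?w t)) * indicator {0..} t) =
       ennreal (exp (- lam * (t + h)) * L (\<gamma> (t + h), u (t + h))) * indicator {h..} (t + h)"
      by (simp add: indicator_def)
  qed
  also have "\<dots> = cost lam \<gamma> u {h..}"
    unfolding cost_def using h
    by (intro nn_integral_shift[where H="\<lambda>t. ennreal (exp (- lam * t) * L (\<gamma> t, u t)) * indicator {h..} t"]
        borel_measurable_ennreal_indicator[OF admissible_L_measurable[OF \<gamma>]]) auto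
  also have "\<dots> = cost lam \<gamma> u {h<..}"
    unfolding cost_def
  proof (rule nn_integral_cong_AE, rule AE_lebesgue_negligibleI[of "{h}"])
    fix t assume "t \<notin> {h}"
    then have "indicator {h..} t = (indicator {h<..} t :: ennreal)" by (auto simp: indicator_def)
    then show "ennreal (exp (- lam * t) * L (\<gamma> t, u t)) * indicator {h..} t = ennreal (exp (- lam * t) * L (\<gamma> t, u t)) * indicator {h<..} t"
      by simp
  qed simp
  finally show ?thesis
    unfolding cost_split[OF admissible_L_measurable[OF \<gamma>] h] by (rule add_left_mono)
qed

end

section \<open>Estimates uniform in the discount and the limit function\<close>

context control_problem
begin

lemma cost_le_bounded_control:
  assumes \<gamma>: "\<And>t. t \<in> {0..s} \<Longrightarrow> norm (\<gamma> t) \<le> R" and R: "R \<ge> 0" and s: "s \<ge> 0"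
  shows "cost 0 \<gamma> (\<lambda>_. w) {0..s} \<le> ennreal (B R * (1 + (norm w)\<^sup>2) * s)"
proof -
  have "cost 0 \<gamma> (\<lambda>_. w) {0..s} \<le> (\<integral>\<^sup>+t. ennreal (B R * (1 + (norm w)\<^sup>2)) * indicator {0..s} t \<partial>lebesgue)"
    unfolding cost_def using \<gamma> L_upper[of _ R w]
    by (intro nn_integral_mono) (auto simp: indicator_def intro!: ennreal_leI)
  also have "\<dots> = ennreal (B R * (1 + (norm w)\<^sup>2)) * emeasure lebesgue {0..s}"
    by (rule nn_integral_cmult_indicator) simp
  also have "\<dots> = ennreal (B R * (1 + (norm w)\<^sup>2) * s)"
    using s B_nonneg[OF R] by (simp add: ennreal_mult)
  finally show ?thesis .
qed

text \<open>The curves of \<open>chow_equicontinuous\<close> are driven by plus or minus a unit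
  vector; with \<open>1 + (norm u)^2 = 2\<close> their cost per unit time is at most
  \<open>B R' * 2\<close>, whatever \<open>lam\<close> is.\<close>

lemma value_equicontinuous:
  assumes \<epsilon>: "\<epsilon> > 0"
  shows "\<exists>\<delta>>0. \<forall>lam>0. \<forall>y. norm (y - x0) \<le> \<delta> \<longrightarrow> \<bar>v lam y - v lam x0\<bar> \<le> \<epsilon>"
proof -
  have "\<exists>\<delta>>0. \<forall>w\<in>{v lam | lam. lam > 0}. \<forall>y. norm (y - x0) \<le> \<delta> \<longrightarrow> \<bar>w y - w x0\<bar> \<le> \<epsilon>"
  proof (rule chow_equicontinuous[OF smooth_f chow _ \<epsilon>])
    fix R :: real
    define R' where "R' = max R 0"
    have R': "R' \<ge> 0" "R \<le> R'" by (auto simp: R'_def)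
    show "\<exists>C\<ge>0. \<forall>w\<in>{v lam | lam. lam > 0}. \<forall>i c \<gamma> s. c \<in> {-1, 1} \<longrightarrow> 0 < s \<longrightarrow> s \<le> 1 \<longrightarrow>
       (\<forall>t\<in>{0..s}. norm (\<gamma> t) \<le> R \<and> (\<gamma> has_vector_derivative c *\<^sub>R f i (\<gamma> t)) (at t within {0..s})) \<longrightarrow>
       w (\<gamma> 0) \<le> w (\<gamma> s) + C * s"
    proof (intro exI[of _ "B R' * 2"] conjI ballI allI impI)
      show "B R' * 2 \<ge> 0" using B_nonneg[OF R'(1)] by simp
      fix w i c \<gamma> s
      assume "w \<in> {v lam | lam. lam > 0}" and c: "c \<in> {-1, 1 :: real}" and s: "0 < s" "s \<le> (1::real)"
        and \<gamma>: "\<forall>t\<in>{0..s}. norm (\<gamma> t) \<le> R \<and> (\<gamma> has_vector_derivative c *\<^sub>R f i (\<gamma> t)) (at t within {0..s})"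
      then obtain lam where lam: "lam > 0" "w = v lam" by blast
      let ?u = "c *\<^sub>R axis i (1::real)"
      have u: "velocity f x ?u = c *\<^sub>R f i x" for x
      proof -
        have "velocity f x ?u = (\<Sum>j\<in>UNIV. if j = i then c *\<^sub>R f i x else 0)"
          unfolding velocity_sum by (rule sum.cong) (auto simp: axis_def)
        then show ?thesis by simp
      qed
      have nu: "(norm ?u)\<^sup>2 = 1" using c by (auto simp: norm_axis_1)
      have traj: "(\<gamma>, \<lambda>_. ?u) \<in> trajectories f 0 s"
        using \<gamma> by (intro trajectories_C1 smooth_continuous[OF smooth_f]) (simp add: u)
      have "cost 0 \<gamma> (\<lambda>_. ?u) {0..s} \<le> ennreal (B R' * (1 + (norm ?u)\<^sup>2) * s)"
      proof (rule cost_le_bounded_control)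
        show "norm (\<gamma> t) \<le> R'" if "t \<in> {0..s}" for t
          using bspec[OF \<gamma> that] R' by linarith
      qed (use R' s in auto)
      then have "cost 0 \<gamma> (\<lambda>_. ?u) {0..s} \<le> ennreal (B R' * 2 * s)" unfolding nu by simp
      from dpp_upper[OF lam(1) s(1) traj this]
      show "w (\<gamma> 0) \<le> w (\<gamma> s) + B R' * 2 * s"
        using B_nonneg[OF R'(1)] s by (simp add: lam)
    qed
  qed
  then show ?thesis by blast
qed

lemma value_xstar: "lam > 0 \<Longrightarrow> v lam xstar = 0"
  using value_le[OF _ constant_admissible[of xstar], of lam] value_nonneg[of lam xstar] L_star
  by (simp add: constant_cost)

lemma value_bounded: "\<exists>M. \<forall>lam>0. v lam x \<le> M"
proof -
  define S where "S = {x. \<exists>M. \<forall>lam>0. v lam x \<le> M}"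
  \<comment> \<open>Equicontinuity with tolerance 1 transfers a bound between nearby points for all
    \<open>lam\<close> at once, in both directions; this makes \<open>S\<close> open and
    closed.\<close>
  have near: "\<exists>\<delta>>0. \<forall>y. dist y x \<le> \<delta> \<longrightarrow> (y \<in> S \<longleftrightarrow> x \<in> S)" for x
  proof -
    obtain \<delta> where \<delta>: "\<delta> > 0" "\<And>lam y. lam > 0 \<Longrightarrow> norm (y - x) \<le> \<delta> \<Longrightarrow> \<bar>v lam y - v lam x\<bar> \<le> 1"
      using value_equicontinuous[of 1 x] by auto
    have "y \<in> S \<longleftrightarrow> x \<in> S" if "dist y x \<le> \<delta>" for y
    proof
      assume "y \<in> S"
      then obtain M where "\<And>lam. lam > 0 \<Longrightarrow> v lam y \<le> M" unfolding S_def by blast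
      then have "v lam x \<le> M + 1" if "lam > 0" for lam
        using \<delta>(2)[OF that, of y] \<open>dist y x \<le> \<delta>\<close> that by (fastforce simp: dist_norm abs_le_iff)
      then show "x \<in> S" unfolding S_def by blast
    next
      assume "x \<in> S"
      then obtain M where "\<And>lam. lam > 0 \<Longrightarrow> v lam x \<le> M" unfolding S_def by blast
      then have "v lam y \<le> M + 1" if "lam > 0" for lam
        using \<delta>(2)[OF that, of y] \<open>dist y x \<le> \<delta>\<close> that by (fastforce simp: dist_norm abs_le_iff)
      then show "y \<in> S" unfolding S_def by blast
    qed
    then show ?thesis using \<delta>(1) by blast
  qed
  have "open S" unfolding open_dist
  proof
    fix x assume "x \<in> S"
    with near[of x] show "\<exists>e>0. \<forall>y. dist y x < e \<longrightarrow> y \<in> S" by (meson less_imp_le)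
  qed
  moreover have "open (- S)" unfolding open_dist
  proof
    fix x assume "x \<in> - S"
    with near[of x] show "\<exists>e>0. \<forall>y. dist y x < e \<longrightarrow> y \<in> - S" by (meson ComplD ComplI less_imp_le)
  qed
  then have "closed S" by (simp add: closed_def)
  moreover have "xstar \<in> S" unfolding S_def using value_xstar by auto
  ultimately have "S = UNIV"
    using clopen[of S] by auto
  then show ?thesis unfolding S_def by auto
qed

definition discount :: "nat \<Rightarrow> real" where "discount n = 1 / real (Suc n)"

definition chi :: "real^'d \<Rightarrow> real" where "chi x = (SUP n. v (discount n) x)"

lemma discount: "discount n > 0" "decseq discount" "discount \<longlonglongrightarrow> 0"
proof -
  show "discount n > 0" by (simp add: discount_def)
  show "decseq discount" by (auto simp: discount_def decseq_def frac_le)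
  show "discount \<longlonglongrightarrow> 0" unfolding discount_def[abs_def] by (rule LIMSEQ_Suc[OF lim_1_over_n])
qed

lemma bdd_above_values: "bdd_above (range (\<lambda>n. v (discount n) x))"
  using value_bounded[of x] discount(1) by (auto simp: bdd_above_def)

lemma value_discount_le_chi: "v (discount n) x \<le> chi x"
  unfolding chi_def by (rule cSUP_upper[OF UNIV_I bdd_above_values])

lemma value_tendsto_chi: "(\<lambda>n. v (discount n) x) \<longlonglongrightarrow> chi x"
proof -
  have "incseq (\<lambda>n. v (discount n) x)"
    using discount(1) decseqD[OF discount(2)] by (auto simp: incseq_def intro: value_mono)
  then show ?thesis unfolding chi_def by (rule LIMSEQ_incseq_SUP[OF bdd_above_values])
qed

lemma chi_nonneg: "chi x \<ge> 0"
  using value_discount_le_chi[of 0 x] value_nonneg[OF discount(1), of 0 x] by simp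

lemma chi_xstar: "chi xstar = 0"
  unfolding chi_def using discount(1) by (simp add: value_xstar)

lemma chi_equicontinuous:
  assumes "\<epsilon> > 0"
  shows "\<exists>\<delta>>0. \<forall>y. norm (y - x0) \<le> \<delta> \<longrightarrow> \<bar>chi y - chi x0\<bar> \<le> \<epsilon> \<and> (\<forall>lam>0. \<bar>v lam y - v lam x0\<bar> \<le> \<epsilon>)"
proof -
  obtain \<delta> where \<delta>: "\<delta> > 0" "\<And>lam y. lam > 0 \<Longrightarrow> norm (y - x0) \<le> \<delta> \<Longrightarrow> \<bar>v lam y - v lam x0\<bar> \<le> \<epsilon>"
    using value_equicontinuous[OF assms, of x0] by auto
  have "\<bar>chi y - chi x0\<bar> \<le> \<epsilon>" if "norm (y - x0) \<le> \<delta>" for y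
  proof (rule tendsto_upperbound)
    show "(\<lambda>n. \<bar>v (discount n) y - v (discount n) x0\<bar>) \<longlonglongrightarrow> \<bar>chi y - chi x0\<bar>"
      by (intro tendsto_intros value_tendsto_chi)
    show "\<forall>\<^sub>F n in sequentially. \<bar>v (discount n) y - v (discount n) x0\<bar> \<le> \<epsilon>"
      using \<delta>(2)[OF discount(1) that] by simp
  qed simp
  then show ?thesis using \<delta> by blast
qed

lemma chi_continuous: "continuous_on UNIV chi"
proof (rule continuous_onI)
  fix x :: "real^'d" and e :: real assume "e > 0"
  then obtain \<delta> where "\<delta> > 0" "\<And>y. norm (y - x) \<le> \<delta> \<Longrightarrow> \<bar>chi y - chi x\<bar> \<le> e"
    using chi_equicontinuous by blast
  then show "\<exists>d>0. \<forall>x'\<in>UNIV. dist x' x < d \<longrightarrow> dist (chi x') (chi x) \<le> e"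
    by (intro exI[of _ \<delta>]) (auto simp: dist_norm)
qed

text \<open>Pointwise convergence at the centres of a finite cover is spread by the equicontinuity
  that \<open>chi\<close> shares with all \<open>v lam\<close>; three quarters of \<open>e\<close>
  are spent.\<close>

lemma uniform_limit_chi:
  assumes "compact S"
  shows "uniform_limit S (\<lambda>n. v (discount n)) chi sequentially"
proof (rule uniform_limitI)
  fix e :: real assume "e > 0"
  then have e4: "e / 4 > 0" by simp
  have "\<forall>x. \<exists>\<delta>>0. \<forall>y. norm (y - x) \<le> \<delta> \<longrightarrow> \<bar>chi y - chi x\<bar> \<le> e / 4 \<and> (\<forall>lam>0. \<bar>v lam y - v lam x\<bar> \<le> e / 4)"
    using chi_equicontinuous[OF e4] by blast
  from choice[OF this] obtain \<delta> where \<delta>: "\<And>x. \<delta> x > 0"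
    "\<And>x y. norm (y - x) \<le> \<delta> x \<Longrightarrow> \<bar>chi y - chi x\<bar> \<le> e / 4 \<and> (\<forall>lam>0. \<bar>v lam y - v lam x\<bar> \<le> e / 4)"
    by blast
  obtain T where T: "T \<subseteq> S" "finite T" "S \<subseteq> (\<Union>x\<in>T. ball x (\<delta> x))"
  proof (rule compactE_image[OF assms, of S "\<lambda>x. ball x (\<delta> x)"])
    show "S \<subseteq> (\<Union>x\<in>S. ball x (\<delta> x))" using \<delta>(1) by auto
  qed auto
  have "\<forall>\<^sub>F n in sequentially. \<forall>x\<in>T. dist (v (discount n) x) (chi x) < e / 4"
    by (intro eventually_ball_finite[OF T(2)] ballI tendstoD[OF value_tendsto_chi e4])
  then show "\<forall>\<^sub>F n in sequentially. \<forall>y\<in>S. dist (v (discount n) y) (chi y) < e"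
  proof (rule eventually_mono, intro ballI)
    fix n y assume n: "\<forall>x\<in>T. dist (v (discount n) x) (chi x) < e / 4" and "y \<in> S"
    then obtain x where x: "x \<in> T" "norm (y - x) \<le> \<delta> x"
      using T(3) by (auto simp: dist_norm norm_minus_commute less_imp_le)
    have "\<bar>chi y - chi x\<bar> \<le> e / 4" "\<bar>v (discount n) y - v (discount n) x\<bar> \<le> e / 4"
      using \<delta>(2)[OF x(2)] discount(1) by auto
    moreover have "\<bar>v (discount n) x - chi x\<bar> < e / 4" using n x(1) by (simp add: dist_real_def)
    ultimately show "dist (v (discount n) y) (chi y) < e" unfolding dist_real_def by linarith
  qed
qed

lemma chi_dpp_upper:
  assumes \<tau>: "\<tau> > 0" and \<gamma>: "(\<gamma>, u) \<in> trajectories f 0 \<tau>"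
    and C: "cost 0 \<gamma> u {0..\<tau>} \<le> ennreal C" "C \<ge> 0"
  shows "chi (\<gamma> 0) \<le> C + chi (\<gamma> \<tau>)"
proof (rule LIMSEQ_le)
  show "(\<lambda>n. v (discount n) (\<gamma> 0)) \<longlonglongrightarrow> chi (\<gamma> 0)" by (rule value_tendsto_chi)
  show "(\<lambda>n. C + v (discount n) (\<gamma> \<tau>)) \<longlonglongrightarrow> C + chi (\<gamma> \<tau>)" by (intro tendsto_intros value_tendsto_chi)
  show "\<exists>N. \<forall>n\<ge>N. v (discount n) (\<gamma> 0) \<le> C + v (discount n) (\<gamma> \<tau>)"
    using dpp_upper[OF discount(1) \<tau> \<gamma> C] by blast
qed

text \<open>Passing to the limit here would call for compactness of trajectories. Instead one
  \<open>lam\<close> is kept, small enough that \<open>v lam\<close> is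
  \<open>\<delta>\<close>-close to \<open>chi\<close> on the ball; on the right,
  \<open>v lam x \<le> chi x\<close> replaces the value by \<open>chi\<close>.\<close>

lemma chi_dpp_lower:
  assumes h: "h > 0" and \<delta>: "\<delta> > 0"
  shows "\<exists>lam \<gamma> u. lam > 0 \<and> lam \<le> \<delta> \<and> \<gamma> 0 = x \<and> (\<gamma>, u) \<in> trajectories f 0 h \<and>
    cost lam \<gamma> u {0..h} + ennreal (exp (- lam * h) * v lam (\<gamma> h)) \<le> ennreal (chi x + \<delta>) \<and>
    (\<forall>y\<in>cball 0 R. \<bar>v lam y - chi y\<bar> \<le> \<delta>)"
proof -
  have "\<forall>\<^sub>F n in sequentially. \<forall>y\<in>cball 0 R. dist (v (discount n) y) (chi y) < \<delta>"
    by (rule uniform_limitD[OF uniform_limit_chi \<delta>]) simp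
  moreover have "\<forall>\<^sub>F n in sequentially. discount n < \<delta>"
    using order_tendstoD(2)[OF discount(3) \<delta>] .
  ultimately have "\<forall>\<^sub>F n in sequentially. (\<forall>y\<in>cball 0 R. dist (v (discount n) y) (chi y) < \<delta>) \<and> discount n < \<delta>"
    by (rule eventually_conj)
  then obtain n where n: "\<forall>y\<in>cball 0 R. dist (v (discount n) y) (chi y) < \<delta>" "discount n < \<delta>"
    by (auto dest: eventually_happens)
  obtain \<gamma> u where \<gamma>: "(\<gamma>, u) \<in> admissible (discount n) x" "cost (discount n) \<gamma> u {0..} \<le> ennreal (v (discount n) x + \<delta>)"
    using value_near[OF discount(1) \<delta>] by blast
  have "ennreal (v (discount n) x + \<delta>) \<le> ennreal (chi x + \<delta>)"
    using value_discount_le_chi by (intro ennreal_leI) simp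
  then have "cost (discount n) \<gamma> u {0..h} + ennreal (exp (- discount n * h) * v (discount n) (\<gamma> h)) \<le> ennreal (chi x + \<delta>)"
    using dpp_lower[OF discount(1) h \<gamma>(1)] \<gamma>(2) by order
  then show ?thesis
    using n \<gamma> discount(1) admissible_start[OF \<gamma>(1)] admissible_trajectory[OF \<gamma>(1) h]
    by (intro exI[of _ "discount n"] exI[of _ \<gamma>] exI[of _ u]) (auto simp: dist_real_def less_imp_le)
qed

end

subsection \<open>The ergodic equation\<close>

context control_problem
begin

text \<open>Following the integral curve of a constant control \<open>u\<close> for time
  \<open>s\<close>, the dynamic programming principle and the local maximum give \<open>\<phi>
  (\<gamma> s) - \<phi> x \<ge> - (L (x, u) + \<eta>) * s\<close>. Division by \<open>s\<close>
  yields the inequality for this \<open>u\<close>, and \<open>u\<close> is arbitrary.\<close>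

lemma chi_viscosity_subsolution: "viscosity_subsolution (\<lambda>x p. hamiltonian f L x (- p)) chi"
  unfolding viscosity_subsolution_def
proof (intro allI impI)
  fix \<phi> :: "real^'d \<Rightarrow> real" and x p
  assume \<phi>: "Ck 1 \<phi>" and p: "GDERIV \<phi> x :> p" and max: "\<forall>\<^sub>F y in nhds x. chi y - \<phi> y \<le> chi x - \<phi> x"
  show "hamiltonian f L x (- p) \<le> 0"
    unfolding hamiltonian_def
  proof (rule SUP_least)
    fix u :: "real^'m"
    let ?a = "p \<bullet> velocity f x u"
    \<comment> \<open>\<open>local_flows_exist\<close> expects a family with opposite fields; here
      it is the field of the control \<open>u\<close> and its negative.\<close>
    define F where "F b y = (if b then velocity f y u else - velocity f y u)" for b :: bool and y
    have sm: "smooth (\<lambda>y. velocity f y u)"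
      unfolding velocity_sum by (intro smooth_sum smooth_scaleR smooth_f)
    then have "smooth (F b)" for b
      unfolding F_def[abs_def] using smooth_minus by (cases b) auto
    then have C1: "Ck (Suc 0) (F b)" for b by (rule smooth_Ck)
    define R where "R = norm x + 1"
    have R0: "R \<ge> 0" by (simp add: R_def)
    have "F (\<not> b) y = - F b y" for b y by (simp add: F_def)
    from local_flows_exist[of F Not R, OF C1 this R0] obtain h M \<Phi> where hM: "h > 0" "M \<ge> 0"
      and 0: "\<forall>l y. \<Phi> l 0 y = y"
      and lip: "\<forall>l y y'. \<forall>s\<in>{0..h}. \<forall>t\<in>{0..h}. norm (\<Phi> l s y - \<Phi> l t y') \<le> M * \<bar>s - t\<bar> + 2 * norm (y - y')"
      and der: "\<forall>l y. \<forall>t\<in>{0..h}. \<Phi> l t y \<in> cball 0 R \<longrightarrow>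
        ((\<lambda>t. \<Phi> l t y) has_vector_derivative F l (\<Phi> l t y)) (at t within {0..h})"
      by blast
    define \<gamma> where "\<gamma> t = \<Phi> True t x" for t
    have \<gamma>0: "\<gamma> 0 = x" by (simp add: \<gamma>_def 0)
    have near: "norm (\<gamma> t - x) \<le> M * t" if "t \<in> {0..h}" for t
      using that hM lip[rule_format, of t 0 True x x] by (simp add: \<gamma>_def 0)
    \<comment> \<open>Up to time \<open>h1\<close> the curve stays in the ball of radius
      \<open>R\<close>, where it obeys the original equation.\<close>
    define h1 where "h1 = min h (1 / (M + 1))"
    have h1: "h1 > 0" "h1 \<le> h" "M * h1 \<le> 1"
    proof -
      show "h1 > 0" "h1 \<le> h" using hM by (auto simp: h1_def)
      have "h1 * (M + 1) \<le> 1" using hM by (simp add: pos_le_divide_eq[symmetric] h1_def)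
      then show "M * h1 \<le> 1" using \<open>h1 > 0\<close> by (simp add: algebra_simps)
    qed
    have stay: "norm (\<gamma> t) \<le> R" if "t \<in> {0..h1}" for t
    proof -
      have "M * t \<le> M * h1" using that hM by (intro mult_left_mono) auto
      then show ?thesis
        using near[of t] that h1 norm_triangle_ineq[of "\<gamma> t - x" x] by (simp add: R_def)
    qed
    have der1: "(\<gamma> has_vector_derivative velocity f (\<gamma> t) u) (at t within {0..s})" if "t \<in> {0..s}" "s \<le> h1" for t s
    proof -
      have "((\<lambda>t. \<Phi> True t x) has_vector_derivative F True (\<Phi> True t x)) (at t within {0..h})"
        using der stay[of t] that h1 by (simp add: \<gamma>_def)
      then show ?thesis
        using that h1 by (auto simp: F_def \<gamma>_def[abs_def] intro: has_vector_derivative_within_subset)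
    qed
    have traj: "(\<gamma>, \<lambda>_. u) \<in> trajectories f 0 s" if "s \<le> h1" for s
      by (rule trajectories_C1[OF der1[OF _ that] smooth_continuous[OF smooth_f]])
    have tend: "((\<lambda>t. (\<phi> (\<gamma> t) - \<phi> x) / t) \<longlongrightarrow> ?a) (at_right 0)"
    proof -
      have "(\<gamma> has_derivative (\<lambda>r. r *\<^sub>R velocity f x u)) (at 0 within {0..h1})"
        using der1[of 0 h1] h1 \<gamma>0 by (simp add: has_vector_derivative_def)
      moreover have "(\<phi> has_derivative (\<lambda>v. v \<bullet> p)) (at (\<gamma> 0))"
        using p \<gamma>0 by (simp add: gderiv_def)
      ultimately have "((\<lambda>t. \<phi> (\<gamma> t)) has_derivative (\<lambda>r. (r *\<^sub>R velocity f x u) \<bullet> p)) (at 0 within {0..h1})"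
        by (rule has_derivative_compose)
      then have "((\<lambda>t. \<phi> (\<gamma> t)) has_real_derivative ?a) (at 0 within {0..h1})"
        by (simp add: has_field_derivative_def inner_commute mult_commute_abs)
      then show ?thesis
        using h1 \<gamma>0 by (simp add: has_field_derivative_iff at_within_Icc_at_right)
    qed
    have main: "- L (x, u) - \<eta> \<le> ?a" if \<eta>: "\<eta> > 0" for \<eta>
    proof (rule tendsto_lowerbound[OF tend])
      have "continuous_on UNIV (\<lambda>y. L (y, u))"
        by (intro continuous_on_compose2[OF L_cont] continuous_intros) auto
      then have "isCont (\<lambda>y. L (y, u)) x" by (simp add: continuous_on_eq_continuous_at)
      then obtain e1 where e1: "e1 > 0" "\<And>y. dist y x < e1 \<Longrightarrow> dist (L (y, u)) (L (x, u)) < \<eta>"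
        unfolding continuous_at_eps_delta using \<eta> by blast
      obtain e2 where e2: "e2 > 0" "\<And>y. dist y x < e2 \<Longrightarrow> chi y - \<phi> y \<le> chi x - \<phi> x"
        using max unfolding eventually_nhds_metric by blast
      define e where "e = min e1 e2"
      have e: "e > 0" using e1 e2 by (simp add: e_def)
      define s0 where "s0 = min h1 (e / (M + 1))"
      have s0: "s0 > 0" using h1 e hM by (simp add: s0_def)
      have "- L (x, u) - \<eta> \<le> (\<phi> (\<gamma> s) - \<phi> x) / s" if s: "0 < s" "s < s0" for s
      proof -
        have sh: "s \<le> h1" using s by (simp add: s0_def)
        have close: "dist (\<gamma> t) x < e" if "t \<in> {0..s}" for t
        proof -
          have "norm (\<gamma> t - x) \<le> M * t" using near[of t] that sh h1 by simp
          also have "\<dots> \<le> M * s" using that hM by (intro mult_left_mono) auto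
          also have "\<dots> < (M + 1) * s" using s by (simp add: algebra_simps)
          also have "\<dots> \<le> e"
          proof -
            have "s \<le> e / (M + 1)" using s by (simp add: s0_def)
            then have "s * (M + 1) \<le> e" using hM by (subst (asm) pos_le_divide_eq) auto
            then show ?thesis by (simp add: mult.commute)
          qed
          finally show ?thesis by (simp add: dist_norm)
        qed
        have Lle: "L (\<gamma> t, u) \<le> L (x, u) + \<eta>" if "t \<in> {0..s}" for t
          using e1(2)[of "\<gamma> t"] close[OF that] by (simp add: e_def dist_real_def)
        have "cost 0 \<gamma> (\<lambda>_. u) {0..s} \<le> (\<integral>\<^sup>+t. ennreal (L (x, u) + \<eta>) * indicator {0..s} t \<partial>lebesgue)"
          unfolding cost_def using Lle
          by (intro nn_integral_mono) (auto simp: indicator_def intro!: ennreal_leI)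
        also have "\<dots> = ennreal (L (x, u) + \<eta>) * emeasure lebesgue {0..s}"
          by (rule nn_integral_cmult_indicator) simp
        also have "\<dots> = ennreal ((L (x, u) + \<eta>) * s)"
          using s L_nonneg[of x u] \<eta> by (simp add: ennreal_mult)
        finally have "chi (\<gamma> 0) \<le> (L (x, u) + \<eta>) * s + chi (\<gamma> s)"
          using s L_nonneg[of x u] \<eta> by (intro chi_dpp_upper[OF _ traj[OF sh]]) auto
        moreover have "chi (\<gamma> s) - \<phi> (\<gamma> s) \<le> chi x - \<phi> x"
          using e2(2)[of "\<gamma> s"] close[of s] s by (simp add: e_def)
        ultimately have "(- L (x, u) - \<eta>) * s \<le> \<phi> (\<gamma> s) - \<phi> x"
          using \<gamma>0 by (simp add: algebra_simps)
        then show ?thesis using s by (simp add: pos_le_divide_eq)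
      qed
      then show "\<forall>\<^sub>F s in at_right 0. - L (x, u) - \<eta> \<le> (\<phi> (\<gamma> s) - \<phi> x) / s"
        unfolding eventually_at_right_field using s0 by blast
    qed simp
    have "- L (x, u) \<le> ?a"
    proof (rule field_le_epsilon)
      show "- L (x, u) \<le> ?a + \<eta>" if "\<eta> > 0" for \<eta> using main[OF that] by linarith
    qed
    then have "- p \<bullet> velocity f x u - L (x, u) \<le> 0" unfolding inner_minus_left by linarith
    then show "ereal (- p \<bullet> velocity f x u - L (x, u)) \<le> 0" by (simp only: zero_ereal_def ereal_less_eq)
  qed
qed

lemma cost_finite_integral:
  assumes \<gamma>: "(\<gamma>, u) \<in> trajectories f 0 h" and fin: "cost lam \<gamma> u {0..h} < \<infinity>"
  shows "(\<lambda>t. exp (- lam * t) * L (\<gamma> t, u t)) integrable_on {0..h}"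
    and "cost lam \<gamma> u {0..h} = ennreal (integral {0..h} (\<lambda>t. exp (- lam * t) * L (\<gamma> t, u t)))"
proof -
  let ?G = "\<lambda>t. exp (- lam * t) * L (\<gamma> t, u t)"
  have meas: "(\<lambda>t. indicator {0..h} t *\<^sub>R ?G t) \<in> borel_measurable lebesgue"
    using L_measurable[OF \<gamma>, of lam] measurable_lebesgue_on_iff[of "{0..h}" ?G] by simp
  have eq: "cost lam \<gamma> u {0..h} = (\<integral>\<^sup>+t. ennreal (indicator {0..h} t *\<^sub>R ?G t) \<partial>lebesgue)"
    unfolding cost_def by (intro nn_integral_cong) (auto simp: indicator_def)
  have int: "integrable lebesgue (\<lambda>t. indicator {0..h} t *\<^sub>R ?G t)"
    using fin L_nonneg unfolding eq by (intro integrableI_nonneg meas) auto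
  then have si: "set_integrable lebesgue {0..h} ?G" by (simp add: set_integrable_def)
  show "?G integrable_on {0..h}" by (rule set_lebesgue_integral_eq_integral(1)[OF si])
  have "cost lam \<gamma> u {0..h} = ennreal (LINT t|lebesgue. indicator {0..h} t *\<^sub>R ?G t)"
    unfolding eq using L_nonneg by (intro nn_integral_eq_integral int) auto
  then show "cost lam \<gamma> u {0..h} = ennreal (integral {0..h} ?G)"
    using set_lebesgue_integral_eq_integral(2)[OF si] by (simp add: set_lebesgue_integral_def)
qed

text \<open>The bound \<open>\<eta>\<close> is weak for large controls and coercivity is weak for
  small ones; a convex combination of the two provides both terms of
  \<open>c0 * (1 + (norm u)\<^sup>2)\<close>.\<close>

lemma coercive_lower_bound:
  assumes \<eta>: "\<eta> > 0" and pos: "\<And>u. \<eta> \<le> p \<bullet> velocity f x u + L (x, u)"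
  shows "\<exists>c0>0. \<forall>u. c0 * (1 + (norm u)\<^sup>2) \<le> p \<bullet> velocity f x u + L (x, u)"
proof -
  define P where "P = norm p * (velocity_bound TYPE('m) c * (1 + norm x))"
  \<comment> \<open>The price of completing the square in
    \<open>P * norm u \<le> \<kappa> / 2 * (norm u)\<^sup>2 + D\<close>.\<close>
  define D where "D = P\<^sup>2 / (2 * \<kappa>)"
  have D: "D \<ge> 0" using \<kappa> by (simp add: D_def)
  define N where "N = \<eta> + D"
  have N: "N > 0" "\<eta> \<le> N" using \<eta> D by (auto simp: N_def)
  \<comment> \<open>The weight of the coercive bound, chosen with
    \<open>\<theta> * (\<eta> + D) = \<eta> / 2\<close> so that half of \<open>\<eta>\<close>
    survives.\<close>
  define \<theta> where "\<theta> = \<eta> / (2 * N)"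
  have \<theta>: "0 < \<theta>" "\<theta> \<le> 1" using \<eta> N by (auto simp: \<theta>_def divide_simps)
  have "\<theta> * N = \<eta> / 2" using N by (simp add: \<theta>_def)
  then have \<theta>_eq: "\<theta> * (\<eta> + D) = \<eta> / 2" by (simp add: N_def)
  define c0 where "c0 = min (\<eta> / 2) (\<theta> * \<kappa> / 2)"
  have "c0 * (1 + (norm u)\<^sup>2) \<le> p \<bullet> velocity f x u + L (x, u)" for u
  proof -
    let ?\<psi> = "p \<bullet> velocity f x u + L (x, u)"
    have "\<bar>p \<bullet> velocity f x u\<bar> \<le> norm p * norm (velocity f x u)" by (rule Cauchy_Schwarz_ineq2)
    also have "\<dots> \<le> norm p * (velocity_bound TYPE('m) c * (1 + norm x) * norm u)"
      by (intro mult_left_mono norm_velocity[OF growth c]) auto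
    finally have 1: "\<bar>p \<bullet> velocity f x u\<bar> \<le> P * norm u" by (simp add: P_def mult_ac)
    have "0 \<le> (\<kappa> * norm u - P)\<^sup>2 / (2 * \<kappa>)" using \<kappa> by simp
    also have "(\<kappa> * norm u - P)\<^sup>2 / (2 * \<kappa>) = \<kappa> / 2 * (norm u)\<^sup>2 - P * norm u + D"
      using \<kappa> by (simp add: D_def power2_eq_square field_simps)
    finally have "P * norm u \<le> \<kappa> / 2 * (norm u)\<^sup>2 + D" by simp
    then have 2: "\<kappa> / 2 * (norm u)\<^sup>2 - D \<le> ?\<psi>"
      using 1 L_lower[of u x] by (simp add: abs_le_iff)
    have "c0 * (1 + (norm u)\<^sup>2) \<le> \<eta> / 2 + \<theta> * \<kappa> / 2 * (norm u)\<^sup>2"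
    proof -
      have "c0 * (norm u)\<^sup>2 \<le> \<theta> * \<kappa> / 2 * (norm u)\<^sup>2" by (intro mult_right_mono) (auto simp: c0_def)
      then show ?thesis by (simp add: distrib_left c0_def)
    qed
    also have "\<dots> = \<theta> * (\<kappa> / 2 * (norm u)\<^sup>2 - D) + (1 - \<theta>) * \<eta>"
      using \<theta>_eq by (simp add: algebra_simps)
    also have "\<dots> \<le> \<theta> * ?\<psi> + (1 - \<theta>) * ?\<psi>"
      using 2 pos[of u] \<theta> by (intro add_mono mult_left_mono) auto
    finally show ?thesis by (simp add: algebra_simps)
  qed
  then show ?thesis using \<eta> \<theta> \<kappa> by (intro exI[of _ c0]) (auto simp: c0_def)
qed

text \<open>If the Hamiltonian were negative, \<open>coercive_lower_bound\<close> would give a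
  surplus \<open>c0 * (1 + (norm u)\<^sup>2)\<close>, which absorbs all errors proportional to
  \<open>1 + (norm u)\<^sup>2\<close>: from moving the base point in \<open>\<phi>\<close>, from
  moving it in \<open>L\<close>, and from the discount. Integrated over \<open>{0..h}\<close>, what
  is left exceeds the error permitted by \<open>chi_dpp_lower\<close>. The radius \<open>r\<close>
  comes first, then \<open>h\<close> so that the trajectory stays within \<open>r\<close>, and last
  the tolerance \<open>\<delta>\<close>.\<close>

lemma chi_viscosity_supersolution: "viscosity_supersolution (\<lambda>x p. hamiltonian f L x (- p)) chi"
  unfolding viscosity_supersolution_def
proof (intro allI impI, rule ccontr)
  fix \<phi> :: "real^'d \<Rightarrow> real" and x p
  assume \<phi>: "Ck 1 \<phi>" and p: "GDERIV \<phi> x :> p" and min: "\<forall>\<^sub>F y in nhds x. chi y - \<phi> y \<ge> chi x - \<phi> x"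
    and neg: "\<not> hamiltonian f L x (- p) \<ge> 0"
  have \<phi>1: "Ck (Suc 0) \<phi>" using \<phi> by simp
  have "hamiltonian f L x (- p) < ereal 0" using neg by (simp add: not_le zero_ereal_def[symmetric])
  then obtain r0 where r0: "hamiltonian f L x (- p) < ereal r0" "r0 < 0"
    using ereal_dense2 by force
  have pos: "- r0 \<le> p \<bullet> velocity f x u + L (x, u)" for u
  proof -
    have "ereal (- p \<bullet> velocity f x u - L (x, u)) \<le> hamiltonian f L x (- p)"
      unfolding hamiltonian_def by (rule SUP_upper) simp
    then have "ereal (- p \<bullet> velocity f x u - L (x, u)) < ereal r0" using r0 by order
    then show ?thesis by simp
  qed
  obtain c0 where c0: "c0 > 0" "\<And>u. c0 * (1 + (norm u)\<^sup>2) \<le> p \<bullet> velocity f x u + L (x, u)"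
    using coercive_lower_bound[OF _ pos] r0 by auto
  have Dx: "frechet_derivative \<phi> (at x) v = p \<bullet> v" for v
  proof -
    have "(\<lambda>v. v \<bullet> p) = frechet_derivative \<phi> (at x)"
      by (rule frechet_derivative_at) (use p in \<open>simp add: gderiv_def\<close>)
    from fun_cong[OF this, of v] show ?thesis by (simp add: inner_commute)
  qed
  have linD: "linear (frechet_derivative \<phi> (at y))" for y
    by (rule has_derivative_linear[OF Ck_Suc_has_derivative[OF \<phi>1]])
  have D_sum: "frechet_derivative \<phi> (at y) (velocity f y u) = (\<Sum>i\<in>UNIV. u $ i * lie_derivative (f i) \<phi> y)" for y u
    unfolding velocity_sum by (simp add: linear_sum[OF linD] linear_scale[OF linD] lie_derivative_def)
  \<comment> \<open>\<open>norm u * S y\<close> bounds the change of the derivative of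
    \<open>\<phi>\<close> along the velocity when the base point moves from \<open>x\<close> to
    \<open>y\<close>.\<close>
  define S where "S y = (\<Sum>i\<in>UNIV. \<bar>lie_derivative (f i) \<phi> y - lie_derivative (f i) \<phi> x\<bar>)" for y
  have "continuous_on UNIV (lie_derivative (f i) \<phi>)" for i
    using lie_derivative_Ck[OF smooth_Ck[OF smooth_f] \<phi>1, of i] by simp
  then have "continuous_on UNIV S" unfolding S_def by (intro continuous_intros)
  then have "isCont S x" by (simp add: continuous_on_eq_continuous_at)
  moreover have "S x = 0" by (simp add: S_def)
  moreover have "c0 / 4 > 0" using c0 by simp
  ultimately obtain r1 where r1: "r1 > 0" "\<And>y. dist y x < r1 \<Longrightarrow> \<bar>S y\<bar> < c0 / 4"
    unfolding continuous_at_eps_delta by (metis diff_0_right dist_real_def)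
  obtain r2 where r2: "r2 > 0" "\<And>y. dist y x < r2 \<Longrightarrow> chi y - \<phi> y \<ge> chi x - \<phi> x"
    using min unfolding eventually_nhds_metric by blast
  \<comment> \<open>Within \<open>r = m / 2\<close> of \<open>x\<close>, the function
    \<open>S\<close> is small, the minimum condition holds, and \<open>L\<close> varies by at most
    \<open>c0 / 4 * (1 + (norm u)\<^sup>2)\<close>.\<close>
  define m where "m = min (min r1 r2) (c0 / (4 * l1))"
  have m: "m > 0" "m \<le> r1" "m \<le> r2" "m \<le> c0 / (4 * l1)" using r1 r2 c0 l1 by (auto simp: m_def)
  define r where "r = m / 2"
  have r: "r > 0" "r < r1" "r < r2" "l1 * r \<le> c0 / 4"
  proof -
    show "r > 0" "r < r1" "r < r2" using m unfolding r_def by linarith+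
    have "r \<le> c0 / (4 * l1)" using m unfolding r_def by linarith
    then have "l1 * r \<le> l1 * (c0 / (4 * l1))" using l1 by (intro mult_left_mono) auto
    then show "l1 * r \<le> c0 / 4" using l1 by simp
  qed
  define R where "R = norm x + r"
  have R: "R \<ge> 0" using r by (simp add: R_def)
  have "bounded (chi ` cball 0 R)"
    using chi_continuous by (intro compact_imp_bounded compact_continuous_image) (auto intro: continuous_on_subset)
  then obtain Mc where "Mc > 0" and Mc': "\<forall>y\<in>chi ` cball 0 R. norm y \<le> Mc"
    unfolding bounded_pos by blast
  then have Mc: "Mc > 0" "norm y \<le> R \<Longrightarrow> \<bar>chi y\<bar> \<le> Mc" for y by auto
  \<comment> \<open>A bound for the integral of \<open>(norm u)\<^sup>2\<close>: the discount factor
    is at least 1/2 on \<open>{0..h}\<close> and the cost is at most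
    \<open>chi x + 1\<close>.\<close>
  define E where "E = 2 * (chi x + 1) / \<kappa>"
  have E: "E > 0" unfolding E_def using chi_nonneg[of x] \<kappa> by simp
  let ?c = "velocity_bound TYPE('m) c"
  have velocity_bound: "?c > 0" by (rule velocity_bound_pos[OF growth c])
  define q where "q = ?c * (1 + (2 * norm x + 1))"
  have q: "q > 0" unfolding q_def using velocity_bound by (intro mult_pos_pos) (auto simp: add_pos_nonneg)
  \<comment> \<open>The budget for the integral of \<open>norm u\<close>: the first bound triggers
    \<open>trajectories_bounded\<close>, the second keeps the displacement at most
    \<open>r\<close>.\<close>
  define e where "e = min (1 / (2 * ?c)) (r / q)"
  have e: "e > 0" "?c * e \<le> 1 / 2" "q * e \<le> r"
  proof -
    show "e > 0" using q r velocity_bound by (simp add: e_def)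
    have "?c * e \<le> ?c * (1 / (2 * ?c))" using velocity_bound by (intro mult_left_mono) (auto simp: e_def)
    then show "?c * e \<le> 1 / 2" using velocity_bound by simp
    have "q * e \<le> q * (r / q)"
      using q by (intro mult_left_mono) (auto simp: e_def)
    then show "q * e \<le> r" using q by simp
  qed
  \<comment> \<open>By \<open>norm u \<le> a * (norm u)\<^sup>2 + 1 / (4 * a)\<close> the integral
    of \<open>norm u\<close> is at most \<open>a * E + h / (4 * a)\<close>; \<open>a\<close>, and
    then \<open>h\<close>, are chosen to make each term \<open>e / 2\<close>.\<close>
  define a where "a = e / (2 * E)"
  have a: "a > 0" "a * E = e / 2" using e E by (auto simp: a_def)
  define h where "h = 2 * a * e"
  have h: "h > 0" "h / (4 * a) = e / 2" using a e by (auto simp: h_def)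
  have BR: "B R \<ge> 0" by (rule B_nonneg[OF R])
  \<comment> \<open>The total error per unit of \<open>\<delta>\<close>: near-optimality, the
    distance of \<open>v lam\<close> from \<open>chi\<close>, and the discount applied to a value of
    at most \<open>Mc + 1\<close>.\<close>
  define K where "K = 2 + h * (Mc + 1)"
  have K: "K > 0" using h Mc by (simp add: K_def add_pos_pos)
  \<comment> \<open>The bound \<open>d2\<close> keeps the discount above 1/2, \<open>d3\<close>
    limits its effect on the running cost, and \<open>d4\<close> keeps the total error below the
    gain \<open>h * c0 / 4\<close>.\<close>
  define d2 d3 d4 where "d2 = 1 / (2 * h)" and "d3 = c0 / (4 * h * (B R + 1))" and "d4 = h * c0 / (8 * K)"
  have hB: "4 * h * (B R + 1) > 0" using h BR by simp
  have d: "d2 > 0" "d3 > 0" "d4 > 0" using h c0 K hB by (simp_all add: d2_def d3_def d4_def)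
  define \<delta> where "\<delta> = min (min 1 d2) (min d3 d4)"
  have \<delta>: "\<delta> > 0" "\<delta> \<le> 1" "\<delta> * h \<le> 1 / 2" "\<delta> * h * B R \<le> c0 / 4" "\<delta> * K < h * c0 / 4"
  proof -
    show pos: "\<delta> > 0" using d by (simp add: \<delta>_def)
    show "\<delta> \<le> 1" by (simp add: \<delta>_def)
    have "\<delta> \<le> d2" by (simp add: \<delta>_def)
    then have "\<delta> * h \<le> d2 * h" using h by (intro mult_right_mono) auto
    then show "\<delta> * h \<le> 1 / 2" using h by (simp add: d2_def)
    have "\<delta> \<le> d3" by (simp add: \<delta>_def)
    then have "\<delta> * (4 * h * (B R + 1)) \<le> c0" unfolding d3_def using hB by (subst (asm) pos_le_divide_eq)
    moreover have "\<delta> * (4 * h * (B R + 1)) = 4 * (\<delta> * h * B R) + 4 * (\<delta> * h)" by (simp add: algebra_simps)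
    moreover have "\<delta> * h \<ge> 0" using pos h by simp
    ultimately show "\<delta> * h * B R \<le> c0 / 4" by linarith
    have "\<delta> \<le> d4" by (simp add: \<delta>_def)
    then have "\<delta> * K \<le> d4 * K" using K by (intro mult_right_mono) auto
    also have "\<dots> = h * c0 / 8" using K by (simp add: d4_def)
    also have "\<dots> < h * c0 / 4" using h c0 by simp
    finally show "\<delta> * K < h * c0 / 4" .
  qed
  from chi_dpp_lower[OF h(1) \<delta>(1), of x R] obtain lam \<gamma> u where lam: "lam > 0" "lam \<le> \<delta>" and \<gamma>0: "\<gamma> 0 = x"
    and \<gamma>: "(\<gamma>, u) \<in> trajectories f 0 h"
    and near: "cost lam \<gamma> u {0..h} + ennreal (exp (- lam * h) * v lam (\<gamma> h)) \<le> ennreal (chi x + \<delta>)"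
    and close': "\<forall>y\<in>cball 0 R. \<bar>v lam y - chi y\<bar> \<le> \<delta>"
    by blast
  have close: "\<bar>v lam y - chi y\<bar> \<le> \<delta>" if "norm y \<le> R" for y
    using close' that by auto
  let ?G = "\<lambda>t. exp (- lam * t) * L (\<gamma> t, u t)"
  have "cost lam \<gamma> u {0..h} \<le> cost lam \<gamma> u {0..h} + ennreal (exp (- lam * h) * v lam (\<gamma> h))" by simp
  then have "cost lam \<gamma> u {0..h} \<le> ennreal (chi x + \<delta>)" using near by order
  then have fin: "cost lam \<gamma> u {0..h} < \<infinity>" by (simp add: le_less_trans)
  note G_int = cost_finite_integral(1)[OF \<gamma> fin]
  define I where "I = integral {0..h} ?G"
  have I0: "I \<ge> 0" unfolding I_def using L_nonneg by (intro integral_nonneg G_int) auto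
  have "ennreal I + ennreal (exp (- lam * h) * v lam (\<gamma> h)) \<le> ennreal (chi x + \<delta>)"
    using near cost_finite_integral(2)[OF \<gamma> fin] by (simp add: I_def)
  then have "ennreal (I + exp (- lam * h) * v lam (\<gamma> h)) \<le> ennreal (chi x + \<delta>)"
    using I0 value_nonneg[OF lam(1), of "\<gamma> h"] by (simp add: ennreal_plus)
  then have I_le: "I + exp (- lam * h) * v lam (\<gamma> h) \<le> chi x + \<delta>"
    by (rule ennreal_le_iff[THEN iffD1, rotated]) (use chi_nonneg[of x] \<delta> in simp)
  have lamh: "lam * h \<le> 1 / 2" "lam * h \<le> \<delta> * h"
  proof -
    show 1: "lam * h \<le> \<delta> * h" using lam h by (intro mult_right_mono) auto
    then show "lam * h \<le> 1 / 2" using \<delta> by simp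
  qed
  have exp_lower: "1 - lam * h \<le> exp (- lam * t)" if "t \<in> {0..h}" for t
  proof -
    have "lam * t \<le> lam * h" using that lam by (intro mult_left_mono) auto
    moreover have "1 + (- lam * t) \<le> exp (- lam * t)" by (rule exp_ge_add_one_self)
    ultimately show ?thesis by simp
  qed
  have si2: "set_integrable lebesgue {0..h} (\<lambda>t. (norm (u t))\<^sup>2)" using \<gamma> by (simp add: trajectories_iff)
  note u2 = set_lebesgue_integral_eq_integral(1)[OF si2]
  have u2_le: "integral {0..h} (\<lambda>t. (norm (u t))\<^sup>2) \<le> E"
  proof -
    have "integral {0..h} (\<lambda>t. \<kappa> / 2 * (norm (u t))\<^sup>2) \<le> I"
      unfolding I_def
    proof (rule integral_le)
      show "(\<lambda>t. \<kappa> / 2 * (norm (u t))\<^sup>2) integrable_on {0..h}"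
        by (intro integrable_cmul[where 'b=real, unfolded real_scaleR_def] u2)
      fix t assume t: "t \<in> {0..h}"
      have "1 / 2 * (\<kappa> * (norm (u t))\<^sup>2) \<le> exp (- lam * t) * L (\<gamma> t, u t)"
        using exp_lower[OF t] lamh L_lower[of "u t" "\<gamma> t"] \<kappa> by (intro mult_mono) auto
      then show "\<kappa> / 2 * (norm (u t))\<^sup>2 \<le> ?G t" by simp
    qed (rule G_int)
    also have "I \<le> chi x + 1"
      using I_le value_nonneg[OF lam(1), of "\<gamma> h"] \<delta>(2) by (smt (verit) exp_ge_zero mult_nonneg_nonneg)
    finally have "\<kappa> / 2 * integral {0..h} (\<lambda>t. (norm (u t))\<^sup>2) \<le> chi x + 1" by simp
    then show ?thesis using \<kappa> by (simp add: E_def field_simps)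
  qed
  note si1 = trajectories_norm_integrable[OF \<gamma>]
  have u1_le: "(LINT t:{0..h}|lebesgue. norm (u t)) \<le> e"
  proof -
    have "integral {0..h} (\<lambda>t. norm (u t)) \<le> integral {0..h} (\<lambda>t. a * (norm (u t))\<^sup>2 + 1 / (4 * a))"
    proof (rule integral_le)
      show "(\<lambda>t. a * (norm (u t))\<^sup>2 + 1 / (4 * a)) integrable_on {0..h}"
        by (intro integrable_add integrable_const_ivl integrable_cmul[where 'b=real, unfolded real_scaleR_def] u2)
      fix t
      have "0 \<le> (2 * a * norm (u t) - 1)\<^sup>2 / (4 * a)" using a by simp
      also have "\<dots> = a * (norm (u t))\<^sup>2 + 1 / (4 * a) - norm (u t)"
        using a by (simp add: power2_eq_square field_simps)
      finally show "norm (u t) \<le> a * (norm (u t))\<^sup>2 + 1 / (4 * a)" by simp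
    qed (rule set_lebesgue_integral_eq_integral(1)[OF si1])
    also have "\<dots> = a * integral {0..h} (\<lambda>t. (norm (u t))\<^sup>2) + h * (1 / (4 * a))"
      using h u2 by (subst integral_add) (auto intro!: integrable_cmul[where 'b=real, unfolded real_scaleR_def])
    also have "\<dots> \<le> a * E + h * (1 / (4 * a))"
      using u2_le a h(1) by (intro add_mono mult_left_mono) auto
    also have "\<dots> = e" using a h by simp
    finally show ?thesis using set_lebesgue_integral_eq_integral(2)[OF si1] by simp
  qed
  have u1_nonneg: "0 \<le> (LINT t:{0..h}|lebesgue. norm (u t))"
    unfolding set_lebesgue_integral_def by (intro integral_nonneg_AE) auto
  have bounded: "norm (\<gamma> t) \<le> 2 * norm x + 1" if "t \<in> {0..h}" for t
  proof -
    have "?c * (LINT t:{0..h}|lebesgue. norm (u t)) \<le> ?c * e" using u1_le velocity_bound by (intro mult_left_mono) auto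
    then show ?thesis
      using trajectories_bounded[OF growth c \<gamma> _ that] e(2) \<gamma>0 by simp
  qed
  have disp: "norm (\<gamma> t - x) \<le> r" if "t \<in> {0..h}" for t
  proof -
    have "norm (\<gamma> t - \<gamma> 0) \<le> q * (LINT t:{0..h}|lebesgue. norm (u t))"
      unfolding q_def by (rule trajectories_displacement[OF growth c \<gamma> bounded that])
    also have "\<dots> \<le> q * e"
      using u1_le q by (intro mult_left_mono) auto
    finally show ?thesis using e(3) \<gamma>0 by simp
  qed
  have normR: "norm (\<gamma> t) \<le> R" if "t \<in> {0..h}" for t
    using disp[OF that] norm_triangle_sub[of "\<gamma> t" x] by (simp add: R_def)
  \<comment> \<open>Of the surplus \<open>c0 * ?U\<close>, three quarters are spent on the
    derivative of \<open>\<phi>\<close>, on \<open>L\<close> and on the discount; the last quarter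
    is at least \<open>c0 / 4\<close> since \<open>?U \<ge> 1\<close>.\<close>
  have point: "c0 / 4 \<le> frechet_derivative \<phi> (at (\<gamma> t)) (velocity f (\<gamma> t) (u t)) + ?G t" if t: "t \<in> {0..h}" for t
  proof -
    let ?U = "1 + (norm (u t))\<^sup>2"
    have U: "?U \<ge> 1" "norm (u t) \<le> ?U"
      using sum_squares_bound[of "norm (u t)" 1] by (simp_all add: power2_eq_square) (use norm_ge_zero[of "u t"] in linarith)
    have dt: "dist (\<gamma> t) x < r1" using disp[OF t] r by (simp add: dist_norm)
    have "\<bar>frechet_derivative \<phi> (at (\<gamma> t)) (velocity f (\<gamma> t) (u t)) - p \<bullet> velocity f x (u t)\<bar>
      = \<bar>\<Sum>i\<in>UNIV. u t $ i * (lie_derivative (f i) \<phi> (\<gamma> t) - lie_derivative (f i) \<phi> x)\<bar>"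
      unfolding Dx[symmetric] D_sum by (simp add: sum_subtractf right_diff_distrib)
    also have "\<dots> \<le> (\<Sum>i\<in>UNIV. norm (u t) * \<bar>lie_derivative (f i) \<phi> (\<gamma> t) - lie_derivative (f i) \<phi> x\<bar>)"
      by (rule order_trans[OF sum_abs]) (auto simp: abs_mult intro!: sum_mono mult_right_mono component_le_norm_cart)
    also have "\<dots> = norm (u t) * S (\<gamma> t)" by (simp add: S_def sum_distrib_left)
    also have "\<dots> \<le> ?U * (c0 / 4)"
      using r1(2)[OF dt] U c0 by (intro mult_mono) (auto simp: S_def intro!: sum_nonneg)
    finally have 1: "frechet_derivative \<phi> (at (\<gamma> t)) (velocity f (\<gamma> t) (u t)) \<ge> p \<bullet> velocity f x (u t) - ?U * (c0 / 4)"
      unfolding abs_le_iff by linarith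
    have "L (x, u t) \<le> L (\<gamma> t, u t) + l1 * ?U * norm (x - \<gamma> t)" by (rule L_lipschitz)
    also have "l1 * ?U * norm (x - \<gamma> t) \<le> l1 * ?U * r"
      using disp[OF t] l1 U by (intro mult_left_mono) (auto simp: norm_minus_commute)
    also have "l1 * ?U * r = ?U * (l1 * r)" by simp
    also have "\<dots> \<le> ?U * (c0 / 4)" using r(4) U by (intro mult_left_mono) auto
    finally have 2: "L (\<gamma> t, u t) \<ge> L (x, u t) - ?U * (c0 / 4)" by simp
    have "(1 - lam * h) * L (\<gamma> t, u t) \<le> ?G t"
      using exp_lower[OF t] L_nonneg by (intro mult_right_mono) auto
    moreover have "lam * h * L (\<gamma> t, u t) \<le> ?U * (c0 / 4)"
    proof -
      have "lam * h * L (\<gamma> t, u t) \<le> (\<delta> * h) * (B R * ?U)"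
        using lamh lam h L_upper[OF normR[OF t], of "u t"] L_nonneg \<delta> by (intro mult_mono) auto
      also have "\<dots> = (\<delta> * h * B R) * ?U" by simp
      also have "\<dots> \<le> c0 / 4 * ?U" using \<delta>(4) U by (intro mult_right_mono) auto
      finally show ?thesis by (simp add: mult.commute)
    qed
    ultimately have 3: "?G t \<ge> L (\<gamma> t, u t) - ?U * (c0 / 4)" by (simp add: algebra_simps)
    have "c0 / 4 \<le> ?U * (c0 / 4)" using U c0 by simp
    also have "\<dots> = c0 * ?U - ?U * (c0 / 4) - ?U * (c0 / 4) - ?U * (c0 / 4)" by (simp add: field_simps)
    also have "\<dots> \<le> frechet_derivative \<phi> (at (\<gamma> t)) (velocity f (\<gamma> t) (u t)) + ?G t"
      using 1 2 3 c0(2)[of "u t"] by linarith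
    finally show ?thesis .
  qed
  have D_int: "((\<lambda>t. frechet_derivative \<phi> (at (\<gamma> t)) (velocity f (\<gamma> t) (u t))) has_integral (\<phi> (\<gamma> h) - \<phi> (\<gamma> 0))) {0..h}"
    by (rule trajectories_C1_function[OF \<gamma> less_imp_le[OF h(1)] \<phi>1])
  have "h * (c0 / 4) \<le> (\<phi> (\<gamma> h) - \<phi> (\<gamma> 0)) + I"
  proof (rule has_integral_le)
    show "((\<lambda>t. c0 / 4) has_integral h * (c0 / 4)) {0..h}"
      using has_integral_const_real[of "c0 / 4" 0 h] h by simp
    show "((\<lambda>t. frechet_derivative \<phi> (at (\<gamma> t)) (velocity f (\<gamma> t) (u t)) + ?G t) has_integral (\<phi> (\<gamma> h) - \<phi> (\<gamma> 0)) + I) {0..h}"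
      unfolding I_def by (intro has_integral_add D_int integrable_integral G_int)
  qed (rule point)
  moreover have "\<phi> (\<gamma> h) - \<phi> x \<le> chi (\<gamma> h) - chi x"
    using r2(2)[of "\<gamma> h"] disp[of h] r h by (simp add: dist_norm)
  moreover have "I + chi (\<gamma> h) - chi x \<le> \<delta> * K"
  proof -
    have n: "norm (\<gamma> h) \<le> R" using normR[of h] h by simp
    have vc: "\<bar>v lam (\<gamma> h) - chi (\<gamma> h)\<bar> \<le> \<delta>" by (rule close[OF n])
    have "v lam (\<gamma> h) \<le> Mc + 1" using vc Mc(2)[OF n] \<delta>(2) by (simp add: abs_le_iff)
    then have "lam * h * v lam (\<gamma> h) \<le> \<delta> * h * (Mc + 1)"
      using lamh lam h \<delta> value_nonneg[OF lam(1), of "\<gamma> h"] by (intro mult_mono) auto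
    moreover have "(1 - lam * h) * v lam (\<gamma> h) \<le> exp (- lam * h) * v lam (\<gamma> h)"
      using exp_lower[of h] h value_nonneg[OF lam(1), of "\<gamma> h"] by (intro mult_right_mono) auto
    ultimately have "v lam (\<gamma> h) - \<delta> * h * (Mc + 1) \<le> exp (- lam * h) * v lam (\<gamma> h)"
      by (simp add: algebra_simps)
    then show ?thesis using I_le vc unfolding K_def by (simp add: algebra_simps abs_le_iff)
  qed
  ultimately show False using \<delta>(5) \<gamma>0 by simp
qed

lemma chi_viscosity_solution: "viscosity_solution (\<lambda>x p. hamiltonian f L x (- p)) chi"
  unfolding viscosity_solution_def
  using chi_continuous chi_viscosity_subsolution chi_viscosity_supersolution by blast

end

subsection \<open>Lipschitz continuity for the sub-Riemannian distance\<close>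

lemma regularized_gram_inner:
  fixes A :: "real^'m^'d"
  shows "x \<bullet> ((transpose A ** A + e *\<^sub>R mat 1) *v x) = (norm (A *v x))\<^sup>2 + e * (norm x)\<^sup>2"
proof -
  have "(transpose A ** A + e *\<^sub>R mat 1) *v x = transpose A *v (A *v x) + e *\<^sub>R x"
    by (simp add: matrix_vector_mult_add_rdistrib matrix_vector_mul_assoc scaleR_matrix_vector_assoc[symmetric])
  moreover have "x \<bullet> (transpose A *v (A *v x)) = (A *v x) \<bullet> (A *v x)"
    by (metis dot_lmul_matrix inner_commute transpose_matrix_vector)
  ultimately show ?thesis by (simp only: inner_add_right power2_norm_eq_inner inner_scaleR_right)
qed

lemma regularized_gram_det:
  fixes A :: "real^'m^'d"
  assumes e: "e > 0"
  shows "det (transpose A ** A + e *\<^sub>R mat 1) \<noteq> 0"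
proof -
  let ?G = "transpose A ** A + e *\<^sub>R mat 1"
  have "x = 0" if "?G *v x = 0" for x
  proof -
    have "(norm (A *v x))\<^sup>2 + e * (norm x)\<^sup>2 = 0"
      using regularized_gram_inner[of x A e] unfolding that by simp
    moreover have "(norm (A *v x))\<^sup>2 \<ge> 0" "e * (norm x)\<^sup>2 \<ge> 0" using e by auto
    ultimately have "e * (norm x)\<^sup>2 = 0" by linarith
    then show ?thesis using e by simp
  qed
  then show ?thesis
    using invertible_det_nz[of ?G] invertible_left_inverse[of ?G] matrix_left_invertible_ker[of ?G] by blast
qed

text \<open>Tikhonov regularization, with the regularized solutions given by Cramer's rule: this makes
  the minimizer a limit of continuous functions of \<open>A\<close> and \<open>u\<close>.\<close>

lemma regularized_min_norm:
  fixes A :: "real^'m^'d" and u :: "real^'m"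
  defines "G \<equiv> transpose A ** A"
  obtains p where "A *v p = A *v u" "\<And>u'. A *v u' = A *v u \<Longrightarrow> norm p \<le> norm u'"
    "(\<lambda>n. \<chi> k. det (\<chi> i j. if j = k then (G *v u) $ i else (G + (1 / real (Suc n)) *\<^sub>R mat 1) $ i $ j)
        / det (G + (1 / real (Suc n)) *\<^sub>R mat 1)) \<longlonglongrightarrow> p"
proof -
  have adj: "(transpose A *v y) \<bullet> z = y \<bullet> (A *v z)" for y z
    by (metis dot_lmul_matrix inner_commute transpose_matrix_vector)
  let ?S = "range (\<lambda>y. transpose A *v y)"
  have spanS: "span ?S = ?S"
    by (intro span_eq_iff[THEN iffD2] linear_subspace_image matrix_vector_mul_linear subspace_UNIV)
  \<comment> \<open>\<open>p\<close> is the component of \<open>u\<close> in the range of the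
    transpose, the orthogonal complement of the kernel of \<open>A\<close>; this is the solution of
    least norm.\<close>
  obtain p z where pz: "p \<in> span ?S" "\<And>w. w \<in> span ?S \<Longrightarrow> orthogonal z w" "u = p + z"
    using orthogonal_subspace_decomp_exists[of ?S u] by metis
  obtain y where y: "p = transpose A *v y" using pz(1) unfolding spanS by blast
  have "(A *v z) \<bullet> (A *v z) = z \<bullet> (transpose A *v (A *v z))"
    by (metis adj inner_commute)
  also have "\<dots> = 0"
    using pz(2)[OF span_base[of "transpose A *v (A *v z)" ?S]] unfolding orthogonal_def by blast
  finally have Az: "A *v z = 0" by simp
  have Ap: "A *v p = A *v u"
    using Az by (simp add: pz(3) matrix_vector_right_distrib)
  have min: "norm p \<le> norm u'" if "A *v u' = A *v u" for u'
  proof -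
    have "A *v (u' - p) = 0" using that Ap by (simp add: matrix_vector_mult_diff_distrib)
    then have "p \<bullet> (u' - p) = 0" using adj[of y "u' - p"] by (simp only: y[symmetric] inner_zero_right)
    then have "(norm u')\<^sup>2 = (norm p)\<^sup>2 + (norm (u' - p))\<^sup>2"
      using norm_add_Pythagorean[of p "u' - p"] by (simp add: orthogonal_def)
    then have "(norm p)\<^sup>2 \<le> (norm u')\<^sup>2" by simp
    then show ?thesis by (rule power2_le_imp_le) simp
  qed
  define e where "e n = 1 / real (Suc n)" for n
  have e: "e n > 0" for n by (simp add: e_def)
  define Ge where "Ge n = G + e n *\<^sub>R mat 1" for n
  have Ge: "Ge n *v x = transpose A *v (A *v x) + e n *\<^sub>R x" for n x
    by (simp add: Ge_def G_def matrix_vector_mult_add_rdistrib matrix_vector_mul_assoc scaleR_matrix_vector_assoc[symmetric])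
  have Ge_inner: "x \<bullet> (Ge n *v x) = (norm (A *v x))\<^sup>2 + e n * (norm x)\<^sup>2" for n x
    unfolding Ge_def G_def by (rule regularized_gram_inner)
  have "det (Ge n) \<noteq> 0" for n
    unfolding Ge_def G_def by (rule regularized_gram_det[OF e])
  note cr = cramer[OF this]
  define w where "w n = (\<chi> k. det (\<chi> i j. if j = k then (G *v u) $ i else Ge n $ i $ j) / det (Ge n))" for n
  have w: "Ge n *v w n = G *v u" for n using cr[of n "w n" "G *v u"] by (simp add: w_def)
  \<comment> \<open>The rate comes from writing \<open>p\<close> as the transpose applied to
    \<open>y\<close>: the error equation is tested with the error, and the resulting product with
    \<open>norm y\<close> is absorbed by completing a square.\<close>
  have bound: "norm (w n - p) \<le> sqrt (e n) * norm y" for n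
  proof -
    let ?r = "w n - p"
    have "Ge n *v ?r = G *v u - (transpose A *v (A *v p) + e n *\<^sub>R p)"
      unfolding matrix_vector_mult_diff_distrib w by (simp only: Ge)
    also have "\<dots> = - (e n *\<^sub>R p)"
      by (simp add: G_def matrix_vector_mul_assoc[symmetric] Ap)
    finally have "?r \<bullet> (Ge n *v ?r) = - (e n * (?r \<bullet> (transpose A *v y)))" by (simp add: y)
    also have "?r \<bullet> (transpose A *v y) = (A *v ?r) \<bullet> y" by (metis adj inner_commute)
    finally have "(norm (A *v ?r))\<^sup>2 + e n * (norm ?r)\<^sup>2 = e n * - ((A *v ?r) \<bullet> y)" unfolding Ge_inner by simp
    also have "\<dots> \<le> e n * (norm (A *v ?r) * norm y)"
      using Cauchy_Schwarz_ineq2[of "A *v ?r" y] e[of n] by (intro mult_left_mono) auto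
    finally have 1: "(norm (A *v ?r))\<^sup>2 + e n * (norm ?r)\<^sup>2 \<le> e n * (norm (A *v ?r) * norm y)" .
    have "0 \<le> (norm (A *v ?r) - e n * norm y)\<^sup>2 + (norm (A *v ?r))\<^sup>2" by simp
    then have "2 * (e n * (norm (A *v ?r) * norm y)) \<le> 2 * (norm (A *v ?r))\<^sup>2 + (e n)\<^sup>2 * (norm y)\<^sup>2"
      by (simp add: power2_diff power_mult_distrib algebra_simps)
    then have "e n * (norm ?r)\<^sup>2 \<le> e n * (e n * (norm y)\<^sup>2 / 2)" using 1 by (simp add: power2_eq_square)
    then have "(norm ?r)\<^sup>2 \<le> e n * (norm y)\<^sup>2 / 2" using e[of n] by (simp only: mult_le_cancel_left_pos)
    also have "\<dots> \<le> (sqrt (e n) * norm y)\<^sup>2" using e[of n] by (simp add: power_mult_distrib)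
    finally show ?thesis
    proof (rule power2_le_imp_le)
      show "0 \<le> sqrt (e n) * norm y" using e[of n] by simp
    qed
  qed
  have "w \<longlonglongrightarrow> p"
  proof (rule LIM_zero_cancel, rule Lim_null_comparison)
    show "\<forall>\<^sub>F n in sequentially. norm (w n - p) \<le> sqrt (e n) * norm y" using bound by simp
    have "e \<longlonglongrightarrow> 0" unfolding e_def[abs_def] by (rule LIMSEQ_Suc[OF lim_1_over_n])
    then have "(\<lambda>n. sqrt (e n) * norm y) \<longlonglongrightarrow> sqrt 0 * norm y" by (intro tendsto_intros)
    then show "(\<lambda>n. sqrt (e n) * norm y) \<longlonglongrightarrow> 0" by simp
  qed
  then have lim: "(\<lambda>n. \<chi> k. det (\<chi> i j. if j = k then (G *v u) $ i else (G + (1 / real (Suc n)) *\<^sub>R mat 1) $ i $ j)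
        / det (G + (1 / real (Suc n)) *\<^sub>R mat 1)) \<longlonglongrightarrow> p"
    unfolding w_def[abs_def] Ge_def e_def .
  show ?thesis
  proof (rule that[OF Ap _ lim])
    show "norm p \<le> norm u'" if "A *v u' = A *v u" for u' by (rule min[OF that])
  qed
qed

lemma continuous_on_det:
  fixes M :: "'a::topological_space \<Rightarrow> real^'n^'n"
  assumes "\<And>i j. continuous_on S (\<lambda>x. M x $ i $ j)"
  shows "continuous_on S (\<lambda>x. det (M x))"
  unfolding det_def by (intro continuous_intros assms)

context control_problem
begin

text \<open>The infimum in \<open>sr_metric\<close> is taken separately at each time, so its
  minimizer has to be shown measurable in time. It is a pointwise limit of continuous functions of
  \<open>(\<gamma> t, u t)\<close>, and its square integrability is inherited from
  \<open>u\<close>.\<close>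

lemma minimal_control:
  assumes \<gamma>: "(\<gamma>, u) \<in> trajectories f a b"
  obtains w where "(\<gamma>, w) \<in> trajectories f a b"
    "AE t in lebesgue. t \<in> {a..b} \<longrightarrow> (\<forall>u'. vector_derivative \<gamma> (at t) = velocity f (\<gamma> t) u' \<longrightarrow> norm (w t) \<le> norm u')"
proof -
  define G where "G x = transpose (control_matrix f x) ** control_matrix f x" for x
  define Ge where "Ge n x = G x + (1 / real (Suc n)) *\<^sub>R (mat 1 :: real^'m^'m)" for n x
  define W where "W n z = (\<chi> k. det (\<chi> i j. if j = k then (G (fst z) *v snd z) $ i else Ge n (fst z) $ i $ j)
        / det (Ge n (fst z)))" for n z
  have ex: "\<forall>t. \<exists>p. velocity f (\<gamma> t) p = velocity f (\<gamma> t) (u t) \<and> (\<forall>u'. velocity f (\<gamma> t) u' = velocity f (\<gamma> t) (u t) \<longrightarrow> norm p \<le> norm u') \<and>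
      (\<lambda>n. W n (\<gamma> t, u t)) \<longlonglongrightarrow> p"
  proof
    fix t
    obtain p where "velocity f (\<gamma> t) p = velocity f (\<gamma> t) (u t)" "\<And>u'. velocity f (\<gamma> t) u' = velocity f (\<gamma> t) (u t) \<Longrightarrow> norm p \<le> norm u'"
      "(\<lambda>n. W n (\<gamma> t, u t)) \<longlonglongrightarrow> p"
      using regularized_min_norm[of "control_matrix f (\<gamma> t)" "u t"] unfolding W_def Ge_def G_def fst_conv snd_conv by blast
    then show "\<exists>p. velocity f (\<gamma> t) p = velocity f (\<gamma> t) (u t) \<and> (\<forall>u'. velocity f (\<gamma> t) u' = velocity f (\<gamma> t) (u t) \<longrightarrow> norm p \<le> norm u') \<and>
      (\<lambda>n. W n (\<gamma> t, u t)) \<longlonglongrightarrow> p" by blast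
  qed
  from choice[OF ex] obtain w where w: "\<And>t. velocity f (\<gamma> t) (w t) = velocity f (\<gamma> t) (u t)"
    "\<And>t u'. velocity f (\<gamma> t) u' = velocity f (\<gamma> t) (u t) \<Longrightarrow> norm (w t) \<le> norm u'"
    "\<And>t. (\<lambda>n. W n (\<gamma> t, u t)) \<longlonglongrightarrow> w t"
    by blast
  have contf: "continuous_on UNIV (\<lambda>z. f i (fst z) $ k)" for i k and z :: "(real^'d) \<times> (real^'m)"
    by (intro continuous_intros continuous_on_compose2[OF smooth_continuous[OF smooth_f, of UNIV]]) auto
  have G_eq: "G x $ i $ j = (\<Sum>k\<in>UNIV. f i x $ k * f j x $ k)" for x i j
    by (simp add: G_def matrix_matrix_mult_def transpose_def control_matrix_def)
  have contG: "continuous_on UNIV (\<lambda>z. G (fst z) $ i $ j)" for i j and z :: "(real^'d) \<times> (real^'m)"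
    unfolding G_eq
    by (intro continuous_intros continuous_on_compose2[OF smooth_continuous[OF smooth_f, of UNIV]]) auto
  have contGe: "continuous_on UNIV (\<lambda>z :: (real^'d) \<times> (real^'m). Ge n (fst z) $ i $ j)" for n i j
    unfolding Ge_def by (simp, intro continuous_intros contG)
  have det_nz: "det (Ge n x) \<noteq> 0" for n x
    unfolding Ge_def G_def by (rule regularized_gram_det) simp
  have contW: "continuous_on UNIV (W n)" for n
    unfolding W_def[abs_def]
  proof (intro continuous_on_vec_lambda continuous_on_divide continuous_on_det)
    show "continuous_on UNIV (\<lambda>z :: (real^'d) \<times> (real^'m). (\<chi> i j. if j = k then (G (fst z) *v snd z) $ i else Ge n (fst z) $ i $ j) $ i $ j)" for i j k
    proof (cases "j = k")
      case True
      then show ?thesis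
        by (simp add: matrix_vector_mult_def) (intro continuous_intros contG)
    qed (simp add: contGe)
  qed (use contGe det_nz in auto)
  have meas: "w \<in> borel_measurable (lebesgue_on {a..b})"
  proof (rule borel_measurable_LIMSEQ_metric)
    have "\<gamma> \<in> borel_measurable (lebesgue_on {a..b})"
      using AC_continuous \<gamma> by (intro continuous_imp_measurable_on_sets_lebesgue) (auto simp: trajectories_iff)
    moreover have "u \<in> borel_measurable (lebesgue_on {a..b})"
      using \<gamma> measurable_lebesgue_on_iff[of "{a..b}" u] by (simp add: trajectories_iff)
    ultimately have "(\<lambda>t. (\<gamma> t, u t)) \<in> borel_measurable (lebesgue_on {a..b})"
      by (rule borel_measurable_Pair)
    then show "(\<lambda>t. W n (\<gamma> t, u t)) \<in> borel_measurable (lebesgue_on {a..b})" for n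
      by (rule measurable_compose[OF _ borel_measurable_continuous_onI[OF contW]])
    show "(\<lambda>n. W n (\<gamma> t, u t)) \<longlonglongrightarrow> w t" for t by (rule w(3))
  qed
  then have meas': "(\<lambda>t. indicator {a..b} t *\<^sub>R w t) \<in> borel_measurable lebesgue"
    using measurable_lebesgue_on_iff[of "{a..b}" w] by simp
  have "set_integrable lebesgue {a..b} (\<lambda>t. (norm (w t))\<^sup>2)"
    unfolding set_integrable_def
  proof (rule Bochner_Integration.integrable_bound)
    show "integrable lebesgue (\<lambda>t. indicat_real {a..b} t *\<^sub>R (norm (u t))\<^sup>2)"
      using \<gamma> by (simp add: trajectories_iff set_integrable_def)
    have "(\<lambda>t. (norm (indicator {a..b} t *\<^sub>R w t))\<^sup>2) \<in> borel_measurable lebesgue"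
      using measurable_compose[OF meas', of "\<lambda>x. (norm x)\<^sup>2" borel] by simp
    moreover have "(norm (indicator {a..b} t *\<^sub>R w t))\<^sup>2 = indicat_real {a..b} t *\<^sub>R (norm (w t))\<^sup>2" for t
      by (auto simp: indicator_def)
    ultimately show "(\<lambda>t. indicat_real {a..b} t *\<^sub>R (norm (w t))\<^sup>2) \<in> borel_measurable lebesgue" by simp
    show "AE t in lebesgue. norm (indicat_real {a..b} t *\<^sub>R (norm (w t))\<^sup>2) \<le> norm (indicat_real {a..b} t *\<^sub>R (norm (u t))\<^sup>2)"
      using w(2) by (intro AE_I2) (auto simp: indicator_def intro!: power_mono)
  qed
  then have traj: "(\<gamma>, w) \<in> trajectories f a b"
    using \<gamma> meas' by (simp add: trajectories_iff w(1))
  have "AE t in lebesgue. t \<in> {a..b} \<longrightarrow> (\<gamma> has_vector_derivative velocity f (\<gamma> t) (u t)) (at t)"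
    using \<gamma> by (simp add: trajectories_iff)
  then have "AE t in lebesgue. t \<in> {a..b} \<longrightarrow> (\<forall>u'. vector_derivative \<gamma> (at t) = velocity f (\<gamma> t) u' \<longrightarrow> norm (w t) \<le> norm u')"
  proof (rule eventually_mono, intro impI allI)
    fix t u' assume "t \<in> {a..b} \<longrightarrow> (\<gamma> has_vector_derivative velocity f (\<gamma> t) (u t)) (at t)" "t \<in> {a..b}"
      and eq: "vector_derivative \<gamma> (at t) = velocity f (\<gamma> t) u'"
    then have "(\<gamma> has_vector_derivative velocity f (\<gamma> t) (u t)) (at t)" by blast
    from vector_derivative_at[OF this] eq have "velocity f (\<gamma> t) u' = velocity f (\<gamma> t) (u t)" by simp
    then show "norm (w t) \<le> norm u'" by (rule w(2))
  qed
  then show ?thesis using that traj by blast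
qed

text \<open>At almost every time, minimality of \<open>w\<close> against each competing
  \<open>u'\<close> bounds \<open>norm (w t)\<close> by the root of the metric; monotonicity of
  \<open>nn_integral\<close> carries this to the length.\<close>

lemma length_ge_minimal_control:
  assumes traj: "(\<gamma>, w) \<in> trajectories f a b"
    and w: "AE t in lebesgue. t \<in> {a..b} \<longrightarrow> (\<forall>u'. vector_derivative \<gamma> (at t) = velocity f (\<gamma> t) u' \<longrightarrow> norm (w t) \<le> norm u')"
  shows "ennreal (LINT t:{a..b}|lebesgue. norm (w t)) \<le>
    (\<integral>\<^sup>+ t. ennreal_root (sr_metric f (\<gamma> t) (vector_derivative \<gamma> (at t))) \<partial>lebesgue_on {a..b})"
proof -
  \<comment> \<open>The infinite value of the metric, which \<open>enn2real\<close> would send to 0,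
    is treated apart.\<close>
  have root: "ennreal r \<le> ennreal_root z" if "ennreal (r\<^sup>2) \<le> z" "r \<ge> 0" for r z
  proof (cases "z = top")
    case False
    then have "ennreal (r\<^sup>2) \<le> ennreal (enn2real z)" using that(1) by (simp add: ennreal_enn2real_if)
    then have "r\<^sup>2 \<le> enn2real z" by (rule ennreal_le_iff[THEN iffD1, rotated]) simp
    then have "sqrt (r\<^sup>2) \<le> sqrt (enn2real z)" by (rule real_sqrt_le_mono)
    then show ?thesis using that False by (simp add: ennreal_root_def ennreal_leI)
  qed (simp add: ennreal_root_def)
  have "integrable lebesgue (\<lambda>t. indicator {a..b} t *\<^sub>R norm (w t))"
    using trajectories_norm_integrable[OF traj] by (simp add: set_integrable_def)
  then have "ennreal (LINT t:{a..b}|lebesgue. norm (w t)) = (\<integral>\<^sup>+t. ennreal (indicator {a..b} t *\<^sub>R norm (w t)) \<partial>lebesgue)"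
    unfolding set_lebesgue_integral_def by (intro nn_integral_eq_integral[symmetric]) auto
  also have "\<dots> = (\<integral>\<^sup>+t. ennreal (norm (w t)) * indicator {a..b} t \<partial>lebesgue)"
    by (intro nn_integral_cong) (auto simp: indicator_def)
  also have "\<dots> \<le> (\<integral>\<^sup>+ t. ennreal_root (sr_metric f (\<gamma> t) (vector_derivative \<gamma> (at t))) * indicator {a..b} t \<partial>lebesgue)"
  proof (rule nn_integral_mono_AE, rule eventually_mono[OF w])
    fix t assume t: "t \<in> {a..b} \<longrightarrow> (\<forall>u'. vector_derivative \<gamma> (at t) = velocity f (\<gamma> t) u' \<longrightarrow> norm (w t) \<le> norm u')"
    show "ennreal (norm (w t)) * indicator {a..b} t \<le> ennreal_root (sr_metric f (\<gamma> t) (vector_derivative \<gamma> (at t))) * indicator {a..b} t"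
    proof (cases "t \<in> {a..b}")
      case True
      have "ennreal ((norm (w t))\<^sup>2) \<le> sr_metric f (\<gamma> t) (vector_derivative \<gamma> (at t))"
        unfolding sr_metric_def
      proof (rule INF_greatest)
        fix u' assume "u' \<in> {u'. vector_derivative \<gamma> (at t) = (\<Sum>i\<in>UNIV. u' $ i *\<^sub>R f i (\<gamma> t))}"
        then have "norm (w t) \<le> norm u'" using t True by (simp add: velocity_sum)
        then have "(norm (w t))\<^sup>2 \<le> (norm u')\<^sup>2" by (intro power_mono) auto
        also have "(norm u')\<^sup>2 = (\<Sum>i\<in>UNIV. (u' $ i)\<^sup>2)"
          unfolding power2_norm_eq_inner inner_vec_def by (simp add: power2_eq_square)
        finally show "ennreal ((norm (w t))\<^sup>2) \<le> ennreal (\<Sum>i\<in>UNIV. (u' $ i)\<^sup>2)" by (rule ennreal_leI)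
      qed
      then show ?thesis using root True by simp
    qed simp
  qed
  also have "\<dots> = (\<integral>\<^sup>+ t. ennreal_root (sr_metric f (\<gamma> t) (vector_derivative \<gamma> (at t))) \<partial>lebesgue_on {a..b})"
    by (rule nn_integral_restrict_space[symmetric]) simp
  finally show ?thesis .
qed

text \<open>Running a trajectory at the constant speed \<open>\<bar>m\<bar>\<close>, backwards if \<open>m < 0\<close>.\<close>

lemma chi_reparametrized:
  assumes \<gamma>: "(\<gamma>, u) \<in> trajectories f a b" and ab: "a < b" and R: "\<And>t. t \<in> {a..b} \<Longrightarrow> norm (\<gamma> t) \<le> R"
    and m: "m \<noteq> 0" and sub: "\<And>t. t \<in> {0..(b - a) / \<bar>m\<bar>} \<Longrightarrow> m * t + q \<in> {a..b}"
  shows "chi (\<gamma> q) \<le> B R * ((b - a) / \<bar>m\<bar> + \<bar>m\<bar> * integral {a..b} (\<lambda>t. (norm (u t))\<^sup>2)) + chi (\<gamma> (m * ((b - a) / \<bar>m\<bar>) + q))"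
proof -
  define T where "T = (b - a) / \<bar>m\<bar>"
  define U where "U = integral {a..b} (\<lambda>t. (norm (u t))\<^sup>2)"
  have T: "T > 0" using ab m by (simp add: T_def)
  have "norm (\<gamma> a) \<le> R" using R ab by simp
  then have "R \<ge> 0" using norm_ge_zero[of "\<gamma> a"] by linarith
  then have BR: "B R \<ge> 0" by (rule B_nonneg)
  have si: "set_integrable lebesgue {a..b} (\<lambda>t. (norm (u t))\<^sup>2)" using \<gamma> by (simp add: trajectories_iff)
  have U: "U = (LINT t|lebesgue. indicator {a..b} t *\<^sub>R (norm (u t))\<^sup>2)"
    using set_lebesgue_integral_eq_integral(2)[OF si] by (simp add: U_def set_lebesgue_integral_def)
  have U0: "U \<ge> 0" unfolding U_def using set_lebesgue_integral_eq_integral(1)[OF si] by (rule integral_nonneg) simp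
  \<comment> \<open>A majorant of the running cost, written as a function of the old time; the
    substitution contributes the factor \<open>\<bar>m\<bar>\<close>.\<close>
  let ?H = "\<lambda>s. indicator {a..b} s *\<^sub>R (B R * (1 + m\<^sup>2 * (norm (u s))\<^sup>2))"
  have H_eq: "?H s = B R * (indicator {a..b} s *\<^sub>R 1 + m\<^sup>2 * (indicator {a..b} s *\<^sub>R (norm (u s))\<^sup>2))" for s
    by (auto simp: indicator_def)
  have int1: "integrable lebesgue (\<lambda>t. indicator {a..b} t *\<^sub>R (1::real))"
    by (intro integrable_scaleR_left integrable_real_indicator) (auto simp: emeasure_lborel_Icc_eq)
  have int2: "integrable lebesgue (\<lambda>t. indicator {a..b} t *\<^sub>R (norm (u t))\<^sup>2)" using si by (simp add: set_integrable_def)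
  have H_int: "integrable lebesgue ?H"
    unfolding H_eq using int1 int2
    by (intro integrable_mult_right Bochner_Integration.integrable_add)
  have "(LINT s|lebesgue. ?H s) = B R * ((b - a) + m\<^sup>2 * U)"
    unfolding H_eq U using int1 int2 ab by (simp add: Bochner_Integration.integral_add integrable_mult_right)
  then have H_nn: "(\<integral>\<^sup>+s. ennreal (?H s) \<partial>lebesgue) = ennreal (B R * ((b - a) + m\<^sup>2 * U))"
    using BR by (subst nn_integral_eq_integral[OF H_int]) (auto simp: indicator_def)
  let ?g = "\<lambda>t. \<gamma> (m * t + q)" and ?w = "\<lambda>t. m *\<^sub>R u (m * t + q)"
  have traj: "(?g, ?w) \<in> trajectories f 0 T"
    by (rule trajectories_affine[OF \<gamma> m]) (use sub in \<open>simp add: T_def\<close>)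
  have cost_le: "cost 0 ?g ?w {0..T} \<le> (\<integral>\<^sup>+t. ennreal (?H (q + m * t)) \<partial>lebesgue)"
    unfolding cost_def
  proof (rule nn_integral_mono)
    fix t
    show "ennreal (exp (- 0 * t) * L (?g t, ?w t)) * indicator {0..T} t \<le> ennreal (?H (q + m * t))"
    proof (cases "t \<in> {0..T}")
      case True
      then have s: "m * t + q \<in> {a..b}" using sub by (simp add: T_def)
      have "L (?g t, ?w t) \<le> B R * (1 + (norm (?w t))\<^sup>2)" by (rule L_upper[OF R[OF s]])
      then have "L (?g t, ?w t) \<le> ?H (q + m * t)" using s by (simp add: add.commute power_mult_distrib)
      then show ?thesis using True by (simp add: ennreal_leI)
    qed simp
  qed
  have "ennreal \<bar>m\<bar> * cost 0 ?g ?w {0..T} \<le> ennreal \<bar>m\<bar> * (\<integral>\<^sup>+t. ennreal (?H (q + m * t)) \<partial>lebesgue)"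
    by (intro mult_left_mono cost_le) auto
  also have "\<dots> = (\<integral>\<^sup>+s. ennreal (?H s) \<partial>lebesgue)"
    using measurable_compose[OF borel_measurable_integrable[OF H_int] measurable_ennreal]
    by (intro nn_integral_real_affine_lebesgue[OF _ m, symmetric])
  finally have "ennreal \<bar>m\<bar> * cost 0 ?g ?w {0..T} \<le> ennreal (B R * ((b - a) + m\<^sup>2 * U))" unfolding H_nn .
  then have "ennreal (1 / \<bar>m\<bar>) * (ennreal \<bar>m\<bar> * cost 0 ?g ?w {0..T}) \<le> ennreal (1 / \<bar>m\<bar>) * ennreal (B R * ((b - a) + m\<^sup>2 * U))"
    by (intro mult_left_mono) auto
  then have "cost 0 ?g ?w {0..T} \<le> ennreal ((1 / \<bar>m\<bar>) * (B R * ((b - a) + m\<^sup>2 * U)))"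
    using m BR U0 ab by (simp add: mult.assoc[symmetric] ennreal_mult[symmetric])
  also have "(1 / \<bar>m\<bar>) * (B R * ((b - a) + m\<^sup>2 * U)) = B R * (T + \<bar>m\<bar> * U)"
  proof -
    have "m\<^sup>2 = \<bar>m\<bar> * \<bar>m\<bar>" by (simp add: power2_eq_square)
    then show ?thesis using m by (simp add: T_def field_simps)
  qed
  finally have "chi (?g 0) \<le> B R * (T + \<bar>m\<bar> * U) + chi (?g T)"
    using BR T U0 m by (intro chi_dpp_upper[OF T traj]) auto
  then show ?thesis by (simp add: T_def U_def)
qed

text \<open>The piece is run forwards from \<open>\<gamma> a\<close> and backwards from
  \<open>\<gamma> b\<close>, which gives both signs. The speed \<open>k\<close> stays free, to be
  adapted to the size of the control.\<close>

lemma chi_step: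
  assumes \<gamma>: "(\<gamma>, u) \<in> trajectories f a b" and ab: "a \<le> b" and R: "\<And>t. t \<in> {a..b} \<Longrightarrow> norm (\<gamma> t) \<le> R"
    and k: "k > 0"
  shows "\<bar>chi (\<gamma> b) - chi (\<gamma> a)\<bar> \<le> B R * ((b - a) / k + k * integral {a..b} (\<lambda>t. (norm (u t))\<^sup>2))"
proof (cases "a = b")
  case True
  then show ?thesis by simp
next
  case False
  then have ab: "a < b" using ab by simp
  have "chi (\<gamma> a) \<le> B R * ((b - a) / \<bar>k\<bar> + \<bar>k\<bar> * integral {a..b} (\<lambda>t. (norm (u t))\<^sup>2)) + chi (\<gamma> (k * ((b - a) / \<bar>k\<bar>) + a))"
  proof (rule chi_reparametrized[OF \<gamma> ab R])
    show "k * t + a \<in> {a..b}" if "t \<in> {0..(b - a) / \<bar>k\<bar>}" for t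
      using that k by (auto simp: pos_le_divide_eq algebra_simps)
  qed (use k in auto)
  moreover have "chi (\<gamma> b) \<le> B R * ((b - a) / \<bar>- k\<bar> + \<bar>- k\<bar> * integral {a..b} (\<lambda>t. (norm (u t))\<^sup>2)) + chi (\<gamma> ((- k) * ((b - a) / \<bar>- k\<bar>) + b))"
  proof (rule chi_reparametrized[OF \<gamma> ab R])
    show "(- k) * t + b \<in> {a..b}" if "t \<in> {0..(b - a) / \<bar>- k\<bar>}" for t
      using that k by (auto simp: pos_le_divide_eq algebra_simps)
  qed (use k in auto)
  ultimately show ?thesis using k by (simp add: abs_le_iff)
qed

text \<open>On each piece of a fine tagged division the trajectory is run at the speed prescribed by
  the tag; Henstock's lemma controls the resulting error.\<close>

lemma chi_length_bound:
  assumes \<gamma>: "(\<gamma>, u) \<in> trajectories f a b" and ab: "a \<le> b" and R: "\<And>t. t \<in> {a..b} \<Longrightarrow> norm (\<gamma> t) \<le> R"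
  shows "\<bar>chi (\<gamma> b) - chi (\<gamma> a)\<bar> \<le> 2 * B R * integral {a..b} (\<lambda>t. norm (u t))"
proof -
  have "norm (\<gamma> a) \<le> R" using R ab by simp
  then have "R \<ge> 0" using norm_ge_zero[of "\<gamma> a"] by linarith
  then have BR: "B R \<ge> 0" by (rule B_nonneg)
  let ?w = "\<lambda>t. norm (u t)"
  let ?I = "integral {a..b} ?w"
  have i1: "?w integrable_on {a..b}"
    by (rule set_lebesgue_integral_eq_integral(1)[OF trajectories_norm_integrable[OF \<gamma>]])
  have i2: "(\<lambda>t. (?w t)\<^sup>2) integrable_on cbox a b"
    unfolding box_real by (rule set_lebesgue_integral_eq_integral(1)) (use \<gamma> in \<open>simp add: trajectories_iff\<close>)
  \<comment> \<open>The coefficient \<open>3 + (b - a)\<close> collects twice the error of the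
    Riemann sum, the excess \<open>\<eta>\<close> in the reciprocal speed over the whole interval,
    and the Henstock error.\<close>
  have bound: "\<bar>chi (\<gamma> b) - chi (\<gamma> a)\<bar> \<le> B R * (2 * ?I + (3 + (b - a)) * \<eta>)" if \<eta>: "\<eta> > 0" for \<eta>
  proof -
    have "\<eta>\<^sup>2 > 0" using \<eta> by simp
    \<comment> \<open>The tolerance is quadratic because the Henstock errors will be divided by
      \<open>\<eta>\<close>.\<close>
    from Henstock_lemma[OF i2 this] obtain g1 where g1: "gauge g1"
      "\<And>p. p tagged_partial_division_of cbox a b \<Longrightarrow> g1 fine p \<Longrightarrow>
         (\<Sum>(x,k)\<in>p. norm (measure lborel k *\<^sub>R (?w x)\<^sup>2 - integral k (\<lambda>t. (?w t)\<^sup>2))) < \<eta>\<^sup>2"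
      by blast
    have "(?w has_integral ?I) {a..b}" using i1 by (rule integrable_integral)
    from has_integral_real[THEN iffD1, OF this, rule_format, OF \<eta>] obtain g2 where g2: "gauge g2"
      "\<forall>D. D tagged_division_of {a..b} \<and> g2 fine D \<longrightarrow> norm ((\<Sum>(x,k)\<in>D. measure lborel k *\<^sub>R ?w x) - ?I) < \<eta>"
      by blast
    have "gauge (\<lambda>x. g1 x \<inter> g2 x)" using g1(1) g2(1) by (rule gauge_Int)
    then obtain D where D: "D tagged_division_of {a..b}" "(\<lambda>x. g1 x \<inter> g2 x) fine D"
      by (rule fine_division_exists_real)
    then have fine: "g1 fine D" "g2 fine D" by (auto simp: fine_Int)
    define e where "e x k = norm (measure lborel k *\<^sub>R (?w x)\<^sup>2 - integral k (\<lambda>t. (?w t)\<^sup>2))" for x k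
    have sum_e: "(\<Sum>(x,k)\<in>D. e x k) < \<eta>\<^sup>2"
      using g1(2)[OF _ fine(1)] D(1) by (simp add: e_def tagged_division_of_def)
    have sum_w: "(\<Sum>(x,k)\<in>D. measure lborel k * ?w x) \<le> ?I + \<eta>"
      using g2(2) D(1) fine(2) by fastforce
    have piece: "\<bar>chi (\<gamma> (Sup k)) - chi (\<gamma> (Inf k))\<bar> \<le> B R * (2 * (measure lborel k * ?w x) + \<eta> * measure lborel k + e x k / \<eta>)"
      if xk: "(x, k) \<in> D" for x k
    proof -
      obtain s t where st: "k = cbox s t" using tagged_division_ofD(4)[OF D(1) xk] by blast
      have x: "x \<in> k" by (rule tagged_division_ofD(2)[OF D(1) xk])
      have sub: "k \<subseteq> {a..b}" by (rule tagged_division_ofD(3)[OF D(1) xk])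
      have k: "k = {s..t}" "s \<le> t" "Inf k = s" "Sup k = t" "measure lborel k = t - s" "a \<le> s" "t \<le> b"
        using st x sub by auto
      define U where "U = integral {s..t} (\<lambda>t. (?w t)\<^sup>2)"
      \<comment> \<open>The speed is \<open>1 / c\<close>: the reciprocal of the control norm at the
        tag balances the two terms of \<open>chi_step\<close>, and the added \<open>\<eta>\<close>
        keeps \<open>c\<close> away from 0.\<close>
      define c where "c = ?w x + \<eta>"
      have c: "c > 0" "?w x \<le> c" "\<eta> \<le> c" using \<eta> by (auto simp: c_def add_nonneg_pos)
      have e: "e x k \<ge> 0" by (simp add: e_def)
      have "U \<le> (t - s) * (?w x)\<^sup>2 + e x k"
        unfolding e_def U_def using k by (simp add: abs_if)
      then have "U / c \<le> ((t - s) * (?w x)\<^sup>2 + e x k) / c" using c by (intro divide_right_mono) auto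
      also have "\<dots> = (t - s) * ((?w x)\<^sup>2 / c) + e x k / c" by (simp add: add_divide_distrib)
      also have "\<dots> \<le> (t - s) * ?w x + e x k / \<eta>"
      proof (intro add_mono mult_left_mono)
        show "(?w x)\<^sup>2 / c \<le> ?w x"
          using c by (subst pos_divide_le_eq) (auto simp: power2_eq_square mult_left_mono)
        show "e x k / c \<le> e x k / \<eta>" using c \<eta> e by (intro divide_left_mono) auto
      qed (use k in auto)
      finally have Uc: "U / c \<le> (t - s) * ?w x + e x k / \<eta>" .
      have "(\<gamma>, u) \<in> trajectories f s t" using k by (intro trajectories_subinterval[OF \<gamma>]) auto
      then have "\<bar>chi (\<gamma> t) - chi (\<gamma> s)\<bar> \<le> B R * ((t - s) / (1 / c) + (1 / c) * U)"
        unfolding U_def using k c by (intro chi_step R) auto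
      also have "\<dots> \<le> B R * (2 * ((t - s) * ?w x) + \<eta> * (t - s) + e x k / \<eta>)"
        using Uc BR by (intro mult_left_mono) (auto simp: c_def algebra_simps)
      finally show ?thesis using k by simp
    qed
    have "chi (\<gamma> b) - chi (\<gamma> a) = (\<Sum>(x,k)\<in>D. chi (\<gamma> (Sup k)) - chi (\<gamma> (Inf k)))"
      using additive_tagged_division_1[OF ab D(1), of "\<lambda>t. chi (\<gamma> t)"] by simp
    also have "\<bar>\<dots>\<bar> \<le> (\<Sum>(x,k)\<in>D. B R * (2 * (measure lborel k * ?w x) + \<eta> * measure lborel k + e x k / \<eta>))"
      using piece by (intro order_trans[OF sum_abs] sum_mono) auto
    also have "\<dots> = B R * (2 * (\<Sum>(x,k)\<in>D. measure lborel k * ?w x) + \<eta> * (\<Sum>(x,k)\<in>D. measure lborel k) + (\<Sum>(x,k)\<in>D. e x k) / \<eta>)"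
      by (simp add: case_prod_beta sum_distrib_left sum.distrib sum_divide_distrib distrib_left)
    also have "(\<Sum>(x,k)\<in>D. measure lborel k) = b - a"
      using additive_content_tagged_division[of D a b] D(1) ab by simp
    also have "B R * (2 * (\<Sum>(x,k)\<in>D. measure lborel k * ?w x) + \<eta> * (b - a) + (\<Sum>(x,k)\<in>D. e x k) / \<eta>)
        \<le> B R * (2 * ?I + (3 + (b - a)) * \<eta>)"
    proof (intro mult_left_mono BR)
      have "(\<Sum>(x,k)\<in>D. e x k) / \<eta> \<le> \<eta>\<^sup>2 / \<eta>" using sum_e \<eta> by (intro divide_right_mono) auto
      also have "\<dots> = \<eta>" using \<eta> by (simp add: power2_eq_square)
      finally show "2 * (\<Sum>(x,k)\<in>D. measure lborel k * ?w x) + \<eta> * (b - a) + (\<Sum>(x,k)\<in>D. e x k) / \<eta>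
        \<le> 2 * ?I + (3 + (b - a)) * \<eta>"
        using sum_w by (simp add: algebra_simps)
    qed
    finally show ?thesis .
  qed
  have "((\<lambda>\<eta>. B R * (2 * ?I + (3 + (b - a)) * \<eta>)) \<longlongrightarrow> B R * (2 * ?I + (3 + (b - a)) * 0)) (at_right 0)"
    by (intro tendsto_intros)
  then have "\<bar>chi (\<gamma> b) - chi (\<gamma> a)\<bar> \<le> B R * (2 * ?I + (3 + (b - a)) * 0)"
    by (rule tendsto_lowerbound) (use bound in \<open>auto simp: eventually_at_right_field intro!: exI[of _ 1]\<close>)
  then show ?thesis by (simp add: mult_ac)
qed

text \<open>A curve joining two points of the ball may make a long detour, where no bound on
  \<open>B\<close> is at hand. A short curve stays in the ball of radius \<open>R'\<close> and
  \<open>chi_length_bound\<close> applies; a curve that is not short has length bounded below, and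
  there the bound \<open>2 * Mc\<close> on the difference of values is enough.\<close>

lemma chi_lipschitz_sr_dist:
  assumes R: "R \<ge> 0"
  shows "\<exists>l\<ge>0. \<forall>x\<in>cball 0 R. \<forall>y\<in>cball 0 R. ennreal \<bar>chi x - chi y\<bar> \<le> ennreal l * sr_dist f x y"
proof -
  have "bounded (chi ` cball 0 R)"
    using chi_continuous by (intro compact_imp_bounded compact_continuous_image) (auto intro: continuous_on_subset)
  then obtain Mc where "Mc > 0" and Mc': "\<forall>y\<in>chi ` cball 0 R. norm y \<le> Mc"
    unfolding bounded_pos by blast
  then have Mc: "Mc > 0" "y \<in> cball 0 R \<Longrightarrow> \<bar>chi y\<bar> \<le> Mc" for y by auto
  let ?c = "velocity_bound TYPE('m) c"
  have velocity_bound: "?c > 0" by (rule velocity_bound_pos[OF growth c])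
  define R' where "R' = 2 * R + 1"
  have BR: "B R' \<ge> 0" using R by (intro B_nonneg) (simp add: R'_def)
  \<comment> \<open>The first term serves short curves. The second serves those with
    \<open>?c * I > 1 / 2\<close>, for which \<open>2 * Mc \<le> 4 * Mc * (?c * I)\<close>.\<close>
  define l where "l = 2 * B R' + 4 * ?c * Mc"
  have l: "l > 0" "2 * B R' \<le> l" "4 * ?c * Mc \<le> l" using BR velocity_bound Mc by (auto simp: l_def add_nonneg_pos)
  have main: "ennreal (\<bar>chi x - chi y\<bar> / l) \<le>
      (\<integral>\<^sup>+ t. ennreal_root (sr_metric f (\<gamma> t) (vector_derivative \<gamma> (at t))) \<partial>lebesgue_on {0..1})"
    if x: "x \<in> cball 0 R" and y: "y \<in> cball 0 R" and \<gamma>: "(\<gamma>, u) \<in> trajectories_between f 0 1 x y" for x y \<gamma> u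
  proof -
    have traj: "(\<gamma>, u) \<in> trajectories f 0 1" and ends: "\<gamma> 0 = x" "\<gamma> 1 = y"
      using \<gamma> by (auto simp: trajectories_between_def trajectories_from_def trajectories_to_def)
    obtain w where w: "(\<gamma>, w) \<in> trajectories f 0 1"
      "AE t in lebesgue. t \<in> {0..1} \<longrightarrow> (\<forall>u'. vector_derivative \<gamma> (at t) = velocity f (\<gamma> t) u' \<longrightarrow> norm (w t) \<le> norm u')"
      using minimal_control[OF traj] by blast
    define I where "I = (LINT t:{0..1}|lebesgue. norm (w t))"
    have I_eq: "I = integral {0..1} (\<lambda>t. norm (w t))"
      unfolding I_def by (rule set_lebesgue_integral_eq_integral(2)[OF trajectories_norm_integrable[OF w(1)]])
    have I0: "I \<ge> 0"
      unfolding I_def set_lebesgue_integral_def by (intro integral_nonneg_AE) auto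
    have "\<bar>chi x - chi y\<bar> \<le> l * I"
    proof (cases "?c * I \<le> 1 / 2")
      case True
      have "norm (\<gamma> t) \<le> R'" if "t \<in> {0..1}" for t
        using trajectories_bounded[OF growth c w(1) _ that] True x ends by (simp add: I_def R'_def)
      then have "\<bar>chi (\<gamma> 1) - chi (\<gamma> 0)\<bar> \<le> 2 * B R' * I"
        unfolding I_eq by (intro chi_length_bound[OF w(1)]) auto
      also have "\<dots> \<le> l * I" using l I0 by (intro mult_right_mono) auto
      finally show ?thesis using ends by (simp add: abs_minus_commute)
    next
      case False
      have "\<bar>chi x - chi y\<bar> \<le> 2 * Mc" using Mc(2)[OF x] Mc(2)[OF y] by linarith
      also have "\<dots> \<le> 4 * Mc * (?c * I)"
      proof -
        have "4 * Mc * (1 / 2) \<le> 4 * Mc * (?c * I)" using False Mc(1) by (intro mult_left_mono) auto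
        then show ?thesis by simp
      qed
      also have "\<dots> = 4 * ?c * Mc * I" by simp
      also have "\<dots> \<le> l * I" using l I0 by (intro mult_right_mono) auto
      finally show ?thesis .
    qed
    then have "\<bar>chi x - chi y\<bar> / l \<le> I" using l(1) by (simp add: pos_divide_le_eq mult.commute)
    then have "ennreal (\<bar>chi x - chi y\<bar> / l) \<le> ennreal I" by (rule ennreal_leI)
    also have "\<dots> \<le> (\<integral>\<^sup>+ t. ennreal_root (sr_metric f (\<gamma> t) (vector_derivative \<gamma> (at t))) \<partial>lebesgue_on {0..1})"
      unfolding I_def by (rule length_ge_minimal_control[OF w])
    finally show ?thesis .
  qed
  have "ennreal \<bar>chi x - chi y\<bar> \<le> ennreal l * sr_dist f x y" if "x \<in> cball 0 R" "y \<in> cball 0 R" for x y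
  proof -
    have "ennreal (\<bar>chi x - chi y\<bar> / l) \<le> sr_dist f x y"
      unfolding sr_dist_def using main[OF that] by (intro INF_greatest) auto
    then have "ennreal l * ennreal (\<bar>chi x - chi y\<bar> / l) \<le> ennreal l * sr_dist f x y"
      by (intro mult_left_mono) auto
    then show ?thesis using l(1) by (simp add: ennreal_mult[symmetric])
  qed
  then show ?thesis using l(1) by (intro exI[of _ l]) auto
qed

end

subsection \<open>The Lagrangian\<close>

context
  fixes L :: "(real^'d) \<times> (real^'m) \<Rightarrow> real"
  assumes C2: "Ck 2 L"
begin

lemma L_C1: "Ck (Suc 0) L"
  by (rule Ck_le[OF C2]) simp

lemma L_has_derivative_x:
  "((\<lambda>y. L (y, u)) has_derivative (\<lambda>v. frechet_derivative L (at (y, u)) (v, 0))) (at y)"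
  by (rule has_derivative_compose[OF _ Ck_Suc_has_derivative[OF L_C1], of "\<lambda>y. (y, u)"])
     (auto intro!: derivative_eq_intros)

lemma L_has_derivative_u:
  "((\<lambda>v. L (x, v)) has_derivative (\<lambda>w. frechet_derivative L (at (x, v)) (0, w))) (at v)"
  by (rule has_derivative_compose[OF _ Ck_Suc_has_derivative[OF L_C1], of "\<lambda>v. (x, v)"])
     (auto intro!: derivative_eq_intros)

lemma L_lipschitz_x:
  assumes "\<And>x u. onorm (frechet_derivative (\<lambda>y. L (y, u)) (at x)) \<le> l1 * (1 + (norm u)\<^sup>2)"
  shows "L (x, u) \<le> L (y, u) + l1 * (1 + (norm u)\<^sup>2) * norm (x - y)"
proof -
  have "norm (L (x, u) - L (y, u)) \<le> l1 * (1 + (norm u)\<^sup>2) * norm (x - y)"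
  proof (rule differentiable_bound[where S=UNIV])
    show "((\<lambda>y. L (y, u)) has_derivative frechet_derivative (\<lambda>y. L (y, u)) (at z)) (at z within UNIV)" for z
      using differentiableI[OF L_has_derivative_x[of u z]] by (simp add: frechet_derivative_works)
  qed (use assms in auto)
  then show ?thesis by simp
qed

text \<open>Along the segment from 0 to \<open>u\<close> the first derivative vanishes at the start,
  by minimality, and the second is at least \<open>(norm u)\<^sup>2 / l1\<close>; two integrations,
  in the form of monotonicity, give the factor 1/2.\<close>

lemma L_uniform_convexity:
  assumes l1: "l1 > 0"
    and conv: "\<And>x u w. frechet_derivative (\<lambda>v. frechet_derivative (\<lambda>v'. L (x, v')) (at v) w) (at u) w
              \<ge> 1 / l1 * (norm w)\<^sup>2"
    and min: "\<And>u. L (x, u) \<ge> L (x, 0)"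
  shows "L (x, u) \<ge> L (x, 0) + 1 / (2 * l1) * (norm u)\<^sup>2"
proof -
  \<comment> \<open>The partial derivative in the control is rewritten through the full derivative
    of \<open>L\<close>, whose differentiability is what \<open>C2\<close> provides.\<close>
  define h where "h v = frechet_derivative (\<lambda>v'. L (x, v')) (at v) u" for v
  have h_eq: "h v = frechet_derivative L (at (x, v)) (0, u)" for v
    unfolding h_def using frechet_derivative_at[OF L_has_derivative_u[of x v]] by metis
  have "Ck (Suc 0) (\<lambda>z. frechet_derivative L (at z) (0, u))"
    using C2 by (simp add: numeral_2_eq_2)
  note D = Ck_Suc_has_derivative[OF this]
  have "h differentiable (at v)" for v
  proof -
    have "((\<lambda>v. (x, v)) has_derivative (\<lambda>w. (0, w))) (at v)" by (auto intro!: derivative_eq_intros)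
    from differentiableI[OF has_derivative_compose[OF this D]] show ?thesis
      unfolding h_eq[abs_def] .
  qed
  then have h_der: "(h has_derivative frechet_derivative h (at v)) (at v)" for v
    using frechet_derivative_works by blast
  define Q where "Q s = frechet_derivative h (at (s *\<^sub>R u)) u" for s
  have Q: "Q s \<ge> 1 / l1 * (norm u)\<^sup>2" for s
    using conv[where x=x and w=u and u="s *\<^sub>R u"] by (simp add: Q_def h_def[abs_def])
  define g where "g s = L (x, s *\<^sub>R u)" for s
  define d where "d s = h (s *\<^sub>R u)" for s
  have line: "((\<lambda>s. s *\<^sub>R u) has_derivative (\<lambda>r. r *\<^sub>R u)) (at s)" for s :: real
    by (auto intro!: derivative_eq_intros)
  have d_der: "(d has_real_derivative Q s) (at s)" for s
  proof -
    have "(d has_derivative (\<lambda>r. frechet_derivative h (at (s *\<^sub>R u)) (r *\<^sub>R u))) (at s)"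
      unfolding d_def[abs_def] by (rule has_derivative_compose[OF line h_der])
    then show ?thesis
      by (simp add: has_field_derivative_def linear_scale[OF has_derivative_linear[OF h_der]] Q_def mult_commute_abs)
  qed
  have g_der: "(g has_real_derivative d s) (at s)" for s
  proof -
    have "(g has_derivative (\<lambda>r. frechet_derivative L (at (x, s *\<^sub>R u)) (0, r *\<^sub>R u))) (at s)"
      unfolding g_def[abs_def] by (rule has_derivative_compose[OF line L_has_derivative_u])
    moreover have "frechet_derivative L (at (x, s *\<^sub>R u)) (0, r *\<^sub>R u) = d s * r" for r
      using linear_scale[OF has_derivative_linear[OF Ck_Suc_has_derivative[OF L_C1]], of "(x, s *\<^sub>R u)" r "(0, u)"]
      by (simp add: d_def h_eq)
    ultimately show ?thesis by (simp add: has_field_derivative_def)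
  qed
  have "d 0 = 0"
    by (rule DERIV_local_min[OF g_der[of 0] zero_less_one]) (use min in \<open>auto simp: g_def\<close>)
  have d_lower: "s * (1 / l1 * (norm u)\<^sup>2) \<le> d s" if "s \<ge> 0" for s
  proof -
    have "d 0 - 0 * (1 / l1 * (norm u)\<^sup>2) \<le> d s - s * (1 / l1 * (norm u)\<^sup>2)"
    proof (rule DERIV_nonneg_imp_nondecreasing[OF that])
      fix r
      have "((\<lambda>s. d s - s * (1 / l1 * (norm u)\<^sup>2)) has_real_derivative Q r - 1 * (1 / l1 * (norm u)\<^sup>2)) (at r)"
        by (intro DERIV_diff d_der DERIV_cmult_right DERIV_ident)
      then show "\<exists>y. ((\<lambda>s. d s - s * (1 / l1 * (norm u)\<^sup>2)) has_real_derivative y) (at r) \<and> 0 \<le> y"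
        using Q[of r] by (intro exI conjI) auto
    qed
    then show ?thesis using \<open>d 0 = 0\<close> by simp
  qed
  have "g 0 - 0\<^sup>2 * (1 / (2 * l1) * (norm u)\<^sup>2) \<le> g 1 - 1\<^sup>2 * (1 / (2 * l1) * (norm u)\<^sup>2)"
  proof (rule DERIV_nonneg_imp_nondecreasing[where f="\<lambda>s. g s - s\<^sup>2 * (1 / (2 * l1) * (norm u)\<^sup>2)"])
    fix r :: real assume r: "0 \<le> r"
    have "((\<lambda>s. g s - s\<^sup>2 * (1 / (2 * l1) * (norm u)\<^sup>2)) has_real_derivative d r - (2 * r) * (1 / (2 * l1) * (norm u)\<^sup>2)) (at r)"
      using l1 by (auto intro!: derivative_eq_intros g_der)
    moreover have "(2 * r) * (1 / (2 * l1) * (norm u)\<^sup>2) = r * (1 / l1 * (norm u)\<^sup>2)"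
      using l1 by simp
    ultimately show "\<exists>y. ((\<lambda>s. g s - s\<^sup>2 * (1 / (2 * l1) * (norm u)\<^sup>2)) has_real_derivative y) (at r) \<and> 0 \<le> y"
      using d_lower[OF r] by (intro exI conjI) auto
  qed simp
  then show ?thesis by (simp add: g_def)
qed

end

text \<open>The proof derives the constants of \<open>control_problem\<close> from the assumptions.
  The Hamiltonian is taken at \<open>- p\<close> since the value functions prescribe the initial
  point: a subsolution test then says that \<open>p \<bullet> velocity + L\<close> is nonnegative
  for every control, in accordance with the dynamic programming principle.\<close>

theorem theorem6p4:
  fixes f :: "'m::finite \<Rightarrow> real^'d \<Rightarrow> real^'d"
    and L :: "(real^'d) \<times> (real^'m) \<Rightarrow> real"
    and K :: "(real^'d) set"
    and xstar :: "real^'d"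
  assumes "\<And>i. smooth (f i)"
    and "assumption_F1 f"
    and "chow_condition f"
    and "Ck 2 L"
    and "assumption_L1 L"
    and "assumption_L2 L"
    and "assumption_L3' L K"
    and "is_arg_min (\<lambda>x. L (x, 0)) (\<lambda>x. x \<in> K) xstar"
  shows "\<exists>(chi :: real^'d \<Rightarrow> real) (lam :: nat \<Rightarrow> real).
    continuous_on UNIV chi \<and>
    (\<forall>n. lam n > 0) \<and> decseq lam \<and> lam \<longlonglongrightarrow> 0 \<and>
    (\<forall>R\<ge>0. uniform_limit (cball 0 R) (\<lambda>n. discounted_value f L (lam n)) chi sequentially) \<and>
    (\<forall>x. chi x \<ge> 0) \<and> chi xstar = 0 \<and>
    (\<forall>R\<ge>0. \<exists>l\<ge>0. \<forall>x\<in>cball 0 R. \<forall>y\<in>cball 0 R.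
       ennreal \<bar>chi x - chi y\<bar> \<le> ennreal l * sr_dist f x y) \<and>
    viscosity_solution (\<lambda>x p. hamiltonian f L x (- p)) chi"
proof -
  obtain c where c: "c \<ge> 1" "\<And>x i. norm (f i x) \<le> c * (1 + norm x)"
    using assms(2) unfolding assumption_F1_def by blast
  obtain \<beta> l1 where mono: "mono_on {0..} \<beta>" and l1: "l1 > 0"
    and up: "\<And>x u. L (x, u) \<le> \<beta> (norm x) * (1 + (norm u)\<^sup>2)"
    and lip: "\<And>x u. onorm (frechet_derivative (\<lambda>y. L (y, u)) (at x)) \<le> l1 * (1 + (norm u)\<^sup>2)"
    and conv: "\<And>x u w. frechet_derivative (\<lambda>v. frechet_derivative (\<lambda>v'. L (x, v')) (at v) w) (at u) w
              \<ge> 1 / l1 * (norm w)\<^sup>2"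
    using assms(5) unfolding assumption_L1_def by blast
  have min: "L (x, u) \<ge> L (x, 0)" for x u using assms(6) unfolding assumption_L2_def by blast
  obtain y where y: "is_arg_min (\<lambda>x. L (x, 0)) (\<lambda>x. x \<in> K) y" "L (y, 0) = 0"
    and inf: "(INF x\<in>- K. ereal (L (x, 0))) > 0"
    using assms(7) unfolding assumption_L3'_def by blast
  \<comment> \<open>On \<open>K\<close> the minimum is 0; outside, the infimum is positive. With
    \<open>assumption_L2\<close> this makes \<open>L\<close> nonnegative everywhere.\<close>
  have nonneg0: "L (x, 0) \<ge> 0" for x
  proof (cases "x \<in> K")
    case True
    then show ?thesis using y by (auto simp: is_arg_min_def not_less)
  next
    case False
    then have "(INF x\<in>- K. ereal (L (x, 0))) \<le> ereal (L (x, 0))" by (intro INF_lower) simp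
    then have "0 < ereal (L (x, 0))" using inf by order
    then show ?thesis by simp
  qed
  \<comment> \<open>\<open>y\<close> and \<open>xstar\<close> both minimize over \<open>K\<close>,
    so they share the minimal value 0.\<close>
  have xs: "L (xstar, 0) = 0"
  proof -
    have "\<not> L (y, 0) < L (xstar, 0)" using assms(8) y(1) by (auto simp: is_arg_min_def)
    then show ?thesis using y(2) nonneg0[of xstar] by simp
  qed
  have lower: "L (x, u) \<ge> L (x, 0) + 1 / (2 * l1) * (norm u)\<^sup>2" for x u
    by (rule L_uniform_convexity[OF assms(4) l1 conv min])
  \<comment> \<open>The coercivity constant is half the convexity constant, and the growth function
    on balls is \<open>\<beta>\<close>, by monotonicity.\<close>
  interpret control_problem f L c "1 / (2 * l1)" l1 \<beta> xstar
  proof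
    show "L (x, u) \<ge> 0" for x u using min[of x u] nonneg0[of x] by simp
    show "L (x, u) \<le> \<beta> R * (1 + (norm u)\<^sup>2)" if "norm x \<le> R" for x u R
    proof -
      have "0 \<le> R" using that norm_ge_zero[of x] by linarith
      then have "\<beta> (norm x) \<le> \<beta> R" using mono that by (intro mono_onD[of "{0..}" \<beta>]) auto
      then have "\<beta> (norm x) * (1 + (norm u)\<^sup>2) \<le> \<beta> R * (1 + (norm u)\<^sup>2)"
        by (intro mult_right_mono) auto
      then show ?thesis using up[of x u] by simp
    qed
    show "1 / (2 * l1) * (norm u)\<^sup>2 \<le> L (x, u)" for x u using lower[of x u] nonneg0[of x] by simp
    show "L (x, u) \<le> L (y, u) + l1 * (1 + (norm u)\<^sup>2) * norm (x - y)" for x y u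
      by (rule L_lipschitz_x[OF assms(4) lip])
    show "continuous_on UNIV L" by (rule Ck_continuous[OF assms(4)])
  qed (use assms(1,3) c l1 xs in auto)
  show ?thesis
    using chi_continuous discount uniform_limit_chi[OF compact_cball] chi_nonneg chi_xstar
      chi_lipschitz_sr_dist chi_viscosity_solution
    by (intro exI[of _ chi] exI[of _ discount]) blast
qed

end
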